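(* Let $d \geq 1$ be an integer, let $\alpha \in (1,2)$, let $\nu_\alpha$ be a non-degenerate symmetric $\alpha$-stable L\'evy measure on $\mathbb{R}^d$ and let $p \in (1, +\infty)$. Then $$W^{\alpha-1,p}(\mathbb{R}^d,dx) = \overline{\mathcal{C}^{\infty}_c(\mathbb{R}^d)}^{\|\cdot\|_{\alpha-1,p}},$$ i.e. the space $W^{\alpha-1,p}(\mathbb{R}^d,dx)$ is the closure of $\mathcal{C}_c^\infty(\mathbb{R}^d)$ with respect to the norm $\|\cdot\|_{\alpha-1,p}$.
   Context: $\langle\cdot;\cdot\rangle$ between vectors is the Euclidean inner product, and $\mathbb{S}^{d-1}$ the Euclidean unit sphere. A symmetric $\alpha$-stable L\'evy measure is $\nu_\alpha(B)=\int_{\mathbb{S}^{d-1}}\int_0^{+\infty} \mathbf{1}_B(ry)\,\frac{dr}{r^{\alpha+1}}\,\sigma(dy)$, where $\sigma$ is a finite positive symmetric ($\sigma(B)=\sigma(-B)$) Borel measure on $\mathbb{S}^{d-1}$. With $\lambda_1 = -\cos(\alpha\pi/2)\frac{\Gamma(2-\alpha)}{\alpha(\alpha-1)}\sigma$, it is non-degenerate if $\inf_{y\in\mathbb{S}^{d-1}}\int_{\mathbb{S}^{d-1}}|\langle y;x\rangle|^\alpha\lambda_1(dx)>0$. Fractional gradient: for $f\in\mathcal{S}(\mathbb{R}^d)$, $D^{\alpha-1}(f)(x)=\int_{\mathbb{R}^d}(f(x+u)-f(x))\,u\,\nu_\alpha(du)$. For $f\in L^p(\mathbb{R}^d,dx)$,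 $p\in[1,+\infty)$, $D^{\alpha-1}(f)=(D_1^{\alpha-1}(f),\dots,D_d^{\alpha-1}(f))$ is the $\mathbb{R}^d$-valued tempered distribution with components $\langle D^{\alpha-1}_k(f);\varphi\rangle=\int_{\mathbb{R}^d}f(x)(D^{\alpha-1}_k)^*(\varphi)(x)dx$, $\varphi\in\mathcal{S}(\mathbb{R}^d)$, where $(D^{\alpha-1}_k)^*(\varphi)(x)=\int_{\mathbb{R}^d}(\varphi(x-u)-\varphi(x))u_k\nu_\alpha(du)$. The non-homogeneous fractional Sobolev space is $$W^{\alpha-1,p}(\mathbb{R}^d,dx)=\{f\in L^p(\mathbb{R}^d,dx):\ D_k^{\alpha-1}(f)\in L^p(\mathbb{R}^d,dx)\ \text{for all } k\in\{1,\dots,d\}\},$$ with norm $\|f\|_{\alpha-1,p}=\left(\|f\|^p_{L^p(\mathbb{R}^d,dx)}+\sum_{k=1}^d\|D_k^{\alpha-1}(f)\|^p_{L^p(\mathbb{R}^d,dx)}\right)^{1/p}$. *)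

theory Defs
  imports "HOL-Analysis.Analysis"
begin

section \<open>Smooth, Schwartz and test functions\<close>

definition partial_deriv :: "'n::finite \<Rightarrow> (real ^ 'n \<Rightarrow> real) \<Rightarrow> real ^ 'n \<Rightarrow> real" where
  "partial_deriv k f x = frechet_derivative f (at x) (axis k 1)"

text \<open>A list of indices plays the role of a multi-index.\<close>

primrec iter_partial_deriv :: "'n::finite list \<Rightarrow> (real ^ 'n \<Rightarrow> real) \<Rightarrow> real ^ 'n \<Rightarrow> real" where
  "iter_partial_deriv [] f = f"
| "iter_partial_deriv (k # ks) f = partial_deriv k (iter_partial_deriv ks f)"

definition smooth :: "(real ^ 'n::finite \<Rightarrow> real) \<Rightarrow> bool" where
  "smooth f \<longleftrightarrow> (\<forall>ks. iter_partial_deriv ks f differentiable_on UNIV)"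

definition schwartz_space :: "(real ^ 'n::finite \<Rightarrow> real) set" where
  "schwartz_space = {f. smooth f \<and>
     (\<forall>m::nat. \<forall>ks. bounded (range (\<lambda>x. norm x ^ m * iter_partial_deriv ks f x)))}"

definition test_functions :: "(real ^ 'n::finite \<Rightarrow> real) set" where
  "test_functions = {f. smooth f \<and> compact (closure {x. f x \<noteq> 0})}"


section \<open>Symmetric stable Levy measures\<close>

definition symmetric_spherical_measure :: "(real ^ 'n::finite) measure \<Rightarrow> bool" where
  "symmetric_spherical_measure \<sigma> \<longleftrightarrow>
     finite_measure \<sigma> \<and> sets \<sigma> = sets (restrict_space borel (sphere 0 1)) \<and>
     (\<forall>B\<in>sets \<sigma>. emeasure \<sigma> (uminus ` B) = emeasure \<sigma> B)"

definition symmetric_stable_levy_measure ::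
    "real \<Rightarrow> (real ^ 'n::finite) measure \<Rightarrow> (real ^ 'n) measure \<Rightarrow> bool" where
  "symmetric_stable_levy_measure \<alpha> \<sigma> \<nu> \<longleftrightarrow>
     symmetric_spherical_measure \<sigma> \<and> sets \<nu> = sets borel \<and>
     (\<forall>B\<in>sets borel. emeasure \<nu> B =
        (\<integral>\<^sup>+y. (\<integral>\<^sup>+r\<in>{0<..}. ennreal (indicator B (r *\<^sub>R y) / r powr (\<alpha> + 1)) \<partial>lborel) \<partial>\<sigma>))"

definition spectral_measure :: "real \<Rightarrow> (real ^ 'n::finite) measure \<Rightarrow> (real ^ 'n) measure" where
  "spectral_measure \<alpha> \<sigma> =
     scale_measure (ennreal (- cos (\<alpha> * pi / 2) * (Gamma (2 - \<alpha>) / (\<alpha> * (\<alpha> - 1))))) \<sigma>"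

definition nondegenerate :: "real \<Rightarrow> (real ^ 'n::finite) measure \<Rightarrow> bool" where
  "nondegenerate \<alpha> \<sigma> \<longleftrightarrow>
     (INF y\<in>sphere 0 1. LINT x|spectral_measure \<alpha> \<sigma>. \<bar>y \<bullet> x\<bar> powr \<alpha>) > 0"


section \<open>Fractional Sobolev spaces\<close>

text \<open>
  Elements of \<open>L\<^sup>p\<close> are functions rather than classes modulo equality almost everywhere, so that
  the norms below are seminorms on functions.
\<close>

definition Lp_space :: "real \<Rightarrow> (real ^ 'n::finite \<Rightarrow> real) set" where
  "Lp_space p = {f \<in> borel_measurable lborel. integrable lborel (\<lambda>x. \<bar>f x\<bar> powr p)}"

definition frac_deriv_adj ::
    "(real ^ 'n::finite) measure \<Rightarrow> 'n \<Rightarrow> (real ^ 'n \<Rightarrow> real) \<Rightarrow> real ^ 'n \<Rightarrow> real" where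
  "frac_deriv_adj \<nu> k \<phi> x = (LINT u|\<nu>. (\<phi> (x - u) - \<phi> x) * u $ k)"

text \<open>
  The \<open>k\<close>-th component of the fractional gradient of \<open>f\<close>, as a functional that is applied to
  Schwartz functions only.
\<close>

definition frac_deriv_distr ::
    "(real ^ 'n::finite) measure \<Rightarrow> 'n \<Rightarrow> (real ^ 'n \<Rightarrow> real) \<Rightarrow> (real ^ 'n \<Rightarrow> real) \<Rightarrow> real" where
  "frac_deriv_distr \<nu> k f \<phi> = (LINT x|lborel. f x * frac_deriv_adj \<nu> k \<phi> x)"

definition represents :: "(real ^ 'n::finite \<Rightarrow> real) \<Rightarrow> ((real ^ 'n \<Rightarrow> real) \<Rightarrow> real) \<Rightarrow> bool" where
  "represents g T \<longleftrightarrow> (\<forall>\<phi>\<in>schwartz_space. T \<phi> = (LINT x|lborel. g x * \<phi> x))"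

definition frac_sobolev ::
    "(real ^ 'n::finite) measure \<Rightarrow> real \<Rightarrow> (real ^ 'n \<Rightarrow> real) set" where
  "frac_sobolev \<nu> p =
     {f \<in> Lp_space p. \<forall>k. \<exists>g\<in>Lp_space p. represents g (frac_deriv_distr \<nu> k f)}"

text \<open>
  For \<open>f\<close> in the Sobolev space: a function in \<open>L\<^sup>p\<close> that represents the distribution above. It is
  determined up to equality almost everywhere.
\<close>

definition frac_deriv ::
    "(real ^ 'n::finite) measure \<Rightarrow> real \<Rightarrow> 'n \<Rightarrow> (real ^ 'n \<Rightarrow> real) \<Rightarrow> real ^ 'n \<Rightarrow> real" where
  "frac_deriv \<nu> p k f = (SOME g. g \<in> Lp_space p \<and> represents g (frac_deriv_distr \<nu> k f))"

definition frac_sobolev_norm ::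
    "(real ^ 'n::finite) measure \<Rightarrow> real \<Rightarrow> (real ^ 'n \<Rightarrow> real) \<Rightarrow> real" where
  "frac_sobolev_norm \<nu> p f =
     ((LINT x|lborel. \<bar>f x\<bar> powr p) +
      (\<Sum>k\<in>UNIV. LINT x|lborel. \<bar>frac_deriv \<nu> p k f x\<bar> powr p)) powr (1 / p)"

text \<open>
  The norm is meaningful (finite) on the Sobolev space only. The closure is taken in \<open>L\<^sup>p\<close>, and
  closeness of \<open>f\<close> to \<open>\<phi>\<close> includes that \<open>f - \<phi>\<close> lies in the Sobolev space; that \<open>A\<close> or its
  closure is contained in the Sobolev space is not built in.
\<close>

definition frac_sobolev_closure ::
    "(real ^ 'n::finite) measure \<Rightarrow> real \<Rightarrow> (real ^ 'n \<Rightarrow> real) set \<Rightarrow> (real ^ 'n \<Rightarrow> real) set" where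
  "frac_sobolev_closure \<nu> p A =
     {f \<in> Lp_space p. \<forall>\<epsilon>>0. \<exists>\<phi>\<in>A. (\<lambda>x. f x - \<phi> x) \<in> frac_sobolev \<nu> p \<and>
        frac_sobolev_norm \<nu> p (\<lambda>x. f x - \<phi> x) < \<epsilon>}"

end

(*
  Commutator argument. Truncating f by a slowly varying test function chi(x / R) produces the
  error D(chi f) - chi D(f), whose value at x is the integral of
  f(x + u) (chi((x + u) / R) - chi(x / R)) u nu(du). By Jensen and Fubini its L^p norm is at most
  the L^p norm of f times the integral of min(2, L |u| / R) |u| nu(du), which tends to 0 by
  dominated convergence because min(|u|, |u|^2) is nu-integrable for 1 < alpha < 2. A compactly
  supported f is then mollified, and D(f * rho) = D(f) * rho follows from the translation
  invariance of D^* on Schwartz functions.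
*)
theory Submission
  imports Defs
begin

section \<open>Smooth functions\<close>

text \<open>D(f) is only a functional on Schwartz functions, and the two terms of the difference
  under the integral over nu do not converge separately in general. So every identity is proved
  after pairing with a Schwartz function phi: Fubini moves the x-integral inside, and for fixed u
  the two terms do separate and a translation in x does the work. The effort lies in joint
  integrability, which is why nu is traded for a finite measure and differences of phi are bounded
  by decaying majorants. The cutoff has to come before the mollification: a function in L^p need not
  be integrable, and only bounded support makes its convolution with a mollifier a test function.
  D(chi f) itself has no bounded support in general, and none is used. The norm refers to a chosen
  representative of each component of D(f); mollification also shows that representatives agree
  almost everywhere, so explicit ones may replace the choice. For the converse inclusion the closure
  already provides f - phi in the Sobolev space, and what remains is that test functions belong to
  it.\<close>

lemma iter_partial_deriv_append:
  "iter_partial_deriv (ks @ ls) f = iter_partial_deriv ks (iter_partial_deriv ls f)"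
  by (induction ks) auto

text \<open>Products, bumps and convolutions have no convenient formula for their higher
  derivatives. With this rule it suffices to exhibit a class of differentiable functions that one
  differentiation does not leave.\<close>

lemma smooth_coinduct:
  assumes "f \<in> S"
    and "\<And>g. g \<in> S \<Longrightarrow> g differentiable_on UNIV"
    and "\<And>g k. g \<in> S \<Longrightarrow> partial_deriv k g \<in> S"
  shows "smooth f"
proof -
  have "iter_partial_deriv ks f \<in> S" for ks
    by (induction ks) (use assms in auto)
  then show ?thesis
    using assms(2) by (auto simp: smooth_def)
qed

lemma smooth_differentiable_on: "smooth f \<Longrightarrow> f differentiable_on UNIV"
  unfolding smooth_def by (metis iter_partial_deriv.simps(1))

lemma smooth_continuous_on: "smooth f \<Longrightarrow> continuous_on UNIV f"
  by (intro differentiable_imp_continuous_on smooth_differentiable_on)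

lemma smooth_borel_measurable [measurable]: "smooth f \<Longrightarrow> f \<in> borel_measurable borel"
  by (intro borel_measurable_continuous_onI smooth_continuous_on)

lemma smooth_iter_partial_deriv: "smooth f \<Longrightarrow> smooth (iter_partial_deriv ks f)"
  unfolding smooth_def by (metis iter_partial_deriv_append)

lemma smooth_partial_deriv: "smooth f \<Longrightarrow> smooth (partial_deriv k f)"
  using smooth_iter_partial_deriv[of f "[k]"] by simp

lemma partial_deriv_eqI:
  "(f has_derivative f') (at x) \<Longrightarrow> partial_deriv k f x = f' (axis k 1)"
  by (metis frechet_derivative_at partial_deriv_def)

lemma has_derivative_partial_deriv:
  fixes f :: "real ^ 'n::finite \<Rightarrow> real"
  assumes "f differentiable_on UNIV"
  shows "(f has_derivative (\<lambda>h. \<Sum>k\<in>UNIV. h $ k * partial_deriv k f x)) (at x)"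
proof -
  let ?D = "frechet_derivative f (at x)"
  have D: "(f has_derivative ?D) (at x)"
    using assms by (simp add: differentiable_on_def frechet_derivative_works)
  then interpret D: linear ?D
    by (rule has_derivative_linear)
  have "?D h = (\<Sum>k\<in>UNIV. h $ k * partial_deriv k f x)" for h
  proof -
    have "?D h = ?D (\<Sum>k\<in>UNIV. h $ k *\<^sub>R axis k 1)"
      using basis_expansion[of h] by (simp add: scalar_mult_eq_scaleR)
    then show ?thesis
      by (simp add: D.sum D.scaleR partial_deriv_def)
  qed
  then show ?thesis
    using D by (metis (no_types, lifting) ext)
qed

lemma
  fixes f g :: "real ^ 'n::finite \<Rightarrow> real"
  assumes f: "f differentiable_on UNIV" and g: "g differentiable_on UNIV"
  shows partial_deriv_add:
      "partial_deriv k (\<lambda>x. f x + g x) = (\<lambda>x. partial_deriv k f x + partial_deriv k g x)"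
    and partial_deriv_mult:
      "partial_deriv k (\<lambda>x. f x * g x) = (\<lambda>x. f x * partial_deriv k g x + partial_deriv k f x * g x)"
proof -
  have "(f has_derivative frechet_derivative f (at x)) (at x)"
    "(g has_derivative frechet_derivative g (at x)) (at x)" for x
    using f g by (simp_all add: differentiable_on_def frechet_derivative_works)
  note D = has_derivative_add[OF this] has_derivative_mult[OF this]
  show "partial_deriv k (\<lambda>x. f x + g x) = (\<lambda>x. partial_deriv k f x + partial_deriv k g x)"
    by (rule ext, subst partial_deriv_eqI[OF D(1)]) (simp add: partial_deriv_def)
  show "partial_deriv k (\<lambda>x. f x * g x) = (\<lambda>x. f x * partial_deriv k g x + partial_deriv k f x * g x)"
    by (rule ext, subst partial_deriv_eqI[OF D(2)]) (simp add: partial_deriv_def)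
qed

text \<open>
  The span of the products of two smooth functions is closed under partial derivatives; this
  replaces the Leibniz formula for higher derivatives.
\<close>

inductive_set smooth_products :: "(real ^ 'n::finite \<Rightarrow> real) set" where
  mult: "smooth f \<Longrightarrow> smooth g \<Longrightarrow> (\<lambda>x. f x * g x) \<in> smooth_products"
| add: "f \<in> smooth_products \<Longrightarrow> g \<in> smooth_products \<Longrightarrow> (\<lambda>x. f x + g x) \<in> smooth_products"

lemma smooth_mult:
  assumes "smooth f" "smooth g"
  shows "smooth (\<lambda>x. f x * g x)"
proof -
  have *: "h differentiable_on UNIV \<and> (\<forall>k. partial_deriv k h \<in> smooth_products)"
    if "h \<in> smooth_products" for h :: "real ^ 'a \<Rightarrow> real"
    using that
  proof induction
    case (mult f g)
    then show ?case
      by (auto simp: partial_deriv_mult smooth_differentiable_on smooth_partial_deriv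
          intro!: differentiable_on_mult smooth_products.intros)
  next
    case (add f g)
    then show ?case
      by (auto simp: partial_deriv_add intro!: differentiable_on_add smooth_products.intros)
  qed
  show ?thesis
    by (rule smooth_coinduct[where S = smooth_products])
       (use * assms in \<open>auto intro: smooth_products.intros\<close>)
qed

lemma smooth_const: "smooth (\<lambda>x. c)"
  by (rule smooth_coinduct[where S = "range (\<lambda>c x. c)"])
     (auto simp: partial_deriv_eqI[OF has_derivative_const] fun_eq_iff)

text \<open>Translations (\<open>c = 1\<close>), reflections (\<open>c = -1\<close>) and dilations
  are treated at once; each differentiation pulls out one factor \<open>c\<close> by the chain
  rule.\<close>

lemma iter_partial_deriv_affine:
  fixes f :: "real ^ 'n::finite \<Rightarrow> real"
  assumes "smooth f"
  shows "iter_partial_deriv ks (\<lambda>x. f (a + c *\<^sub>R x)) =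
    (\<lambda>x. c ^ length ks * iter_partial_deriv ks f (a + c *\<^sub>R x))"
proof (induction ks)
  case (Cons k ks)
  have D: "((\<lambda>x. c ^ length ks * iter_partial_deriv ks f (a + c *\<^sub>R x)) has_derivative
      (\<lambda>h. c ^ length ks * (\<Sum>k\<in>UNIV. (c *\<^sub>R h) $ k * partial_deriv k (iter_partial_deriv ks f) (a + c *\<^sub>R x)))) (at x)"
    for x
  proof (intro has_derivative_mult_right)
    have "((\<lambda>x. a + c *\<^sub>R x) has_derivative (\<lambda>h. c *\<^sub>R h)) (at x)"
      by (auto intro!: derivative_eq_intros)
    then show "((\<lambda>x. iter_partial_deriv ks f (a + c *\<^sub>R x)) has_derivative
       (\<lambda>h. \<Sum>k\<in>UNIV. (c *\<^sub>R h) $ k * partial_deriv k (iter_partial_deriv ks f) (a + c *\<^sub>R x))) (at x)"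
      by (rule has_derivative_compose)
         (intro has_derivative_partial_deriv smooth_differentiable_on smooth_iter_partial_deriv assms)
  qed
  show ?case
    by (rule ext) (simp add: Cons partial_deriv_eqI[OF D] axis_def if_distrib if_distribR sum.delta cong: if_cong)
qed simp

lemma smooth_affine:
  fixes f :: "real ^ 'n::finite \<Rightarrow> real"
  assumes "smooth f"
  shows "smooth (\<lambda>x. f (a + c *\<^sub>R x))"
proof -
  have "iter_partial_deriv ks f differentiable at y" for ks y
    using assms by (simp add: smooth_def differentiable_on_def)
  then have "(\<lambda>x. iter_partial_deriv ks f (a + c *\<^sub>R x)) differentiable at x" for ks x
    by (rule differentiable_compose) (simp_all add: differentiable_def, auto intro!: derivative_eq_intros)
  then show ?thesis
    unfolding smooth_def iter_partial_deriv_affine[OF assms] differentiable_on_def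
    by simp
qed

section \<open>A flat function and the smooth bump\<close>

text \<open>For \<open>m = 0\<close> this is the classical flat function. Differentiating exp(-1/t)
  produces negative powers of t; the index \<open>m\<close> records them and makes the span of the
  family closed under derivatives.\<close>

definition flat_at_zero :: "nat \<Rightarrow> real \<Rightarrow> real" where
  "flat_at_zero m t = (if 0 < t then exp (- 1 / t) / t ^ m else 0)"

lemma flat_at_zero_tendsto: "(flat_at_zero m \<longlongrightarrow> 0) (at 0)"
proof (rule filterlim_split_at)
  show "(flat_at_zero m \<longlongrightarrow> 0) (at_left 0)"
    by (rule tendsto_eventually)
       (auto simp: eventually_at_left_field flat_at_zero_def intro!: exI[of _ "-1"])
  have "((\<lambda>t. (inverse t) ^ m / exp (inverse t)) \<longlongrightarrow> 0) (at_right (0::real))"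
    by (rule filterlim_compose[OF tendsto_power_div_exp_0 filterlim_inverse_at_top_right])
  moreover have "\<forall>\<^sub>F t in at_right 0. (inverse t) ^ m / exp (inverse t) = flat_at_zero m t"
    by (auto simp: eventually_at_right_field flat_at_zero_def field_simps exp_minus intro!: exI[of _ 1])
  ultimately show "(flat_at_zero m \<longlongrightarrow> 0) (at_right 0)"
    by (rule Lim_transform_eventually)
qed

lemma flat_at_zero_deriv:
  "(flat_at_zero m has_real_derivative flat_at_zero (m + 2) t - real m * flat_at_zero (m + 1) t) (at t)"
proof (cases t "0::real" rule: linorder_cases)
  case less
  have "((\<lambda>t. 0) has_real_derivative 0) (at t)" by simp
  then have "(flat_at_zero m has_real_derivative 0) (at t)"
    by (rule has_field_derivative_transform_within_open[where S = "{..<0}"])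
       (use less in \<open>auto simp: flat_at_zero_def\<close>)
  then show ?thesis using less by (simp add: flat_at_zero_def)
next
  case equal
  \<comment> \<open>At 0 the difference quotient of index \<open>m\<close> is exactly the member of
    index \<open>m + 1\<close>, whose limit is already known.\<close>
  have "flat_at_zero (m + 1) h = (flat_at_zero m (0 + h) - flat_at_zero m 0) / h" if "h \<noteq> 0" for h
    using that by (simp add: flat_at_zero_def field_simps)
  then have "((\<lambda>h. (flat_at_zero m (0 + h) - flat_at_zero m 0) / h) \<longlongrightarrow> 0) (at 0)"
    by (intro Lim_transform_eventually[OF flat_at_zero_tendsto[of "m + 1"]])
       (simp add: eventually_at_filter)
  then show ?thesis
    using equal by (simp add: DERIV_def flat_at_zero_def)
next
  case greater
  have "((\<lambda>t. exp (- 1 / t) / t ^ m) has_real_derivative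
      flat_at_zero (m + 2) t - real m * flat_at_zero (m + 1) t) (at t)"
    using greater
    by (auto intro!: derivative_eq_intros simp: flat_at_zero_def field_simps power2_eq_square)
       (cases m; simp add: field_simps power2_eq_square)
  then show ?thesis
    by (rule has_field_derivative_transform_within_open[where S = "{0<..}"])
       (use greater in \<open>auto simp: flat_at_zero_def\<close>)
qed

text \<open>
  The same device for the bump \<open>exp (- 1 / (1 - \<bar>x\<bar>\<^sup>2))\<close>: its partial derivatives stay in the algebra
  generated by the coordinates and the functions \<open>flat_at_zero m (1 - \<bar>x\<bar>\<^sup>2)\<close>.
\<close>

inductive_set bump_algebra :: "(real ^ 'n::finite \<Rightarrow> real) set" where
  flat: "(\<lambda>x. flat_at_zero m (1 - x \<bullet> x)) \<in> bump_algebra"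
| coord: "(\<lambda>x. x $ k) \<in> bump_algebra"
| const: "(\<lambda>x. c) \<in> bump_algebra"
| add: "f \<in> bump_algebra \<Longrightarrow> g \<in> bump_algebra \<Longrightarrow> (\<lambda>x. f x + g x) \<in> bump_algebra"
| mult: "f \<in> bump_algebra \<Longrightarrow> g \<in> bump_algebra \<Longrightarrow> (\<lambda>x. f x * g x) \<in> bump_algebra"

lemma smooth_bump: "smooth (\<lambda>x :: real ^ 'n::finite. flat_at_zero m (1 - x \<bullet> x))"
proof -
  have *: "h differentiable_on UNIV \<and> (\<forall>k. partial_deriv k h \<in> bump_algebra)"
    if "h \<in> bump_algebra" for h :: "real ^ 'n \<Rightarrow> real"
    using that
  proof induction
    case (flat m)
    have D: "((\<lambda>x :: real ^ 'n. flat_at_zero m (1 - x \<bullet> x)) has_derivative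
       (\<lambda>h. (- (x \<bullet> h + h \<bullet> x)) * (flat_at_zero (m + 2) (1 - x \<bullet> x) - real m * flat_at_zero (m + 1) (1 - x \<bullet> x)))) (at x)"
      for x
    proof -
      have "((\<lambda>x :: real ^ 'n. 1 - x \<bullet> x) has_derivative (\<lambda>h. - (x \<bullet> h + h \<bullet> x))) (at x)"
        by (auto intro!: derivative_eq_intros)
      from has_derivative_compose[OF this flat_at_zero_deriv[of m, unfolded has_field_derivative_def]]
      show ?thesis by (simp add: mult.commute)
    qed
    have "partial_deriv k (\<lambda>x :: real ^ 'n. flat_at_zero m (1 - x \<bullet> x)) =
       (\<lambda>x. (- 2 * x $ k) * (flat_at_zero (m + 2) (1 - x \<bullet> x) + (- real m) * flat_at_zero (m + 1) (1 - x \<bullet> x)))" for k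
      by (rule ext, subst partial_deriv_eqI[OF D]) (simp add: inner_axis inner_commute[of "axis _ _"] algebra_simps)
    moreover have "(\<lambda>x. (- 2 * x $ k) * (flat_at_zero (m + 2) (1 - x \<bullet> x) + (- real m) * flat_at_zero (m + 1) (1 - x \<bullet> x)))
        \<in> bump_algebra" for k
      by (intro bump_algebra.intros)
    moreover have "(\<lambda>x :: real ^ 'n. flat_at_zero m (1 - x \<bullet> x)) differentiable_on UNIV"
      unfolding differentiable_on_def differentiable_def using D by blast
    ultimately show ?case
      by (intro conjI allI) (simp_all only:)
  next
    case (coord k)
    have D: "((\<lambda>x :: real ^ 'n. x $ k) has_derivative (\<lambda>h. h $ k)) (at x)" for x
      by (intro bounded_linear_imp_has_derivative bounded_linear_vec_nth)
    then have "partial_deriv j (\<lambda>x :: real ^ 'n. x $ k) = (\<lambda>x. axis j 1 $ k)" for j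
      by (intro ext partial_deriv_eqI)
    moreover have "(\<lambda>x :: real ^ 'n. x $ k) differentiable_on UNIV"
      unfolding differentiable_on_def differentiable_def using D by blast
    ultimately show ?case
      by (simp add: bump_algebra.const)
  next
    case (const c)
    have "partial_deriv k (\<lambda>x :: real ^ 'n. c) = (\<lambda>x. 0)" for k
      by (auto simp: partial_deriv_eqI[OF has_derivative_const])
    then show ?case
      using bump_algebra.const by (metis differentiable_on_const)
  next
    case (add f g)
    then show ?case
      by (auto simp: partial_deriv_add intro!: differentiable_on_add bump_algebra.intros)
  next
    case (mult f g)
    then show ?case
      by (auto simp: partial_deriv_mult intro!: differentiable_on_mult bump_algebra.intros)
  qed
  show ?thesis
    by (rule smooth_coinduct[where S = bump_algebra])
       (use * in \<open>auto intro: bump_algebra.intros\<close>)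
qed

section \<open>Test functions and Schwartz functions\<close>

lemma test_functions_iff:
  "f \<in> test_functions \<longleftrightarrow> smooth f \<and> (\<exists>R. \<forall>x. R < norm x \<longrightarrow> f x = 0)"
proof -
  have "bounded {x. f x \<noteq> 0} \<longleftrightarrow> (\<exists>R. \<forall>x. R < norm x \<longrightarrow> f x = 0)"
    unfolding bounded_iff mem_Collect_eq Ball_def not_le[symmetric] by (intro ex_cong1) auto
  then show ?thesis
    by (simp add: test_functions_def compact_closure)
qed

lemma test_function_smooth: "f \<in> test_functions \<Longrightarrow> smooth f"
  by (simp add: test_functions_def)

lemma test_function_support:
  assumes "f \<in> test_functions"
  obtains R where "0 < R" "\<And>x. R < norm x \<Longrightarrow> f x = 0"
proof -
  obtain R where "\<forall>x. R < norm x \<longrightarrow> f x = 0"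
    using assms by (auto simp: test_functions_iff)
  then show ?thesis
    using that[of "max R 1"] by auto
qed

lemma test_function_bounded:
  fixes f :: "real ^ 'n::finite \<Rightarrow> real"
  assumes "f \<in> test_functions"
  obtains B where "0 < B" "\<And>x. \<bar>f x\<bar> \<le> B"
proof -
  obtain R where "0 < R" and R: "\<And>x. R < norm x \<Longrightarrow> f x = 0"
    using assms by (rule test_function_support) (blast intro: that)
  have "compact (f ` cball 0 R)"
    using smooth_continuous_on[OF test_function_smooth[OF assms]]
    by (intro compact_continuous_image compact_cball) (blast intro: continuous_on_subset)
  then obtain B where "0 < B" and B: "\<forall>x\<in>cball 0 R. \<bar>f x\<bar> \<le> B"
    using compact_imp_bounded bounded_pos by (metis (no_types, lifting) imageI real_norm_def)
  have "\<bar>f x\<bar> \<le> B" for x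
    using R[of x] B \<open>0 < B\<close> by (cases "R < norm x") auto
  with \<open>0 < B\<close> show ?thesis by (rule that)
qed

lemma test_function_partial_deriv:
  assumes "f \<in> test_functions"
  shows "partial_deriv k f \<in> test_functions"
proof -
  obtain R where "0 < R" and R: "\<And>x. R < norm x \<Longrightarrow> f x = 0"
    using assms by (rule test_function_support) (blast intro: that)
  have "partial_deriv k f x = 0" if "R < norm x" for x
  proof -
    have "open {x. R < norm x}"
      by (intro open_Collect_less continuous_intros)
    then have "(f has_derivative (\<lambda>h. 0)) (at x)"
      using R that
      by (intro has_derivative_transform_within_open[OF has_derivative_const, of "{x. R < norm x}"]) auto
    then show ?thesis
      by (simp add: partial_deriv_eqI)
  qed
  then show ?thesis
    using assms by (auto simp: test_functions_iff intro: smooth_partial_deriv)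
qed

lemma test_function_iter_partial_deriv:
  "f \<in> test_functions \<Longrightarrow> iter_partial_deriv ks f \<in> test_functions"
  by (induction ks) (auto intro: test_function_partial_deriv)

lemma test_functions_subset_schwartz: "test_functions \<subseteq> schwartz_space"
proof
  fix f :: "real ^ 'a \<Rightarrow> real"
  assume f: "f \<in> test_functions"
  have "bounded (range (\<lambda>x. norm x ^ m * iter_partial_deriv ks f x))" for m ks
  proof -
    let ?g = "iter_partial_deriv ks f"
    have g: "?g \<in> test_functions"
      using f by (rule test_function_iter_partial_deriv)
    obtain R where R: "0 < R" "\<And>x. R < norm x \<Longrightarrow> ?g x = 0"
      using g by (rule test_function_support) (blast intro: that)
    obtain B where B: "0 < B" "\<And>x. \<bar>?g x\<bar> \<le> B"
      using g by (rule test_function_bounded) (blast intro: that)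
    have "norm (norm x ^ m * ?g x) \<le> R ^ m * B" for x
    proof (cases "R < norm x")
      case False
      then show ?thesis
        using R B by (auto simp: abs_mult intro!: mult_mono power_mono)
    qed (use R B in auto)
    then show ?thesis
      unfolding bounded_iff by blast
  qed
  then show "f \<in> schwartz_space"
    using f by (simp add: schwartz_space_def test_function_smooth)
qed

lemma test_function_mult:
  assumes "f \<in> test_functions" "smooth g"
  shows "(\<lambda>x. f x * g x) \<in> test_functions"
  using assms smooth_mult[of f g] by (fastforce simp: test_functions_iff)

lemma test_function_affine:
  fixes f :: "real ^ 'n::finite \<Rightarrow> real"
  assumes "f \<in> test_functions" "c \<noteq> 0"
  shows "(\<lambda>x. f (a + c *\<^sub>R x)) \<in> test_functions"
proof -
  obtain R where "0 < R" and R: "\<And>x. R < norm x \<Longrightarrow> f x = 0"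
    using assms(1) by (rule test_function_support) (blast intro: that)
  have "f (a + c *\<^sub>R x) = 0" if "(R + norm a) / \<bar>c\<bar> < norm x" for x
  proof (rule R)
    have "R + norm a < norm (c *\<^sub>R x)"
      using that \<open>c \<noteq> 0\<close> by (simp add: field_simps)
    also have "\<dots> \<le> norm (a + c *\<^sub>R x) + norm a"
      using norm_triangle_ineq4[of "a + c *\<^sub>R x" a] by simp
    finally show "R < norm (a + c *\<^sub>R x)" by simp
  qed
  then show ?thesis
    using assms by (auto simp: test_functions_iff intro: smooth_affine)
qed

lemma integrable_bounded_support:
  fixes f :: "real ^ 'n::finite \<Rightarrow> real"
  assumes [measurable]: "f \<in> borel_measurable borel"
    and "\<And>x. \<bar>f x\<bar> \<le> B" "\<And>x. R < norm x \<Longrightarrow> f x = 0"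
  shows "integrable lborel f"
proof (rule Bochner_Integration.integrable_bound)
  show "integrable lborel (\<lambda>x :: real ^ 'n. B * indicator (cball 0 R) x)"
    using emeasure_bounded_finite[OF bounded_cball, of 0 R] by (intro integrable_mult_right integrable_real_indicator) auto
  show "AE x in lborel. norm (f x) \<le> norm (B * indicat_real (cball 0 R) x)"
    using assms by (intro AE_I2) (auto simp: indicator_def abs_le_iff intro: order_trans[OF _ abs_ge_self])
qed simp

lemma test_function_integrable: "f \<in> test_functions \<Longrightarrow> integrable lborel f"
  by (metis integrable_bounded_support smooth_borel_measurable test_function_bounded
      test_function_smooth test_function_support)

lemma flat_at_zero_nonneg: "0 \<le> flat_at_zero m t"
  by (simp add: flat_at_zero_def)

lemma bump_test_function: "(\<lambda>x :: real ^ 'n::finite. flat_at_zero m (1 - x \<bullet> x)) \<in> test_functions"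
proof -
  have "flat_at_zero m (1 - x \<bullet> x) = 0" if "1 < norm x" for x :: "real ^ 'n"
  proof -
    have "1 < x \<bullet> x"
      using that one_less_power[of "norm x" 2] by (simp add: power2_norm_eq_inner)
    then show ?thesis by (simp add: flat_at_zero_def)
  qed
  then show ?thesis
    using smooth_bump[of m] by (auto simp: test_functions_iff)
qed

text \<open>No plateau around the origin is asked for: under dilations by 1/n, continuity at 0
  already gives convergence to 1 at every point. The factor \<open>exp 1\<close> compensates the
  value exp(-1) of the bump at 0.\<close>

lemma cutoff_exists:
  obtains \<eta> :: "real ^ 'n::finite \<Rightarrow> real"
  where "\<eta> \<in> test_functions" "\<eta> 0 = 1" "\<And>x. \<bar>\<eta> x\<bar> \<le> 1"
proof
  let ?\<eta> = "\<lambda>x :: real ^ 'n. flat_at_zero 0 (1 - x \<bullet> x) * exp 1"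
  show "?\<eta> \<in> test_functions"
    by (intro test_function_mult bump_test_function smooth_const)
  show "?\<eta> 0 = 1"
    by (simp add: flat_at_zero_def flip: exp_add)
  show "\<bar>?\<eta> x\<bar> \<le> 1" for x
    using inner_ge_zero[of x] by (auto simp: flat_at_zero_def field_simps simp flip: exp_add)
qed

text \<open>A predicate with an upper bound for the support instead of a scaled family: a mollifier
  of small radius is one for all larger radii, so a single one can serve finitely many
  functions.\<close>

definition mollifier :: "real \<Rightarrow> (real ^ 'n::finite \<Rightarrow> real) \<Rightarrow> bool" where
  "mollifier \<delta> \<rho> \<longleftrightarrow> \<rho> \<in> test_functions \<and> (\<forall>x. 0 \<le> \<rho> x) \<and> (\<forall>x. \<delta> < norm x \<longrightarrow> \<rho> x = 0) \<and>
     (LINT x|lborel. \<rho> x) = 1"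

lemma mollifierD:
  assumes "mollifier \<delta> \<rho>"
  shows "\<rho> \<in> test_functions" "0 \<le> \<rho> x" "\<delta> < norm x \<Longrightarrow> \<rho> x = 0" "(LINT x|lborel. \<rho> x) = 1"
  using assms by (auto simp: mollifier_def)

lemma mollifier_mono: "mollifier \<delta> \<rho> \<Longrightarrow> \<delta> \<le> \<delta>' \<Longrightarrow> mollifier \<delta>' \<rho>"
  by (auto simp: mollifier_def)

lemma mollifier_exists:
  assumes "0 < \<delta>"
  shows "\<exists>\<rho> :: real ^ 'n::finite \<Rightarrow> real. mollifier \<delta> \<rho>"
proof -
  \<comment> \<open>The summand 0 brings the argument into the affine form of
    \<open>test_function_affine\<close>.\<close>
  define b :: "real ^ 'n \<Rightarrow> real"
    where "b x = flat_at_zero 0 (1 - (0 + (1 / \<delta>) *\<^sub>R x) \<bullet> (0 + (1 / \<delta>) *\<^sub>R x))" for x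
  have b: "b \<in> test_functions"
    unfolding b_def using assms by (intro test_function_affine[OF bump_test_function]) auto
  have b_pos: "0 < b x \<longleftrightarrow> norm x < \<delta>" for x
  proof -
    have "0 < b x \<longleftrightarrow> (norm x / \<delta>)\<^sup>2 < 1"
      using assms by (simp add: b_def flat_at_zero_def power_divide power2_norm_eq_inner divide_simps)
         (simp add: power2_eq_square)
    also have "\<dots> \<longleftrightarrow> norm x < \<delta>"
      using assms by (simp add: power_less_one_iff abs_square_less_1)
    finally show ?thesis .
  qed
  have b_nonneg: "0 \<le> b x" for x
    by (simp add: b_def flat_at_zero_nonneg)
  \<comment> \<open>The bump is nonnegative and positive exactly on an open ball, which is not
    negligible.\<close>
  have "(LINT x|lborel. b x) \<noteq> 0"
  proof
    assume "(LINT x|lborel. b x) = 0"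
    then have "AE x in lborel. b x = 0"
      using integral_nonneg_eq_0_iff_AE[OF test_function_integrable[OF b]] b_nonneg by auto
    then have "AE x :: real ^ 'n in lborel. x \<notin> ball 0 \<delta>"
      by (rule eventually_mono) (simp flip: b_pos)
    then have "ball 0 \<delta> \<in> null_sets (lborel :: (real ^ 'n) measure)"
      by (subst (asm) AE_iff_null_sets[symmetric]) auto
    then have "negligible (ball 0 \<delta> :: (real ^ 'n) set)"
      by (simp add: negligible_iff_null_sets null_sets_completionI)
    then show False
      using assms open_not_negligible[of "ball 0 \<delta> :: (real ^ 'n) set"] by simp
  qed
  then have pos: "0 < (LINT x|lborel. b x)"
    using b_nonneg by (simp add: integral_nonneg_AE less_le)
  show ?thesis
    unfolding mollifier_def
  proof (intro exI conjI allI impI)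
    show "(\<lambda>x. b x * inverse (LINT x|lborel. b x)) \<in> test_functions"
      by (intro test_function_mult b smooth_const)
    show "0 \<le> b x * inverse (LINT x|lborel. b x)" for x
      using pos b_nonneg[of x] by simp
    show "b x * inverse (LINT x|lborel. b x) = 0" if "\<delta> < norm x" for x
      using b_nonneg[of x] b_pos[of x] that by simp
    show "(LINT x|lborel. b x * inverse (LINT x|lborel. b x)) = 1"
      using pos by simp
  qed
qed

section \<open>Decay of Schwartz functions\<close>

lemma schwartz_smooth: "\<phi> \<in> schwartz_space \<Longrightarrow> smooth \<phi>"
  by (simp add: schwartz_space_def)

text \<open>The seminorms of orders 0 and \<open>N\<close> combine through (1 + r)^N \<le> 2^N (1 +
  r^N).\<close>

lemma schwartz_decay:
  fixes \<phi> :: "real ^ 'n::finite \<Rightarrow> real"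
  assumes "\<phi> \<in> schwartz_space"
  obtains C where "0 \<le> C" "\<And>x. \<bar>iter_partial_deriv ks \<phi> x\<bar> \<le> C / (1 + norm x) ^ N"
proof -
  let ?g = "iter_partial_deriv ks \<phi>"
  have "\<exists>B. \<forall>x. norm x ^ m * \<bar>?g x\<bar> \<le> B" for m
    using assms by (auto simp: schwartz_space_def bounded_iff abs_mult)
  then obtain B where B: "\<And>m x. norm x ^ m * \<bar>?g x\<bar> \<le> B m" by metis
  have "\<bar>?g x\<bar> \<le> 2 ^ N * (B 0 + B N) / (1 + norm x) ^ N" for x
  proof -
    have "(1 + norm x) ^ N \<le> (2 * max 1 (norm x)) ^ N"
      by (intro power_mono) auto
    also have "\<dots> \<le> 2 ^ N * (1 + norm x ^ N)"
      by (auto simp: power_mult_distrib max_def)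
    finally have "(1 + norm x) ^ N * \<bar>?g x\<bar> \<le> 2 ^ N * (1 + norm x ^ N) * \<bar>?g x\<bar>"
      by (rule mult_right_mono) simp
    also have "\<dots> = 2 ^ N * (\<bar>?g x\<bar> + norm x ^ N * \<bar>?g x\<bar>)"
      by (simp add: algebra_simps)
    also have "\<dots> \<le> 2 ^ N * (B 0 + B N)"
      using B[of x 0] B[of x N] by (intro mult_left_mono add_mono) auto
    finally show ?thesis
      by (simp add: field_simps add_pos_nonneg)
  qed
  moreover have "0 \<le> 2 ^ N * (B 0 + B N)"
    using order_trans[OF _ B[of 0 0]] order_trans[OF _ B[of 0 N]] by simp
  ultimately show ?thesis by (intro that)
qed

lemma schwartz_translate:
  fixes \<phi> :: "real ^ 'n::finite \<Rightarrow> real"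
  assumes "\<phi> \<in> schwartz_space"
  shows "(\<lambda>x. \<phi> (a + x)) \<in> schwartz_space"
proof -
  have "bounded (range (\<lambda>x. norm x ^ m * iter_partial_deriv ks (\<lambda>x. \<phi> (a + x)) x))" for m ks
  proof -
    obtain C where C: "0 \<le> C" "\<And>x. \<bar>iter_partial_deriv ks \<phi> x\<bar> \<le> C / (1 + norm x) ^ m"
      using assms by (rule schwartz_decay[where ks = ks and N = m]) (blast intro: that)
    have "norm (norm x ^ m * iter_partial_deriv ks \<phi> (a + x)) \<le> (1 + norm a) ^ m * C" for x
    proof -
      \<comment> \<open>A variant of Peetre's inequality: decay measured at \<open>a + x\<close> is
        decay at \<open>x\<close> up to a power of 1 + |a|.\<close>
      have "norm x \<le> norm a + norm (a + x)"
        using norm_triangle_ineq4[of "a + x" a] by simp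
      also have "\<dots> \<le> (1 + norm a) * (1 + norm (a + x))"
        by (simp add: algebra_simps)
      finally have "norm x ^ m \<le> (1 + norm a) ^ m * (1 + norm (a + x)) ^ m"
        by (metis norm_ge_zero power_mono power_mult_distrib)
      then have "norm x ^ m * \<bar>iter_partial_deriv ks \<phi> (a + x)\<bar> \<le>
          ((1 + norm a) ^ m * (1 + norm (a + x)) ^ m) * (C / (1 + norm (a + x)) ^ m)"
        by (rule mult_mono) (use C in auto)
      also have "\<dots> = (1 + norm a) ^ m * C"
        using norm_ge_zero[of "a + x"] by (simp add: add_nonneg_eq_0_iff)
      finally show ?thesis by (simp add: abs_mult)
    qed
    then show ?thesis
      using iter_partial_deriv_affine[OF schwartz_smooth[OF assms], of ks a 1]
      unfolding bounded_iff by auto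
  qed
  moreover have "smooth (\<lambda>x. \<phi> (a + x))"
    using smooth_affine[OF schwartz_smooth[OF assms], of a 1] by simp
  ultimately show ?thesis
    by (simp add: schwartz_space_def)
qed

text \<open>The convex set \<open>S\<close> admits gradient bounds that hold only near a point and
  therefore remember the decay there. The factor \<open>CARD('n)\<close> comes from estimating the
  differential by the sum of the partial derivatives.\<close>

lemma partial_deriv_Lipschitz:
  fixes f :: "real ^ 'n::finite \<Rightarrow> real"
  assumes "f differentiable_on UNIV" "convex S" "x \<in> S" "y \<in> S"
    and B: "\<And>k z. z \<in> S \<Longrightarrow> \<bar>partial_deriv k f z\<bar> \<le> B"
  shows "\<bar>f x - f y\<bar> \<le> real CARD('n) * B * norm (x - y)"
proof -
  have "0 \<le> B"
    using B[OF \<open>x \<in> S\<close>] abs_ge_zero order_trans by blast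
  have "onorm (\<lambda>h. \<Sum>k\<in>UNIV. h $ k * partial_deriv k f z) \<le> real CARD('n) * B" if "z \<in> S" for z
  proof (rule onorm_bound)
    fix h :: "real ^ 'n"
    have "norm (\<Sum>k\<in>UNIV. h $ k * partial_deriv k f z) \<le> (\<Sum>k\<in>(UNIV :: 'n set). norm h * B)"
      using B[OF that] component_le_norm_cart[of h] \<open>0 \<le> B\<close>
      by (intro sum_norm_le) (auto simp: abs_mult intro!: mult_mono)
    then show "norm (\<Sum>k\<in>UNIV. h $ k * partial_deriv k f z) \<le> real CARD('n) * B * norm h"
      by (simp add: mult_ac)
  qed (use \<open>0 \<le> B\<close> in simp)
  then show ?thesis
    using differentiable_bound[of S f "\<lambda>z h. \<Sum>k\<in>UNIV. h $ k * partial_deriv k f z" "real CARD('n) * B" x y]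
      has_derivative_at_withinI[OF has_derivative_partial_deriv[OF assms(1)]] assms
    by (simp add: dist_norm)
qed

text \<open>For |u| \<le> 1 the mean value inequality on the unit ball around x gives the factor |u|
  and keeps the decay of the gradient; for |u| > 1 the two values are bounded one by one. The factor
  \<open>min 1 (norm u)\<close> later cancels the singularity of the kernel.\<close>

lemma schwartz_difference:
  fixes \<phi> :: "real ^ 'n::finite \<Rightarrow> real"
  assumes "\<phi> \<in> schwartz_space"
  obtains C where "0 \<le> C"
    "\<And>x u. \<bar>\<phi> (x - u) - \<phi> x\<bar> \<le> min 1 (norm u) * (C / (1 + norm (x - u)) ^ N + C / (1 + norm x) ^ N)"
proof -
  obtain C0 where C0: "0 \<le> C0" "\<And>x. \<bar>\<phi> x\<bar> \<le> C0 / (1 + norm x) ^ N"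
    using schwartz_decay[OF assms, of "[]" N] by auto
  have "\<exists>C. \<forall>x. \<bar>partial_deriv k \<phi> x\<bar> \<le> C / (1 + norm x) ^ N" for k
    using schwartz_decay[OF assms, of "[k]" N] by (metis iter_partial_deriv.simps)
  then obtain D where D: "\<And>k x. \<bar>partial_deriv k \<phi> x\<bar> \<le> D k / (1 + norm x) ^ N"
    by metis
  have D_nonneg: "0 \<le> D k" for k
    using order_trans[OF abs_ge_zero D[of k 0]] by simp
  \<comment> \<open>The first summand serves large \<open>u\<close>, the second small
    \<open>u\<close>: \<open>CARD('n)\<close> is the loss in the mean value inequality, and 2^N
    compares 1 + |z| with 1 + |x| for z in the unit ball around x.\<close>
  define C where "C = C0 + real CARD('n) * (2 ^ N * (\<Sum>k\<in>UNIV. D k))"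
  have "0 \<le> C"
    using C0 D_nonneg by (auto simp: C_def intro!: add_nonneg_nonneg mult_nonneg_nonneg sum_nonneg)
  moreover have "\<bar>\<phi> (x - u) - \<phi> x\<bar> \<le>
    min 1 (norm u) * (C / (1 + norm (x - u)) ^ N + C / (1 + norm x) ^ N)" for x u
  proof (cases "norm u \<le> 1")
    case True
    have "\<bar>partial_deriv k \<phi> z\<bar> \<le> 2 ^ N * (\<Sum>k\<in>UNIV. D k) / (1 + norm x) ^ N"
      if "z \<in> cball x 1" for z k
    proof -
      have "norm x \<le> norm z + 1"
        using that norm_triangle_ineq2[of x z] by (simp add: dist_norm)
      moreover have "0 \<le> norm z" by simp
      ultimately have "1 + norm x \<le> 2 * (1 + norm z)"
        by (smt (verit))
      then have "(1 + norm x) ^ N \<le> (2 * (1 + norm z)) ^ N"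
        by (intro power_mono) auto
      then have "(1 + norm x) ^ N \<le> 2 ^ N * (1 + norm z) ^ N"
        by (simp only: power_mult_distrib)
      then have "1 / (1 + norm z) ^ N \<le> 2 ^ N / (1 + norm x) ^ N"
        by (simp add: field_simps add_pos_nonneg)
      moreover have "D k \<le> (\<Sum>k\<in>UNIV. D k)"
        using D_nonneg by (intro member_le_sum) auto
      ultimately have "D k * (1 / (1 + norm z) ^ N) \<le> (\<Sum>k\<in>UNIV. D k) * (2 ^ N / (1 + norm x) ^ N)"
        using D_nonneg by (intro mult_mono) (auto intro: sum_nonneg)
      then show ?thesis
        using D[where k=k and x=z] by (simp add: mult.commute)
    qed
    then have "\<bar>\<phi> (x - u) - \<phi> x\<bar> \<le>
        real CARD('n) * (2 ^ N * (\<Sum>k\<in>UNIV. D k) / (1 + norm x) ^ N) * norm ((x - u) - x)"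
      using smooth_differentiable_on[OF schwartz_smooth[OF assms]] True
      by (intro partial_deriv_Lipschitz[where S = "cball x 1"]) (auto simp: dist_norm)
    also have "\<dots> = min 1 (norm u) * (real CARD('n) * (2 ^ N * (\<Sum>k\<in>UNIV. D k)) / (1 + norm x) ^ N)"
      using True by (simp add: mult_ac)
    also have "\<dots> \<le> min 1 (norm u) * (C / (1 + norm (x - u)) ^ N + C / (1 + norm x) ^ N)"
      using C0 \<open>0 \<le> C\<close>
      by (intro mult_left_mono add_increasing divide_right_mono divide_nonneg_nonneg zero_le_power)
         (auto simp: C_def)
    finally show ?thesis .
  next
    case False
    have "C0 \<le> C"
      using D_nonneg by (auto simp: C_def intro!: mult_nonneg_nonneg sum_nonneg)
    then have "C0 / (1 + norm y) ^ N \<le> C / (1 + norm y) ^ N" for y :: "real ^ 'n"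
      by (intro divide_right_mono) auto
    then have "\<bar>\<phi> y\<bar> \<le> C / (1 + norm y) ^ N" for y
      using C0(2) order_trans by blast
    from this[of x] this[of "x - u"] show ?thesis
      using False by simp
  qed
  ultimately show ?thesis by (rule that)
qed

text \<open>Comparison with the series of 1/k^2: the shell where |x| has integer part k lies in the
  ball of radius k + 1, whose volume is proportional to (k + 1)^n. Using whole balls instead of
  shells costs one power, hence the exponent n + 2.\<close>

lemma integrable_inverse_power_norm:
  "integrable lborel (\<lambda>x :: real ^ 'n::finite. 1 / (1 + norm x) ^ (CARD('n) + 2))"
proof (rule integrableI_bounded)
  let ?n = "CARD('n)"
  have [measurable]: "cball (0 :: real ^ 'n) r \<in> sets borel" for r
    by simp
  define V where "V = unit_ball_vol (real ?n)"
  have "ennreal (norm (1 / (1 + norm x) ^ (?n + 2))) \<le>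
      (\<Sum>k. ennreal (1 / (1 + real k) ^ (?n + 2)) * indicator (cball 0 (1 + real k)) x)" for x :: "real ^ 'n"
  proof -
    define g where "g = (\<lambda>k. ennreal (1 / (1 + real k) ^ (?n + 2)) * indicator (cball 0 (1 + real k)) x)"
    define k where "k = nat \<lfloor>norm x\<rfloor>"
    have k: "real k \<le> norm x" "norm x \<le> 1 + real k"
      unfolding k_def by (simp, linarith)
    have "1 / (1 + norm x) ^ (?n + 2) \<le> 1 / (1 + real k) ^ (?n + 2)"
      using k by (intro divide_left_mono power_mono mult_pos_pos zero_less_power) (auto intro: add_pos_nonneg)
    then have "ennreal (norm (1 / (1 + norm x) ^ (?n + 2))) \<le>
        sum g {k}"
      using k by (simp add: ennreal_leI g_def)
    also have "\<dots> \<le> (\<Sum>k. g k)"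
      by (intro sum_le_suminf) auto
    finally show ?thesis by (simp only: g_def)
  qed
  then have "(\<integral>\<^sup>+x. ennreal (norm (1 / (1 + norm (x :: real ^ 'n)) ^ (?n + 2))) \<partial>lborel) \<le>
    (\<integral>\<^sup>+x. (\<Sum>k. ennreal (1 / (1 + real k) ^ (?n + 2)) * indicator (cball 0 (1 + real k)) (x :: real ^ 'n)) \<partial>lborel)"
    by (intro nn_integral_mono)
  also have "\<dots> = (\<Sum>k. \<integral>\<^sup>+x. ennreal (1 / (1 + real k) ^ (?n + 2)) * indicator (cball 0 (1 + real k)) (x :: real ^ 'n) \<partial>lborel)"
    by (intro nn_integral_suminf) measurable
  also have "\<dots> = (\<Sum>k. ennreal (V * inverse (real (Suc k) ^ 2)))"
  proof (intro suminf_cong)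
    fix k
    have "1 / a ^ (?n + 2) * (V * a ^ ?n) = V * inverse (a ^ 2)" if "a \<noteq> 0" for a :: real
      using that by (simp add: power_add field_simps power2_eq_square)
    then have *: "1 / (1 + real k) ^ (?n + 2) * (V * (1 + real k) ^ ?n) = V * inverse (real (Suc k) ^ 2)"
      by simp
    have "(\<integral>\<^sup>+x. ennreal (1 / (1 + real k) ^ (?n + 2)) * indicator (cball 0 (1 + real k)) (x :: real ^ 'n) \<partial>lborel) =
        ennreal (1 / (1 + real k) ^ (?n + 2)) * ennreal (V * (1 + real k) ^ ?n)"
      by (simp add: nn_integral_cmult_indicator emeasure_cball V_def)
    also have "\<dots> = ennreal (1 / (1 + real k) ^ (?n + 2) * (V * (1 + real k) ^ ?n))"
      by (rule ennreal_mult[symmetric]) (auto simp: V_def)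
    also note *
    finally show "(\<integral>\<^sup>+x. ennreal (1 / (1 + real k) ^ (?n + 2)) * indicator (cball 0 (1 + real k)) (x :: real ^ 'n) \<partial>lborel) =
        ennreal (V * inverse (real (Suc k) ^ 2))" .
  qed
  also have "\<dots> < \<infinity>"
  proof -
    have "summable (\<lambda>k. V * inverse (real (Suc k) ^ 2))"
      using inverse_squares_sums by (intro summable_mult) (auto simp: sums_iff field_simps)
    then show ?thesis
      by (subst suminf_ennreal_eq[OF _ summable_sums]) (auto simp: V_def)
  qed
  finally show "(\<integral>\<^sup>+x. ennreal (norm (1 / (1 + norm (x :: real ^ 'n)) ^ (?n + 2))) \<partial>lborel) < \<infinity>" .
qed simp

section \<open>Estimates in \<open>L\<^sup>p\<close>\<close>

lemma lborel_distr_isometry: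
  fixes t :: "'a::euclidean_space"
  assumes "\<bar>c\<bar> = 1"
  shows "distr lborel borel (\<lambda>x. t + c *\<^sub>R x) = lborel"
  using lborel_affine[of c t] assms by (cases "c = 0") (auto simp: density_1)

lemma
  fixes f :: "'a::euclidean_space \<Rightarrow> real"
  assumes [measurable]: "f \<in> borel_measurable borel" and c: "\<bar>c\<bar> = 1"
  shows integral_lborel_isometry: "(LINT x|lborel. f (t + c *\<^sub>R x)) = (LINT x|lborel. f x)"
    and integrable_lborel_isometry: "integrable lborel (\<lambda>x. f (t + c *\<^sub>R x)) \<longleftrightarrow> integrable lborel f"
proof -
  have "(LINT x|lborel. f x) = (LINT x|distr lborel borel (\<lambda>x. t + c *\<^sub>R x). f x)"
    by (simp only: lborel_distr_isometry[OF c])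
  then show "(LINT x|lborel. f (t + c *\<^sub>R x)) = (LINT x|lborel. f x)"
    by (simp add: integral_distr)
  have "integrable lborel f \<longleftrightarrow> integrable (distr lborel borel (\<lambda>x. t + c *\<^sub>R x)) f"
    by (simp only: lborel_distr_isometry[OF c])
  then show "integrable lborel (\<lambda>x. f (t + c *\<^sub>R x)) \<longleftrightarrow> integrable lborel f"
    by (simp add: integrable_distr_eq)
qed

lemma nn_integral_lborel_translate:
  fixes t :: "'a::euclidean_space"
  assumes [measurable]: "f \<in> borel_measurable borel"
  shows "(\<integral>\<^sup>+x. f (x + t) \<partial>lborel) = (\<integral>\<^sup>+x. f x \<partial>lborel)"
proof -
  have "(\<integral>\<^sup>+x. f x \<partial>lborel) = (\<integral>\<^sup>+x. f x \<partial>distr lborel borel (\<lambda>x. t + 1 *\<^sub>R x))"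
    by (subst lborel_distr_isometry) auto
  then show ?thesis
    by (simp add: nn_integral_distr add.commute)
qed

text \<open>Convexity of t^p in the form of its tangent at s, obtained from Young's inequality for t
  and s^(p-1) with the conjugate exponents p and q = p / (p - 1), because (p - 1) q = p.\<close>

lemma powr_tangent_le:
  fixes s t p :: real
  assumes "1 < p" "0 \<le> s" "0 \<le> t"
  shows "s powr p + p * s powr (p - 1) * (t - s) \<le> t powr p"
proof -
  define q where "q = p / (p - 1)"
  have q: "1 < q" "1 / p + 1 / q = 1" "(p - 1) * q = p"
    using assms by (auto simp: q_def field_simps)
  have "t * s powr (p - 1) \<le> t powr p / p + (s powr (p - 1)) powr q / q"
    using assms q by (intro Youngs_inequality) auto
  also have "(s powr (p - 1)) powr q = s powr p"
    using q by (simp add: powr_powr)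
  finally have "p * (t * s powr (p - 1)) \<le> p * (t powr p / p + s powr p / q)"
    using assms by (intro mult_left_mono) auto
  also have "\<dots> = t powr p + (p - 1) * s powr p"
    using assms by (simp add: q_def field_simps)
  finally have "p * (t * s powr (p - 1)) \<le> t powr p + (p - 1) * s powr p" .
  moreover have "s * s powr (p - 1) = s powr p"
    using assms by (cases "s = 0") (auto simp: powr_mult_base)
  ultimately show ?thesis
    by (simp add: algebra_simps)
qed

lemma le_one_plus_powr:
  fixes t p :: real
  assumes "1 \<le> p" "0 \<le> t"
  shows "t \<le> 1 + t powr p"
proof (cases "t \<le> 1")
  case False
  then have "t powr 1 \<le> t powr p"
    using assms by (intro powr_mono) auto
  then show ?thesis using False by simp
qed (use assms in \<open>auto intro: add_increasing2\<close>)

text \<open>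
  No integrability of \<open>b\<close> is needed: if \<open>b\<close> is not integrable, the Bochner integral is 0.
\<close>

lemma integral_powr_Jensen:
  fixes b f k :: "'a \<Rightarrow> real"
  assumes p: "1 < p" and k: "integrable M k" "\<And>x. 0 \<le> k x"
    and [measurable]: "f \<in> borel_measurable M" "b \<in> borel_measurable M"
    and b: "\<And>x. \<bar>b x\<bar> \<le> \<bar>f x\<bar> * k x"
  shows "ennreal (\<bar>LINT x|M. b x\<bar> powr p) \<le>
    ennreal ((LINT x|M. k x) powr (p - 1)) * (\<integral>\<^sup>+x. ennreal (\<bar>f x\<bar> powr p * k x) \<partial>M)"
proof -
  note [measurable] = borel_measurable_integrable[OF k(1)]
  define K where "K = (LINT x|M. k x)"
  have "0 \<le> K"
    unfolding K_def using k by (simp add: integral_nonneg_AE)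
  consider "K = 0" | "0 < K" "integrable M (\<lambda>x. \<bar>f x\<bar> powr p * k x)"
    | "0 < K" "\<not> integrable M (\<lambda>x. \<bar>f x\<bar> powr p * k x)"
    using \<open>0 \<le> K\<close> by fastforce
  then show ?thesis
  proof cases
    case 1
    then have "AE x in M. k x = 0"
      using k by (subst (asm) K_def, subst (asm) integral_nonneg_eq_0_iff_AE) auto
    then have "AE x in M. b x = 0"
      by (rule eventually_mono) (metis abs_le_zero_iff b mult_zero_right)
    then have "(LINT x|M. b x) = 0"
      by (rule integral_eq_zero_AE)
    then show ?thesis using p by simp
  next
    case 2
    have fk: "integrable M (\<lambda>x. \<bar>f x\<bar> * k x)"
    proof (rule Bochner_Integration.integrable_bound)
      show "integrable M (\<lambda>x. k x + \<bar>f x\<bar> powr p * k x)"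
        using k(1) 2(2) by (rule Bochner_Integration.integrable_add)
      have "\<bar>f x\<bar> * k x \<le> (1 + \<bar>f x\<bar> powr p) * k x" for x
        using p k by (intro mult_right_mono le_one_plus_powr) auto
      then show "AE x in M. norm (\<bar>f x\<bar> * k x) \<le> norm (k x + \<bar>f x\<bar> powr p * k x)"
        using k by (intro AE_I2) (simp add: algebra_simps abs_mult)
    qed simp
    define I where "I = (LINT x|M. \<bar>f x\<bar> * k x)"
    define G where "G = (LINT x|M. \<bar>f x\<bar> powr p * k x)"
    \<comment> \<open>The tangent is taken at the weighted mean of |f|, so that its linear term
      vanishes after integration.\<close>
    define s where "s = I / K"
    have "0 \<le> I"
      unfolding I_def using k by (simp add: integral_nonneg_AE)
    then have s: "0 \<le> s" and I: "I = s * K"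
      using \<open>0 < K\<close> by (auto simp: s_def)
    have "s powr p * K + p * s powr (p - 1) * (I - s * K) =
        (LINT x|M. s powr p * k x + p * s powr (p - 1) * (\<bar>f x\<bar> * k x - s * k x))"
      using k(1) fk by (simp add: I_def K_def)
    also have "\<dots> \<le> G"
      unfolding G_def
    proof (intro integral_mono)
      show "integrable M (\<lambda>x. s powr p * k x + p * s powr (p - 1) * (\<bar>f x\<bar> * k x - s * k x))"
        using k(1) fk by simp
      show "s powr p * k x + p * s powr (p - 1) * (\<bar>f x\<bar> * k x - s * k x) \<le> \<bar>f x\<bar> powr p * k x" for x
        using mult_right_mono[OF powr_tangent_le[OF p s abs_ge_zero[of "f x"]] k(2)[of x]]
        by (simp add: algebra_simps)
    qed (rule 2)
    finally have G: "s powr p * K \<le> G"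
      by (simp add: I)
    have "\<bar>LINT x|M. b x\<bar> \<le> (LINT x|M. \<bar>b x\<bar>)"
      by (rule integral_abs_bound)
    also have "\<dots> \<le> I"
      unfolding I_def
    proof (intro integral_mono integrable_abs)
      show "integrable M b"
        using b by (intro Bochner_Integration.integrable_bound[OF fk]) (auto intro: order_trans[OF _ abs_ge_self])
    qed (use fk b in auto)
    finally have "\<bar>LINT x|M. b x\<bar> powr p \<le> I powr p"
      using p by (intro powr_mono2) auto
    also have "\<dots> = K powr (p - 1) * (s powr p * K)"
      using \<open>0 < K\<close> s by (simp add: I powr_mult powr_diff)
    also have "\<dots> \<le> K powr (p - 1) * G"
      using G by (intro mult_left_mono) auto
    finally have "ennreal (\<bar>LINT x|M. b x\<bar> powr p) \<le> ennreal (K powr (p - 1)) * ennreal G"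
      by (simp add: ennreal_leI flip: ennreal_mult')
    also have "ennreal G = (\<integral>\<^sup>+x. ennreal (\<bar>f x\<bar> powr p * k x) \<partial>M)"
      unfolding G_def using 2 k by (subst nn_integral_eq_integral) auto
    finally show ?thesis by (simp add: K_def)
  next
    case 3
    then have "(\<integral>\<^sup>+x. ennreal (\<bar>f x\<bar> powr p * k x) \<partial>M) = \<infinity>"
      using k by (auto simp: integrable_iff_bounded less_top[symmetric])
    then show ?thesis
      using 3 by (simp add: K_def ennreal_mult_top)
  qed
qed

text \<open>
  The \<open>p\<close>-th power of the \<open>L\<^sup>p\<close> norm. Its quasi-triangle inequality with constant \<open>2\<^sup>p\<close> suffices
  for all approximations below, so Minkowski's inequality is avoided.
\<close>

definition Lp_mass :: "real \<Rightarrow> (real ^ 'n::finite \<Rightarrow> real) \<Rightarrow> real" where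
  "Lp_mass p f = (LINT x|lborel. \<bar>f x\<bar> powr p)"

lemma Lp_mass_nonneg: "0 \<le> Lp_mass p f"
  by (simp add: Lp_mass_def)

lemma Lp_measurable [measurable_dest]: "f \<in> Lp_space p \<Longrightarrow> f \<in> borel_measurable borel"
  by (simp add: Lp_space_def)

lemma Lp_integrable: "f \<in> Lp_space p \<Longrightarrow> integrable lborel (\<lambda>x. \<bar>f x\<bar> powr p)"
  by (simp add: Lp_space_def)

lemma nn_integral_Lp: "f \<in> Lp_space p \<Longrightarrow> (\<integral>\<^sup>+x. ennreal (\<bar>f x\<bar> powr p) \<partial>lborel) = ennreal (Lp_mass p f)"
  by (simp add: Lp_mass_def Lp_integrable nn_integral_eq_integral)

lemma
  fixes f :: "real ^ 'n::finite \<Rightarrow> real"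
  assumes [measurable]: "f \<in> borel_measurable borel"
    and B: "(\<integral>\<^sup>+x. ennreal (\<bar>f x\<bar> powr p) \<partial>lborel) \<le> ennreal B" and "0 \<le> B"
  shows Lp_spaceI_nn_integral: "f \<in> Lp_space p" and Lp_mass_le_nn_integral: "Lp_mass p f \<le> B"
proof -
  show f: "f \<in> Lp_space p"
    using le_less_trans[OF B ennreal_less_top] by (auto simp: Lp_space_def integrable_iff_bounded)
  show "Lp_mass p f \<le> B"
    using B nn_integral_Lp[OF f] \<open>0 \<le> B\<close> by simp
qed

lemma Lp_dominated:
  fixes f g :: "real ^ 'n::finite \<Rightarrow> real"
  assumes g: "g \<in> Lp_space p" and [measurable]: "f \<in> borel_measurable borel"
    and le: "\<And>x. \<bar>f x\<bar> \<le> \<bar>g x\<bar>" and p: "0 \<le> p"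
  shows "f \<in> Lp_space p" "Lp_mass p f \<le> Lp_mass p g"
proof -
  have "(\<integral>\<^sup>+x. ennreal (\<bar>f x\<bar> powr p) \<partial>lborel) \<le> ennreal (Lp_mass p g)"
    unfolding nn_integral_Lp[OF g, symmetric] using le p by (intro nn_integral_mono ennreal_leI powr_mono2) auto
  then show "f \<in> Lp_space p" "Lp_mass p f \<le> Lp_mass p g"
    using Lp_spaceI_nn_integral Lp_mass_le_nn_integral Lp_mass_nonneg assms(2) by blast+
qed

lemma abs_add_powr_le:
  fixes a b p :: real
  assumes "0 \<le> p"
  shows "\<bar>a + b\<bar> powr p \<le> 2 powr p * (\<bar>a\<bar> powr p + \<bar>b\<bar> powr p)"
proof -
  have "\<bar>a + b\<bar> powr p \<le> (2 * max \<bar>a\<bar> \<bar>b\<bar>) powr p"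
    using assms by (intro powr_mono2) auto
  also have "\<dots> = 2 powr p * max \<bar>a\<bar> \<bar>b\<bar> powr p"
    by (simp add: powr_mult)
  also have "\<dots> \<le> 2 powr p * (\<bar>a\<bar> powr p + \<bar>b\<bar> powr p)"
    by (intro mult_left_mono) (auto simp: max_def)
  finally show ?thesis .
qed

lemma
  fixes f g :: "real ^ 'n::finite \<Rightarrow> real"
  assumes f: "f \<in> Lp_space p" and g: "g \<in> Lp_space p" and p: "0 \<le> p"
  shows Lp_add: "(\<lambda>x. f x + g x) \<in> Lp_space p"
    and Lp_mass_add: "Lp_mass p (\<lambda>x. f x + g x) \<le> 2 powr p * (Lp_mass p f + Lp_mass p g)"
proof -
  note [measurable] = Lp_measurable[OF f] Lp_measurable[OF g]
  note I = Lp_integrable[OF f] Lp_integrable[OF g]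
  then have D: "integrable lborel (\<lambda>x. 2 powr p * (\<bar>f x\<bar> powr p + \<bar>g x\<bar> powr p))"
    by simp
  then have S: "integrable lborel (\<lambda>x. \<bar>f x + g x\<bar> powr p)"
    by (rule Bochner_Integration.integrable_bound) (use abs_add_powr_le[OF p] in \<open>simp_all add: add_nonneg_nonneg\<close>)
  then show "(\<lambda>x. f x + g x) \<in> Lp_space p"
    by (simp add: Lp_space_def)
  have "Lp_mass p (\<lambda>x. f x + g x) \<le> (LINT x|lborel. 2 powr p * (\<bar>f x\<bar> powr p + \<bar>g x\<bar> powr p))"
    unfolding Lp_mass_def by (intro integral_mono S D abs_add_powr_le p)
  then show "Lp_mass p (\<lambda>x. f x + g x) \<le> 2 powr p * (Lp_mass p f + Lp_mass p g)"
    using I by (simp add: Lp_mass_def)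
qed

lemma
  fixes f :: "real ^ 'n::finite \<Rightarrow> real"
  assumes "f \<in> Lp_space p"
  shows Lp_minus: "(\<lambda>x. - f x) \<in> Lp_space p" and Lp_mass_minus: "Lp_mass p (\<lambda>x. - f x) = Lp_mass p f"
  using assms by (auto simp: Lp_space_def Lp_mass_def)

lemma
  fixes f g :: "real ^ 'n::finite \<Rightarrow> real"
  assumes "f \<in> Lp_space p" "g \<in> Lp_space p" "0 \<le> p"
  shows Lp_diff: "(\<lambda>x. f x - g x) \<in> Lp_space p"
    and Lp_mass_diff: "Lp_mass p (\<lambda>x. f x - g x) \<le> 2 powr p * (Lp_mass p f + Lp_mass p g)"
  using Lp_add[OF assms(1) Lp_minus[OF assms(2)] assms(3)]
    Lp_mass_add[OF assms(1) Lp_minus[OF assms(2)] assms(3)] Lp_mass_minus[OF assms(2)]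
  by simp_all

lemma Lp_mass_cong_AE:
  fixes f g :: "real ^ 'n::finite \<Rightarrow> real"
  assumes "AE x in lborel. f x = g x" "f \<in> Lp_space p" "g \<in> Lp_space p"
  shows "Lp_mass p f = Lp_mass p g"
  unfolding Lp_mass_def using assms by (intro integral_cong_AE) auto

text \<open>Interpolation between L^1 and the bounded functions, by |f|^p \<le> B^(p-1) |f|.\<close>

lemma Lp_bounded_integrable:
  fixes f :: "real ^ 'n::finite \<Rightarrow> real"
  assumes f: "integrable lborel f" and B: "\<And>x. \<bar>f x\<bar> \<le> B" and p: "1 \<le> p"
  shows "f \<in> Lp_space p"
proof -
  note [measurable] = borel_measurable_integrable[OF f]
  have "0 \<le> B"
    using B[of undefined] by linarith
  have "\<bar>f x\<bar> powr p \<le> B powr (p - 1) * \<bar>f x\<bar>" for x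
  proof -
    have "\<bar>f x\<bar> powr p = \<bar>f x\<bar> powr (p - 1) * \<bar>f x\<bar>"
      by (cases "f x = 0") (auto simp: powr_diff)
    also have "\<dots> \<le> B powr (p - 1) * \<bar>f x\<bar>"
      using p B by (intro mult_right_mono powr_mono2) auto
    finally show ?thesis .
  qed
  then have le: "AE x in lborel. norm (\<bar>f x\<bar> powr p) \<le> norm (B powr (p - 1) * \<bar>f x\<bar>)"
    by (simp add: abs_mult)
  have "integrable lborel (\<lambda>x. B powr (p - 1) * \<bar>f x\<bar>)"
    using f by simp
  from this _ le have "integrable lborel (\<lambda>x. \<bar>f x\<bar> powr p)"
    by (rule Bochner_Integration.integrable_bound) simp
  then show ?thesis by (simp add: Lp_space_def)
qed

lemma test_function_Lp: "f \<in> test_functions \<Longrightarrow> 1 \<le> p \<Longrightarrow> f \<in> Lp_space p"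
  by (metis Lp_bounded_integrable test_function_bounded test_function_integrable)

text \<open>In place of Hoelder's inequality, the crude bound |f| \<le> 1 + |f|^p yields the
  majorant |h| + B |f|^p, and no conjugate exponent appears.\<close>

lemma Lp_mult_integrable:
  fixes f h :: "real ^ 'n::finite \<Rightarrow> real"
  assumes f: "f \<in> Lp_space p" and h: "integrable lborel h" "\<And>x. \<bar>h x\<bar> \<le> B" and p: "1 \<le> p"
  shows "integrable lborel (\<lambda>x. f x * h x)"
proof (rule Bochner_Integration.integrable_bound)
  note [measurable] = borel_measurable_integrable[OF h(1)] Lp_measurable[OF f]
  show "integrable lborel (\<lambda>x. \<bar>h x\<bar> + B * \<bar>f x\<bar> powr p)"
    using h(1) Lp_integrable[OF f] by simp
  have "\<bar>f x * h x\<bar> \<le> \<bar>h x\<bar> + B * \<bar>f x\<bar> powr p" for x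
  proof -
    have "\<bar>f x * h x\<bar> \<le> (1 + \<bar>f x\<bar> powr p) * \<bar>h x\<bar>"
      unfolding abs_mult using p by (intro mult_right_mono le_one_plus_powr) auto
    also have "\<dots> \<le> \<bar>h x\<bar> + B * \<bar>f x\<bar> powr p"
      using h(2)[of x] mult_right_mono[OF h(2)[of x], of "\<bar>f x\<bar> powr p"] by (simp add: algebra_simps)
    finally show ?thesis .
  qed
  then show "AE x in lborel. norm (f x * h x) \<le> norm (\<bar>h x\<bar> + B * \<bar>f x\<bar> powr p)"
    by (intro AE_I2) (auto intro: order_trans[OF _ abs_ge_self])
  show "(\<lambda>x. f x * h x) \<in> borel_measurable lborel"
    by measurable
qed

text \<open>The source of joint integrability whenever Fubini is applied to signed integrands. The
  shifts depend on u only, so by translation invariance the x-integral of the majorant |h| + B |f|^p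
  is the same constant for every u, and \<open>k\<close> carries the remaining integral.
  \<open>N\<close> will be the truncated Levy measure or, for convolutions, Lebesgue
  measure.\<close>

lemma shifted_product_integrable:
  fixes f h :: "real ^ 'n::finite \<Rightarrow> real" and s t :: "'a \<Rightarrow> real ^ 'n"
  assumes "sigma_finite_measure N"
    and f: "f \<in> Lp_space p" and h: "integrable lborel h" "\<And>x. \<bar>h x\<bar> \<le> B" and p: "1 \<le> p"
    and k: "integrable N k"
    and [measurable]: "s \<in> N \<rightarrow>\<^sub>M borel" "t \<in> N \<rightarrow>\<^sub>M borel"
  shows "integrable (lborel \<Otimes>\<^sub>M N) (\<lambda>(x, u). f (x + s u) * h (x + t u) * k u)"
proof (rule integrableI_bounded)
  interpret N: sigma_finite_measure N by fact
  interpret P: pair_sigma_finite lborel N ..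
  note [measurable] = borel_measurable_integrable[OF h(1)] Lp_measurable[OF f] borel_measurable_integrable[OF k]
  show "(\<lambda>(x, u). f (x + s u) * h (x + t u) * k u) \<in> borel_measurable (lborel \<Otimes>\<^sub>M N)"
    by measurable
  define A where "A = (LINT x|lborel. \<bar>h x\<bar>) + B * Lp_mass p f"
  have "0 \<le> B"
    using h(2)[of undefined] by linarith
  have A: "(\<integral>\<^sup>+x. ennreal (\<bar>h (x + t u)\<bar> + B * \<bar>f (x + s u)\<bar> powr p) \<partial>lborel) = ennreal A" for u
  proof -
    have "(\<integral>\<^sup>+x. ennreal (\<bar>h (x + t u)\<bar> + B * \<bar>f (x + s u)\<bar> powr p) \<partial>lborel) =
        (\<integral>\<^sup>+x. ennreal \<bar>h (x + t u)\<bar> \<partial>lborel) + (\<integral>\<^sup>+x. ennreal (B * \<bar>f (x + s u)\<bar> powr p) \<partial>lborel)"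
      using \<open>0 \<le> B\<close> by (subst nn_integral_add[symmetric]) auto
    also have "\<dots> = (\<integral>\<^sup>+x. ennreal \<bar>h x\<bar> \<partial>lborel) + (\<integral>\<^sup>+x. ennreal (B * \<bar>f x\<bar> powr p) \<partial>lborel)"
      using nn_integral_lborel_translate[of "\<lambda>x. ennreal \<bar>h x\<bar>" "t u"]
        nn_integral_lborel_translate[of "\<lambda>x. ennreal (B * \<bar>f x\<bar> powr p)" "s u"] by simp
    also have "\<dots> = ennreal A"
      using h(1) Lp_integrable[OF f] \<open>0 \<le> B\<close> Lp_mass_nonneg[of p f]
      by (simp add: A_def Lp_mass_def nn_integral_eq_integral ennreal_plus)
    finally show ?thesis .
  qed
  have "norm (f (x + s u) * h (x + t u) * k u) \<le>
      (\<bar>h (x + t u)\<bar> + B * \<bar>f (x + s u)\<bar> powr p) * \<bar>k u\<bar>" for x u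
  proof -
    have "\<bar>f (x + s u)\<bar> * \<bar>h (x + t u)\<bar> \<le> (1 + \<bar>f (x + s u)\<bar> powr p) * \<bar>h (x + t u)\<bar>"
      using p by (intro mult_right_mono le_one_plus_powr) auto
    also have "\<dots> \<le> \<bar>h (x + t u)\<bar> + B * \<bar>f (x + s u)\<bar> powr p"
      using mult_right_mono[OF h(2)[of "x + t u"], of "\<bar>f (x + s u)\<bar> powr p"] by (simp add: algebra_simps)
    finally show ?thesis
      by (simp add: abs_mult mult_right_mono)
  qed
  then have "ennreal (norm (f (x + s u) * h (x + t u) * k u)) \<le>
      ennreal (\<bar>h (x + t u)\<bar> + B * \<bar>f (x + s u)\<bar> powr p) * ennreal \<bar>k u\<bar>" for x u
    by (subst ennreal_mult''[symmetric]) (auto intro!: ennreal_leI simp del: ennreal_plus)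
  then have "(\<integral>\<^sup>+z. ennreal (norm (case z of (x, u) \<Rightarrow> f (x + s u) * h (x + t u) * k u)) \<partial>(lborel \<Otimes>\<^sub>M N)) \<le>
      (\<integral>\<^sup>+z. (case z of (x, u) \<Rightarrow> ennreal (\<bar>h (x + t u)\<bar> + B * \<bar>f (x + s u)\<bar> powr p) * ennreal \<bar>k u\<bar>) \<partial>(lborel \<Otimes>\<^sub>M N))"
    by (intro nn_integral_mono) (simp add: split_beta del: ennreal_plus)
  also have "\<dots> = (\<integral>\<^sup>+u. \<integral>\<^sup>+x. ennreal (\<bar>h (x + t u)\<bar> + B * \<bar>f (x + s u)\<bar> powr p) * ennreal \<bar>k u\<bar> \<partial>lborel \<partial>N)"
    by (subst P.nn_integral_snd[symmetric]) auto
  also have "\<dots> = (\<integral>\<^sup>+u. ennreal A * ennreal \<bar>k u\<bar> \<partial>N)"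
    by (subst nn_integral_multc) (auto simp: A)
  also have "\<dots> = ennreal A * (\<integral>\<^sup>+u. ennreal \<bar>k u\<bar> \<partial>N)"
    by (intro nn_integral_cmult) simp
  also have "\<dots> < \<infinity>"
    using k by (simp add: nn_integral_eq_integral ennreal_mult_less_top)
  finally show "(\<integral>\<^sup>+z. ennreal (norm (case z of (x, u) \<Rightarrow> f (x + s u) * h (x + t u) * k u)) \<partial>(lborel \<Otimes>\<^sub>M N)) < \<infinity>" .
qed

text \<open>Jensen with weight \<open>k\<close> inside, then Tonelli and translation invariance in
  x. Jensen contributes M^(p-1), with M the integral of \<open>k\<close>, and the outer integral one
  more factor M. The estimate serves convolutions, where \<open>K\<close> is independent of x, as
  well as the commutator of the cutoff, where it is not.\<close>

lemma
  fixes f :: "real ^ 'n::finite \<Rightarrow> real" and s :: "'a \<Rightarrow> real ^ 'n"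
  assumes "sigma_finite_measure N"
    and f: "f \<in> Lp_space p" and p: "1 < p" and k: "integrable N k" "\<And>u. 0 \<le> k u"
    and [measurable]: "s \<in> N \<rightarrow>\<^sub>M borel" "(\<lambda>(x, u). K x u) \<in> borel_measurable (borel \<Otimes>\<^sub>M N)"
    and K: "\<And>x u. \<bar>K x u\<bar> \<le> k u"
  shows Lp_kernel: "(\<lambda>x. LINT u|N. f (x + s u) * K x u) \<in> Lp_space p" (is ?A)
    and Lp_mass_kernel: "Lp_mass p (\<lambda>x. LINT u|N. f (x + s u) * K x u) \<le> (LINT u|N. k u) powr p * Lp_mass p f" (is ?B)
proof -
  interpret N: sigma_finite_measure N by fact
  interpret P: pair_sigma_finite lborel N ..
  note [measurable] = Lp_measurable[OF f] borel_measurable_integrable[OF k(1)]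
  define M where "M = (LINT u|N. k u)"
  have "0 \<le> M"
    unfolding M_def using k by (simp add: integral_nonneg_AE)
  have "(\<integral>\<^sup>+x. ennreal (\<bar>LINT u|N. f (x + s u) * K x u\<bar> powr p) \<partial>lborel) \<le>
      (\<integral>\<^sup>+x. ennreal (M powr (p - 1)) * (\<integral>\<^sup>+u. ennreal (\<bar>f (x + s u)\<bar> powr p * k u) \<partial>N) \<partial>lborel)"
    unfolding M_def using p k K
    by (intro nn_integral_mono integral_powr_Jensen) (auto simp: abs_mult mult_left_mono)
  also have "\<dots> = ennreal (M powr (p - 1)) * (\<integral>\<^sup>+x. \<integral>\<^sup>+u. ennreal (\<bar>f (x + s u)\<bar> powr p * k u) \<partial>N \<partial>lborel)"
    by (intro nn_integral_cmult) measurable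
  also have "(\<integral>\<^sup>+x. \<integral>\<^sup>+u. ennreal (\<bar>f (x + s u)\<bar> powr p * k u) \<partial>N \<partial>lborel) =
      (\<integral>\<^sup>+u. \<integral>\<^sup>+x. ennreal (\<bar>f (x + s u)\<bar> powr p * k u) \<partial>lborel \<partial>N)"
    by (intro P.Fubini'[symmetric]) measurable
  also have "\<dots> = (\<integral>\<^sup>+u. ennreal (Lp_mass p f) * ennreal (k u) \<partial>N)"
  proof (intro nn_integral_cong)
    fix u
    have "(\<integral>\<^sup>+x. ennreal (\<bar>f (x + s u)\<bar> powr p * k u) \<partial>lborel) =
        (\<integral>\<^sup>+x. ennreal (\<bar>f (x + s u)\<bar> powr p) \<partial>lborel) * ennreal (k u)"
      using k by (subst nn_integral_multc[symmetric]) (auto simp: ennreal_mult)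
    then show "(\<integral>\<^sup>+x. ennreal (\<bar>f (x + s u)\<bar> powr p * k u) \<partial>lborel) = ennreal (Lp_mass p f) * ennreal (k u)"
      using nn_integral_lborel_translate[of "\<lambda>x. ennreal (\<bar>f x\<bar> powr p)" "s u"] nn_integral_Lp[OF f] by simp
  qed
  also have "\<dots> = ennreal (Lp_mass p f) * ennreal M"
    using k by (simp add: nn_integral_cmult nn_integral_eq_integral M_def)
  also have "ennreal (M powr (p - 1)) * (ennreal (Lp_mass p f) * ennreal M) = ennreal (M powr p * Lp_mass p f)"
  proof -
    have "M powr (p - 1) * M = M powr p"
      using p \<open>0 \<le> M\<close> by (cases "M = 0") (auto simp: powr_diff)
    then have "M powr (p - 1) * (Lp_mass p f * M) = M powr p * Lp_mass p f"
      by (metis mult.assoc mult.commute)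
    then show ?thesis
      using \<open>0 \<le> M\<close> by (simp add: Lp_mass_nonneg flip: ennreal_mult)
  qed
  finally have "(\<integral>\<^sup>+x. ennreal (\<bar>LINT u|N. f (x + s u) * K x u\<bar> powr p) \<partial>lborel) \<le> ennreal (M powr p * Lp_mass p f)" .
  moreover have "(\<lambda>x. LINT u|N. f (x + s u) * K x u) \<in> borel_measurable borel"
    by measurable
  moreover have "0 \<le> M powr p * Lp_mass p f"
    by (simp add: Lp_mass_nonneg)
  ultimately show ?A ?B
    unfolding M_def by (blast intro: Lp_spaceI_nn_integral Lp_mass_le_nn_integral)+
qed

section \<open>Convolution with mollifiers\<close>

lemma Lp_tendsto:
  fixes f :: "real ^ 'n::finite \<Rightarrow> real"
  assumes [measurable]: "f \<in> borel_measurable borel" "\<And>n. s n \<in> borel_measurable borel"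
    and lim: "AE x in lborel. (\<lambda>n. s n x) \<longlonglongrightarrow> f x"
    and bound: "\<And>n x. \<bar>f x - s n x\<bar> \<le> \<bar>w x\<bar>" and w: "w \<in> Lp_space p" and p: "0 < p"
  shows "(\<lambda>n. Lp_mass p (\<lambda>x. f x - s n x)) \<longlonglongrightarrow> 0"
proof -
  have "(\<lambda>n. Lp_mass p (\<lambda>x. f x - s n x)) \<longlonglongrightarrow> (LINT x|(lborel :: (real ^ 'n) measure). 0)"
    unfolding Lp_mass_def
  proof (rule integral_dominated_convergence)
    show "integrable lborel (\<lambda>x. \<bar>w x\<bar> powr p)"
      by (rule Lp_integrable[OF w])
    show "AE x in lborel. (\<lambda>n. \<bar>f x - s n x\<bar> powr p) \<longlonglongrightarrow> 0"
      using lim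
    proof (rule eventually_mono)
      fix x
      assume "(\<lambda>n. s n x) \<longlonglongrightarrow> f x"
      then have "(\<lambda>n. \<bar>f x - s n x\<bar>) \<longlonglongrightarrow> \<bar>f x - f x\<bar>"
        by (intro tendsto_intros)
      from tendsto_powr'[OF this tendsto_const[of p]] show "(\<lambda>n. \<bar>f x - s n x\<bar> powr p) \<longlonglongrightarrow> 0"
        using p by simp
    qed
    show "AE x in lborel. norm (\<bar>f x - s n x\<bar> powr p) \<le> \<bar>w x\<bar> powr p" for n
      using bound p by (intro AE_I2) (simp add: powr_mono2)
  qed simp_all
  then show ?thesis by simp
qed

text \<open>f is first truncated in space and in height. The resulting bounded function is an almost
  everywhere limit of continuous functions; these are clipped and damped so that dominated
  convergence turns the pointwise limit into a limit in L^p.\<close>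

lemma Lp_approx_continuous:
  fixes f :: "real ^ 'n::finite \<Rightarrow> real"
  assumes f: "f \<in> Lp_space p" and p: "1 \<le> p" and "0 < \<epsilon>"
  obtains g :: "real ^ 'n \<Rightarrow> real" and R
  where "continuous_on UNIV g" "0 < R" "\<And>x. R < norm x \<Longrightarrow> g x = 0" "g \<in> Lp_space p"
    "Lp_mass p (\<lambda>x. f x - g x) < \<epsilon>"
proof -
  note [measurable] = Lp_measurable[OF f]
  have [measurable]: "cball (0 :: real ^ 'n) r \<in> sets borel" for r
    by simp
  \<comment> \<open>Two errors, each multiplied by 2^p in the quasi-triangle inequality.\<close>
  define c where "c = 2 * 2 powr p"
  have "0 < c" by (simp add: c_def)
  define h where "h n x = indicator (cball 0 (real n)) x * max (- real n) (min (real n) (f x))" for n x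
  have h_measurable [measurable]: "h n \<in> borel_measurable borel" for n
    unfolding h_def by measurable
  have "(\<lambda>n. Lp_mass p (\<lambda>x. f x - h n x)) \<longlonglongrightarrow> 0"
  proof (rule Lp_tendsto[OF _ _ _ _ f])
    have "(\<lambda>n. h n x) \<longlonglongrightarrow> f x" for x
    proof (rule tendsto_eventually)
      obtain m :: nat where m: "max (norm x) \<bar>f x\<bar> \<le> real m"
        using real_arch_simple by blast
      have "h n x = f x" if "m \<le> n" for n
      proof -
        have "norm x \<le> real n" "\<bar>f x\<bar> \<le> real n"
          using m that by linarith+
        then show ?thesis
          by (auto simp: h_def min_def max_def)
      qed
      then show "\<forall>\<^sub>F n in sequentially. h n x = f x"
        by (auto simp: eventually_sequentially)
    qed
    then show "AE x in lborel. (\<lambda>n. h n x) \<longlonglongrightarrow> f x" by simp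
    show "\<bar>f x - h n x\<bar> \<le> \<bar>f x\<bar>" for n x
      by (auto simp: h_def indicator_def)
  qed (use p in auto)
  then obtain n where n: "Lp_mass p (\<lambda>x. f x - h n x) < \<epsilon> / c"
    using \<open>0 < \<epsilon>\<close> \<open>0 < c\<close> by (metis (mono_tags, lifting) divide_pos_pos eventually_happens order_tendstoD(2)
        sequentially_bot)
  have h: "h n \<in> Lp_space p"
    using p by (intro Lp_dominated[OF f]) (auto simp: h_def indicator_def)
  have h_bound: "\<bar>h n x\<bar> \<le> real n" for x
    by (auto simp: h_def indicator_def)
  \<comment> \<open>Measurability in the sense of the gauge integral provides continuous functions
    that converge off a negligible set, but with neither a uniform bound nor a common
    support.\<close>
  have "h n measurable_on UNIV"
    by (intro lebesgue_measurable_imp_measurable_on_real measurable_completion) auto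
  then obtain N g where N: "negligible N" and g: "\<And>m. continuous_on UNIV (g m)"
    and lim: "\<And>x. x \<notin> N \<Longrightarrow> (\<lambda>m. g m x) \<longlonglongrightarrow> h n x"
    unfolding measurable_on_def by auto
  \<comment> \<open>\<open>tent\<close> is 1 on the ball that supports \<open>h n\<close> and 0
    outside the ball of radius n + 1; since also |h n| \<le> n, neither damping nor clipping changes
    the limit.\<close>
  define tent :: "real ^ 'n \<Rightarrow> real" where "tent x = max 0 (min 1 (real n + 1 - norm x))" for x
  define s where "s m x = tent x * max (- real n) (min (real n) (g m x))" for m x
  have s_cont: "continuous_on UNIV (s m)" for m
    unfolding s_def tent_def by (intro continuous_intros g)
  have s_measurable [measurable]: "s m \<in> borel_measurable borel" for m
    using s_cont by (rule borel_measurable_continuous_onI)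
  have s_support: "s m x = 0" if "real n + 1 < norm x" for m x
    using that by (simp add: s_def tent_def)
  have s_bound: "\<bar>s m x\<bar> \<le> real n" for m x
  proof -
    have "\<bar>tent x\<bar> * \<bar>max (- real n) (min (real n) (g m x))\<bar> \<le> 1 * real n"
      by (intro mult_mono) (auto simp: tent_def)
    then show ?thesis by (simp add: s_def abs_mult)
  qed
  have s: "s m \<in> Lp_space p" for m
    by (rule Lp_bounded_integrable[OF integrable_bounded_support]) (use s_support s_bound p in auto)
  have "(\<lambda>m. Lp_mass p (\<lambda>x. h n x - s m x)) \<longlonglongrightarrow> 0"
  proof (rule Lp_tendsto)
    have "(\<lambda>m. s m x) \<longlonglongrightarrow> h n x" if "x \<notin> N" for x
    proof -
      have "(\<lambda>m. s m x) \<longlonglongrightarrow> tent x * max (- real n) (min (real n) (h n x))"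
        unfolding s_def by (intro tendsto_intros lim that)
      also have "tent x * max (- real n) (min (real n) (h n x)) = h n x"
        using h_bound[of x] by (auto simp: tent_def h_def indicator_def)
      finally show ?thesis .
    qed
    moreover have "AE x in lborel. x \<notin> N"
      using N by (metis AE_completion_iff AE_not_in negligible_iff_null_sets)
    ultimately show "AE x in lborel. (\<lambda>m. s m x) \<longlonglongrightarrow> h n x"
      by (auto elim: eventually_mono)
    show "\<bar>h n x - s m x\<bar> \<le> \<bar>2 * real n * indicator (cball 0 (real n + 1)) x\<bar>" for m x
      using h_bound[of x] s_bound[of m x] s_support[of x m]
      by (auto simp: h_def indicator_def split: if_splits)
    show "(\<lambda>x. 2 * real n * indicator (cball 0 (real n + 1)) x) \<in> Lp_space p"
      using p by (intro Lp_bounded_integrable[where B = "2 * real n"] integrable_mult_right integrable_real_indicator)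
        (auto simp: emeasure_cball indicator_def)
  qed (use p in auto)
  then obtain m where m: "Lp_mass p (\<lambda>x. h n x - s m x) < \<epsilon> / c"
    using \<open>0 < \<epsilon>\<close> \<open>0 < c\<close> by (metis (mono_tags, lifting) divide_pos_pos eventually_happens order_tendstoD(2)
        sequentially_bot)
  have "Lp_mass p (\<lambda>x. (f x - h n x) + (h n x - s m x)) \<le>
      2 powr p * (Lp_mass p (\<lambda>x. f x - h n x) + Lp_mass p (\<lambda>x. h n x - s m x))"
    using p by (intro Lp_mass_add Lp_diff f h s) auto
  also have "\<dots> < 2 powr p * (\<epsilon> / c + \<epsilon> / c)"
    using n m by (intro mult_strict_left_mono add_strict_mono) auto
  also have "\<dots> = \<epsilon>"
    by (simp add: c_def)
  finally have "Lp_mass p (\<lambda>x. f x - s m x) < \<epsilon>" by simp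
  then show ?thesis
    using s_cont s_support s by (intro that[of "s m" "real n + 1"]) auto
qed

lemma Lp_isometry:
  fixes f :: "real ^ 'n::finite \<Rightarrow> real"
  assumes "f \<in> Lp_space p" "\<bar>c\<bar> = 1"
  shows "(\<lambda>x. f (t + c *\<^sub>R x)) \<in> Lp_space p"
proof -
  note [measurable] = Lp_measurable[OF assms(1)]
  show ?thesis
    using integrable_lborel_isometry[of "\<lambda>x. \<bar>f x\<bar> powr p" c t] assms
    by (simp add: Lp_space_def)
qed

text \<open>The shift sits on \<open>f\<close>, as \<open>Lp_kernel\<close> expects;
  \<open>convol_commute\<close> moves it to the smooth factor for derivatives and for pairings with
  test functions.\<close>

definition convol :: "(real ^ 'n::finite \<Rightarrow> real) \<Rightarrow> (real ^ 'n \<Rightarrow> real) \<Rightarrow> real ^ 'n \<Rightarrow> real" where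
  "convol f \<rho> x = (LINT y|lborel. f (x - y) * \<rho> y)"

lemma convol_commute:
  assumes [measurable]: "f \<in> borel_measurable borel" "\<rho> \<in> borel_measurable borel"
  shows "convol f \<rho> x = (LINT y|lborel. f y * \<rho> (x - y))"
  using integral_lborel_isometry[of "\<lambda>y. f y * \<rho> (x - y)" "-1" x] by (simp add: convol_def)

lemma convol_integrable:
  assumes "f \<in> Lp_space p" "\<rho> \<in> test_functions" "1 \<le> p"
  shows "integrable lborel (\<lambda>y. f (x - y) * \<rho> y)"
proof -
  obtain B where B: "\<And>x. \<bar>\<rho> x\<bar> \<le> B"
    using test_function_bounded[OF assms(2)] by blast
  show ?thesis
    using Lp_mult_integrable[OF Lp_isometry[OF assms(1), of "-1" x] test_function_integrable[OF assms(2)] B assms(3)]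
    by simp
qed

lemma
  fixes f \<rho> :: "real ^ 'n::finite \<Rightarrow> real"
  assumes f: "f \<in> Lp_space p" and \<rho>: "mollifier \<delta> \<rho>"
    and p: "1 < p"
  shows convol_Lp: "convol f \<rho> \<in> Lp_space p"
    and Lp_mass_convol: "Lp_mass p (convol f \<rho>) \<le> Lp_mass p f"
proof -
  note \<rho>_test = mollifierD(1)[OF \<rho>]
  note [measurable] = smooth_borel_measurable[OF test_function_smooth[OF \<rho>_test]]
  have *: "convol f \<rho> = (\<lambda>x. LINT u|lborel. f (x + - u) * \<rho> u)"
    by (rule ext) (simp add: convol_def)
  have "sigma_finite_measure (lborel :: (real ^ 'n) measure)"
    by (rule sigma_finite_lborel)
  note K = this f p test_function_integrable[OF \<rho>_test] mollifierD(2)[OF \<rho>]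
  show "convol f \<rho> \<in> Lp_space p"
    unfolding * by (rule Lp_kernel[OF K]) (use mollifierD[OF \<rho>] in auto)
  show "Lp_mass p (convol f \<rho>) \<le> Lp_mass p f"
    unfolding * by (rule order_trans[OF Lp_mass_kernel[OF K]]) (use mollifierD[OF \<rho>] in auto)
qed

lemma convol_continuous_approx:
  fixes g :: "real ^ 'n::finite \<Rightarrow> real"
  assumes g: "continuous_on UNIV g" and R: "0 < R" "\<And>x. R < norm x \<Longrightarrow> g x = 0" and "0 < \<epsilon>" and p: "1 < p"
    and gp: "g \<in> Lp_space p"
  shows "\<exists>\<delta>>0. \<forall>\<rho>. mollifier \<delta> \<rho> \<longrightarrow> Lp_mass p (\<lambda>x. convol g \<rho> x - g x) < \<epsilon>"
proof -
  define V where "V = measure lborel (cball (0 :: real ^ 'n) (R + 1))"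
  have "0 \<le> V" by (simp add: V_def)
  \<comment> \<open>Chosen so that a uniform error \<open>\<eta>\<close> on a ball of volume
    \<open>V\<close> has mass below \<open>\<epsilon>\<close>; dividing by V + 1 instead of V makes
    this strict.\<close>
  define \<eta> where "\<eta> = (\<epsilon> / (V + 1)) powr (1 / p)"
  have "0 < \<eta>"
    using \<open>0 < \<epsilon>\<close> \<open>0 \<le> V\<close> by (simp add: \<eta>_def)
  have "\<eta> powr p * V = \<epsilon> / (V + 1) * V"
    using \<open>0 < \<epsilon>\<close> \<open>0 \<le> V\<close> p by (simp add: \<eta>_def powr_powr)
  also have "\<dots> < \<epsilon>"
    using \<open>0 < \<epsilon>\<close> \<open>0 \<le> V\<close> by (simp add: field_simps)
  finally have \<eta>: "\<eta> powr p * V < \<epsilon>" .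
  \<comment> \<open>x - y has norm at most R + 2 when |x| \<le> R + 1 and |y| \<le> 1; for larger
    |x| both values of g vanish.\<close>
  have "uniformly_continuous_on (cball 0 (R + 2)) g"
    using g by (intro compact_uniformly_continuous compact_cball) (blast intro: continuous_on_subset)
  then obtain d where "0 < d" and d: "\<And>x y. x \<in> cball 0 (R + 2) \<Longrightarrow> y \<in> cball 0 (R + 2) \<Longrightarrow>
      dist y x < d \<Longrightarrow> dist (g y) (g x) < \<eta>"
    unfolding uniformly_continuous_on_def using \<open>0 < \<eta>\<close> by metis
  define \<delta> where "\<delta> = min (d / 2) 1"
  have \<delta>: "0 < \<delta>" "\<delta> < d" "\<delta> \<le> 1"
    using \<open>0 < d\<close> by (auto simp: \<delta>_def)
  have close: "\<bar>g (x - y) - g x\<bar> \<le> \<eta> * indicator (cball 0 (R + 1)) x" if "norm y \<le> \<delta>" for x y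
  proof (cases "norm x \<le> R + 1")
    case True
    then have "x \<in> cball 0 (R + 2)" "x - y \<in> cball 0 (R + 2)"
      using that \<delta> norm_triangle_ineq4[of x y] by auto
    then have "dist (g (x - y)) (g x) < \<eta>"
      using that \<delta> by (intro d) (auto simp: dist_norm)
    then show ?thesis
      using True by (simp add: dist_norm)
  next
    case False
    then have "R < norm (x - y)" "R < norm x"
      using that \<delta> norm_triangle_ineq2[of x y] by auto
    then show ?thesis
      using R False by simp
  qed
  show ?thesis
  proof (intro exI[of _ \<delta>] conjI allI impI \<delta>(1))
    fix \<rho> :: "real ^ 'n \<Rightarrow> real"
    assume \<rho>_moll: "mollifier \<delta> \<rho>"
    note \<rho> = mollifierD[OF \<rho>_moll]
    have le: "\<bar>convol g \<rho> x - g x\<bar> \<le> \<eta> * indicator (cball 0 (R + 1)) x" for x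
    proof -
      have I: "integrable lborel (\<lambda>y. g (x - y) * \<rho> y)" "integrable lborel \<rho>"
        using convol_integrable[OF gp \<rho>(1)] test_function_integrable[OF \<rho>(1)] p by auto
      have "convol g \<rho> x - g x = (LINT y|lborel. g (x - y) * \<rho> y) - (LINT y|lborel. g x * \<rho> y)"
        using \<rho>(4) by (simp add: convol_def)
      also have "\<dots> = (LINT y|lborel. (g (x - y) - g x) * \<rho> y)"
        using I by (subst Bochner_Integration.integral_diff[symmetric]) (auto simp: algebra_simps)
      finally have "\<bar>convol g \<rho> x - g x\<bar> \<le> (LINT y|lborel. \<bar>(g (x - y) - g x) * \<rho> y\<bar>)"
        by simp
      also have "\<dots> \<le> (LINT y|lborel. \<eta> * indicator (cball 0 (R + 1)) x * \<rho> y)"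
      proof (rule integral_mono)
        show "integrable lborel (\<lambda>y. \<bar>(g (x - y) - g x) * \<rho> y\<bar>)"
          using I by (simp add: left_diff_distrib)
        show "\<bar>(g (x - y) - g x) * \<rho> y\<bar> \<le> \<eta> * indicator (cball 0 (R + 1)) x * \<rho> y" for y
          using close[of y x] \<rho>(2)[of y] \<rho>(3)[of y]
          by (cases "norm y \<le> \<delta>") (auto simp: abs_mult mult_right_mono)
      qed (use I in simp)
      also have "\<dots> = \<eta> * indicator (cball 0 (R + 1)) x"
        using \<rho>(4) by simp
      finally show ?thesis .
    qed
    have "Lp_mass p (\<lambda>x. convol g \<rho> x - g x) \<le> (LINT x|lborel. \<eta> powr p * indicator (cball (0 :: real ^ 'n) (R + 1)) x)"
      unfolding Lp_mass_def
    proof (rule integral_mono)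
      show "integrable lborel (\<lambda>x. \<bar>convol g \<rho> x - g x\<bar> powr p)"
        using Lp_diff[OF convol_Lp[OF gp \<rho>_moll p] gp] p by (intro Lp_integrable) simp
      show "integrable lborel (\<lambda>x. \<eta> powr p * indicator (cball (0 :: real ^ 'n) (R + 1)) x)"
        using R by (intro integrable_mult_right integrable_real_indicator) (auto simp: emeasure_cball)
      show "\<bar>convol g \<rho> x - g x\<bar> powr p \<le> \<eta> powr p * indicator (cball 0 (R + 1)) x" for x
        using powr_mono2[OF _ abs_ge_zero le[of x], of p] p
        by (auto simp: indicator_def split: if_splits)
    qed
    also have "\<dots> < \<epsilon>"
      using \<eta> by (simp add: V_def)
    finally show "Lp_mass p (\<lambda>x. convol g \<rho> x - g x) < \<epsilon>" .
  qed
qed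

text \<open>Density argument: convolution with a mollifier does not increase the L^p mass, hence the
  error f - g of a continuous approximation g stays small after mollification.\<close>

lemma convol_approx:
  fixes f :: "real ^ 'n::finite \<Rightarrow> real"
  assumes f: "f \<in> Lp_space p" and "0 < \<epsilon>" and p: "1 < p"
  shows "\<exists>\<delta>>0. \<forall>\<rho>. mollifier \<delta> \<rho> \<longrightarrow> Lp_mass p (\<lambda>x. f x - convol f \<rho> x) < \<epsilon>"
proof -
  \<comment> \<open>Collects the factors of two nested quasi-triangle inequalities for the three
    errors f - g, the mollification error of g, and the mollified f - g.\<close>
  define c where "c = 2 powr p * (1 + 2 powr p * 2)"
  have c_eq: "2 powr p * (e + 2 powr p * (e + e)) = c * e" for e
    by (simp add: c_def algebra_simps)
  have "0 < c" by (simp add: c_def add_pos_nonneg)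
  then have "0 < \<epsilon> / c"
    using \<open>0 < \<epsilon>\<close> by simp
  obtain g R where g: "continuous_on UNIV g" "0 < R" "\<And>x. R < norm x \<Longrightarrow> g x = 0" "g \<in> Lp_space p"
    and fg: "Lp_mass p (\<lambda>x. f x - g x) < \<epsilon> / c"
    using Lp_approx_continuous[OF f _ \<open>0 < \<epsilon> / c\<close>] p by auto
  obtain \<delta> where "0 < \<delta>" and \<delta>: "\<And>\<rho>. mollifier \<delta> \<rho> \<Longrightarrow>
      Lp_mass p (\<lambda>x. convol g \<rho> x - g x) < \<epsilon> / c"
    using convol_continuous_approx[OF g(1-3) \<open>0 < \<epsilon> / c\<close> p g(4)] by blast
  show ?thesis
  proof (intro exI[of _ \<delta>] conjI allI impI \<open>0 < \<delta>\<close>)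
    fix \<rho> :: "real ^ 'n \<Rightarrow> real"
    assume \<rho>_moll: "mollifier \<delta> \<rho>"
    note \<rho> = mollifierD[OF \<rho>_moll]
    have d: "(\<lambda>x. f x - g x) \<in> Lp_space p"
      using f g p by (intro Lp_diff) auto
    have "convol (\<lambda>x. f x - g x) \<rho> x = convol f \<rho> x - convol g \<rho> x" for x
      using p convol_integrable[OF f \<rho>(1), of x] convol_integrable[OF g(4) \<rho>(1), of x]
      by (simp add: convol_def left_diff_distrib)
    then have eq: "(\<lambda>x. f x - convol f \<rho> x) =
        (\<lambda>x. (f x - g x) - ((convol g \<rho> x - g x) + convol (\<lambda>x. f x - g x) \<rho> x))"
      by (simp add: fun_eq_iff)
    have "Lp_mass p (\<lambda>x. f x - convol f \<rho> x) \<le> 2 powr p * (Lp_mass p (\<lambda>x. f x - g x) +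
        Lp_mass p (\<lambda>x. (convol g \<rho> x - g x) + convol (\<lambda>x. f x - g x) \<rho> x))"
      unfolding eq using p by (intro Lp_mass_diff Lp_add Lp_diff d convol_Lp[OF _ \<rho>_moll] f g) auto
    also have "\<dots> \<le> 2 powr p * (Lp_mass p (\<lambda>x. f x - g x) +
        2 powr p * (Lp_mass p (\<lambda>x. convol g \<rho> x - g x) + Lp_mass p (convol (\<lambda>x. f x - g x) \<rho>)))"
      using p by (intro mult_left_mono add_left_mono Lp_mass_add Lp_diff d convol_Lp[OF _ \<rho>_moll] g) auto
    also have "\<dots> < 2 powr p * (\<epsilon> / c + 2 powr p * (\<epsilon> / c + \<epsilon> / c))"
      using fg \<delta>[OF \<rho>_moll] Lp_mass_convol[OF d \<rho>_moll p]
      by (intro mult_strict_left_mono add_strict_mono) auto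
    also have "\<dots> = c * (\<epsilon> / c)"
      by (rule c_eq)
    also have "\<dots> = \<epsilon>"
      using \<open>0 < c\<close> by simp
    finally show "Lp_mass p (\<lambda>x. f x - convol f \<rho> x) < \<epsilon>" .
  qed
qed

text \<open>Every value of \<open>convol f \<rho>\<close> is a pairing of f with a reflected and
  translated mollifier, hence 0, while \<open>convol f \<rho>\<close> is arbitrarily close to
  f.\<close>

lemma Lp_mass_eq_zero:
  fixes f :: "real ^ 'n::finite \<Rightarrow> real"
  assumes f: "f \<in> Lp_space p" and p: "1 < p"
    and orth: "\<And>\<phi>. \<phi> \<in> test_functions \<Longrightarrow> (LINT x|lborel. f x * \<phi> x) = 0"
  shows "Lp_mass p f = 0"
proof -
  have "Lp_mass p f < \<epsilon>" if eps: "0 < \<epsilon>" for \<epsilon>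
  proof -
    obtain \<delta> where "0 < \<delta>" and \<delta>: "\<And>\<rho>. mollifier \<delta> \<rho> \<Longrightarrow>
      Lp_mass p (\<lambda>x. f x - convol f \<rho> x) < \<epsilon>"
      using convol_approx[OF f eps p] by blast
    obtain \<rho> :: "real ^ 'n \<Rightarrow> real" where \<rho>_moll: "mollifier \<delta> \<rho>"
      using mollifier_exists[OF \<open>0 < \<delta>\<close>] by blast
    note \<rho> = mollifierD[OF \<rho>_moll]
    have "convol f \<rho> x = 0" for x
      using orth[OF test_function_affine[OF \<rho>(1), of "-1" x]]
        convol_commute[OF Lp_measurable[OF f] smooth_borel_measurable[OF test_function_smooth[OF \<rho>(1)]]]
      by simp
    then show ?thesis
      using \<delta>[OF \<rho>_moll] by simp
  qed
  then show ?thesis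
    using Lp_mass_nonneg[of p f] by (metis less_irrefl order_le_less)
qed

text \<open>The constant is uniform in the base point, which is what survives integration in
  \<open>convol_has_derivative\<close>. The mean value inequality is applied twice, to the partial
  derivatives and to the remainder itself.\<close>

lemma test_function_Taylor:
  fixes \<psi> :: "real ^ 'n::finite \<Rightarrow> real"
  assumes "\<psi> \<in> test_functions"
  obtains C where "0 \<le> C"
    "\<And>z h. \<bar>\<psi> (z + h) - \<psi> z - (\<Sum>k\<in>UNIV. h $ k * partial_deriv k \<psi> z)\<bar> \<le> C * (norm h)\<^sup>2"
proof -
  have \<psi>: "\<psi> differentiable_on UNIV"
    using assms by (intro smooth_differentiable_on test_function_smooth)
  have "\<exists>B. \<forall>x. \<bar>partial_deriv j (partial_deriv k \<psi>) x\<bar> \<le> B" for j k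
    using test_function_bounded[OF test_function_partial_deriv[OF test_function_partial_deriv[OF assms]]] by metis
  then obtain B where B: "\<And>j k x. \<bar>partial_deriv j (partial_deriv k \<psi>) x\<bar> \<le> B j k"
    by metis
  define L where "L = (\<Sum>j\<in>UNIV. \<Sum>k\<in>UNIV. B j k)"
  have B_nonneg: "0 \<le> B j k" for j k
    using B[of j k 0] abs_ge_zero order_trans by blast
  have "B j k \<le> L" for j k
  proof -
    have "B j k \<le> (\<Sum>k\<in>UNIV. B j k)"
      using B_nonneg by (intro member_le_sum) auto
    also have "\<dots> \<le> L"
      unfolding L_def using B_nonneg
      by (intro member_le_sum[where f = "\<lambda>j. \<Sum>k\<in>UNIV. B j k"]) (auto intro: sum_nonneg)
    finally show ?thesis .
  qed
  then have L: "\<bar>partial_deriv j (partial_deriv k \<psi>) x\<bar> \<le> L" for j k x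
    using B order_trans by blast
  have "0 \<le> L"
    using B_nonneg by (auto simp: L_def intro!: sum_nonneg)
  define n where "n = real CARD('n)"
  have "\<bar>\<psi> (z + h) - \<psi> z - (\<Sum>k\<in>UNIV. h $ k * partial_deriv k \<psi> z)\<bar> \<le> n * (n * L) * (norm h)\<^sup>2" for z h
  proof -
    \<comment> \<open>Subtracting the linear part makes the gradient vanish at 0, so on the ball of
      radius |h| it is of order |h|.\<close>
    define q where "q v = \<psi> (z + v) - (\<Sum>k\<in>UNIV. v $ k * partial_deriv k \<psi> z)" for v
    have q': "(q has_derivative (\<lambda>v. (\<Sum>k\<in>UNIV. v $ k * partial_deriv k \<psi> (z + x)) -
        (\<Sum>k\<in>UNIV. v $ k * partial_deriv k \<psi> z))) (at x)" for x
    proof -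
      have "((\<lambda>v. z + v) has_derivative (\<lambda>v. v)) (at x)"
        by (auto intro!: derivative_eq_intros)
      from has_derivative_compose[OF this has_derivative_partial_deriv[OF \<psi>]]
      have "((\<lambda>v. \<psi> (z + v)) has_derivative (\<lambda>v. \<Sum>k\<in>UNIV. v $ k * partial_deriv k \<psi> (z + x))) (at x)" .
      moreover have "bounded_linear (\<lambda>v :: real ^ 'n. \<Sum>k\<in>UNIV. v $ k * partial_deriv k \<psi> z)"
        by (intro bounded_linear_sum bounded_linear_mult_const bounded_linear_vec_nth)
      ultimately show ?thesis
        unfolding q_def by (intro has_derivative_diff bounded_linear_imp_has_derivative)
    qed
    have q_partial: "partial_deriv k q x = partial_deriv k \<psi> (z + x) - partial_deriv k \<psi> z" for k x
      by (simp add: partial_deriv_eqI[OF q'] axis_def if_distrib if_distribR sum.delta cong: if_cong)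
    have "\<bar>q h - q 0\<bar> \<le> real CARD('n) * (n * L * norm h) * norm (h - 0)"
    proof (rule partial_deriv_Lipschitz[where S = "cball 0 (norm h)"])
      show "q differentiable_on UNIV"
        unfolding differentiable_on_def differentiable_def using q' by blast
      show "\<bar>partial_deriv k q x\<bar> \<le> n * L * norm h" if "x \<in> cball 0 (norm h)" for k x
      proof -
        have "\<bar>partial_deriv k \<psi> (z + x) - partial_deriv k \<psi> z\<bar> \<le> real CARD('n) * L * norm (z + x - z)"
          using L assms
          by (intro partial_deriv_Lipschitz[where S = UNIV] smooth_differentiable_on test_function_smooth
              test_function_partial_deriv) auto
        also have "\<dots> \<le> n * L * norm h"
          using that \<open>0 \<le> L\<close> by (auto simp: n_def intro!: mult_left_mono)
        finally show ?thesis by (simp add: q_partial)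
      qed
    qed auto
    then show ?thesis
      by (simp add: q_def n_def power2_eq_square algebra_simps)
  qed
  moreover have "0 \<le> n * (n * L)"
    using \<open>0 \<le> L\<close> by (simp add: n_def)
  ultimately show ?thesis by (intro that)
qed

lemma has_derivative_quadratic_remainder:
  fixes F :: "'a::real_normed_vector \<Rightarrow> real"
  assumes "bounded_linear D" "0 \<le> C" and le: "\<And>h. \<bar>F (x + h) - F x - D h\<bar> \<le> C * (norm h)\<^sup>2"
  shows "(F has_derivative D) (at x)"
  unfolding has_derivative_at'
proof (intro conjI allI impI)
  fix e :: real
  assume "0 < e"
  show "\<exists>d>0. \<forall>y. 0 < norm (y - x) \<and> norm (y - x) < d \<longrightarrow> norm (F y - F x - D (y - x)) / norm (y - x) < e"
  \<comment> \<open>C + 1 instead of C keeps the radius positive when C = 0.\<close>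
  proof (intro exI[of _ "e / (C + 1)"] conjI allI impI)
    fix y
    assume y: "0 < norm (y - x) \<and> norm (y - x) < e / (C + 1)"
    have "norm (F y - F x - D (y - x)) / norm (y - x) \<le> C * norm (y - x)"
      using le[of "y - x"] y by (simp add: divide_le_eq power2_eq_square mult_ac)
    also have "\<dots> \<le> (C + 1) * norm (y - x)"
      by (intro mult_right_mono) auto
    also have "\<dots> < e"
      using y \<open>0 \<le> C\<close> by (simp add: field_simps)
    finally show "norm (F y - F x - D (y - x)) / norm (y - x) < e" .
  qed (use \<open>0 < e\<close> \<open>0 \<le> C\<close> in auto)
qed fact

text \<open>The Taylor remainder of \<psi> is at most C |h|^2 at every point, and integration
  against |f| only changes the constant; this replaces dominated convergence for difference
  quotients.\<close>

lemma convol_has_derivative: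
  fixes f \<psi> :: "real ^ 'n::finite \<Rightarrow> real"
  assumes f: "integrable lborel f" and \<psi>: "\<psi> \<in> test_functions"
  shows "(convol f \<psi> has_derivative (\<lambda>h. \<Sum>k\<in>UNIV. h $ k * convol f (partial_deriv k \<psi>) x)) (at x)"
proof -
  note [measurable] = borel_measurable_integrable[OF f]
  have conv: "convol f \<phi> z = (LINT y|lborel. f y * \<phi> (z - y))" if "\<phi> \<in> test_functions" for \<phi> z
    using f by (intro convol_commute[OF _ smooth_borel_measurable[OF test_function_smooth[OF that]]]) auto
  have int: "integrable lborel (\<lambda>y. f y * \<phi> (z - y))" if \<phi>: "\<phi> \<in> test_functions" for \<phi> z
  proof -
    note [measurable] = smooth_borel_measurable[OF test_function_smooth[OF \<phi>]]
    obtain B where B: "0 < B" "\<And>x. \<bar>\<phi> x\<bar> \<le> B"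
      using test_function_bounded[OF \<phi>] by blast
    have "integrable lborel (\<lambda>y. B * f y)"
      using f by simp
    then show ?thesis
      by (rule Bochner_Integration.integrable_bound)
         (use B in \<open>auto simp: abs_mult mult.commute[of B] intro!: mult_left_mono\<close>)
  qed
  obtain C where "0 \<le> C" and
    C: "\<And>z h. \<bar>\<psi> (z + h) - \<psi> z - (\<Sum>k\<in>UNIV. h $ k * partial_deriv k \<psi> z)\<bar> \<le> C * (norm h)\<^sup>2"
    using test_function_Taylor[OF \<psi>] by blast
  have d\<psi>: "partial_deriv k \<psi> \<in> test_functions" for k
    using \<psi> by (rule test_function_partial_deriv)
  have "\<bar>convol f \<psi> (x + h) - convol f \<psi> x - (\<Sum>k\<in>UNIV. h $ k * convol f (partial_deriv k \<psi>) x)\<bar> \<le>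
      (C * (LINT y|lborel. \<bar>f y\<bar>)) * (norm h)\<^sup>2" for h
  proof -
    let ?T = "\<lambda>y. f y * (\<psi> (x - y + h) - \<psi> (x - y) - (\<Sum>k\<in>UNIV. h $ k * partial_deriv k \<psi> (x - y)))"
    have T: "?T = (\<lambda>y. f y * \<psi> (x + h - y) - f y * \<psi> (x - y) -
        (\<Sum>k\<in>UNIV. h $ k * (f y * partial_deriv k \<psi> (x - y))))"
      by (simp add: fun_eq_iff right_diff_distrib sum_distrib_left algebra_simps)
    have T_int: "integrable lborel ?T"
      unfolding T by (intro Bochner_Integration.integrable_diff Bochner_Integration.integrable_sum
          integrable_mult_right int \<psi> d\<psi>)
    have eq: "convol f \<psi> (x + h) - convol f \<psi> x - (\<Sum>k\<in>UNIV. h $ k * convol f (partial_deriv k \<psi>) x) =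
        (LINT y|lborel. ?T y)"
      unfolding T by (simp add: conv \<psi> d\<psi> int)
    have "\<bar>convol f \<psi> (x + h) - convol f \<psi> x - (\<Sum>k\<in>UNIV. h $ k * convol f (partial_deriv k \<psi>) x)\<bar> \<le>
        (LINT y|lborel. \<bar>?T y\<bar>)"
      unfolding eq by (rule integral_abs_bound)
    also have "\<dots> \<le> (LINT y|lborel. (C * (norm h)\<^sup>2) * \<bar>f y\<bar>)"
    proof (intro integral_mono integrable_abs T_int)
      show "\<bar>?T y\<bar> \<le> (C * (norm h)\<^sup>2) * \<bar>f y\<bar>" for y
        unfolding abs_mult using mult_left_mono[OF C[of "x - y" h] abs_ge_zero[of "f y"]]
        by (simp add: mult.commute)
    qed (use f in simp)
    finally show ?thesis by (simp add: mult_ac)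
  qed
  moreover have "bounded_linear (\<lambda>h :: real ^ 'n. \<Sum>k\<in>UNIV. h $ k * convol f (partial_deriv k \<psi>) x)"
    by (intro bounded_linear_sum bounded_linear_mult_const bounded_linear_vec_nth)
  moreover have "0 \<le> C * (LINT y|lborel. \<bar>f y\<bar>)"
    using \<open>0 \<le> C\<close> by simp
  ultimately show ?thesis
    by (intro has_derivative_quadratic_remainder)
qed

text \<open>All derivatives fall on \<psi>, so the convolutions of f with test functions form a
  class closed under partial derivatives. The radii of the supports add up.\<close>

lemma convol_test_function:
  fixes f \<psi> :: "real ^ 'n::finite \<Rightarrow> real"
  assumes f: "integrable lborel f" "\<And>x. R < norm x \<Longrightarrow> f x = 0" and \<psi>: "\<psi> \<in> test_functions"
  shows "convol f \<psi> \<in> test_functions"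
proof -
  have "smooth (convol f \<psi>)"
  proof (rule smooth_coinduct[where S = "convol f ` test_functions"])
    fix g
    assume "g \<in> convol f ` test_functions"
    then obtain \<phi> where \<phi>: "\<phi> \<in> test_functions" "g = convol f \<phi>" by auto
    note D = convol_has_derivative[OF f(1) \<phi>(1)]
    show "g differentiable_on UNIV"
      unfolding \<phi> differentiable_on_def differentiable_def using D by blast
    have "partial_deriv k g = convol f (partial_deriv k \<phi>)" for k
      unfolding \<phi>
      by (rule ext) (simp add: partial_deriv_eqI[OF D] axis_def if_distrib if_distribR sum.delta cong: if_cong)
    then show "partial_deriv k g \<in> convol f ` test_functions" for k
      using \<phi> by (auto intro: test_function_partial_deriv)
  qed (use \<psi> in auto)
  moreover obtain S where S: "0 < S" "\<And>x. S < norm x \<Longrightarrow> \<psi> x = 0"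
    using test_function_support[OF \<psi>] by blast
  have "convol f \<psi> x = 0" if "R + S < norm x" for x
  proof -
    have "f (x - y) * \<psi> y = 0" for y
      using f(2)[of "x - y"] S(2)[of y] that norm_triangle_ineq2[of x y] by fastforce
    then have "(\<lambda>y. f (x - y) * \<psi> y) = (\<lambda>y. 0)"
      by (rule ext)
    then show ?thesis
      by (simp only: convol_def) simp
  qed
  ultimately show ?thesis
    by (auto simp: test_functions_iff)
qed

section \<open>Fractional gradients\<close>

text \<open>Pairings have the x-integral outside, whereas translation in x is available for fixed u
  only. Fubini on both sides moves the comparison there.\<close>

lemma iterated_integral_cong:
  fixes A B :: "real ^ 'n::finite \<Rightarrow> 'a \<Rightarrow> real"
  assumes "sigma_finite_measure N"
    and A: "integrable (lborel \<Otimes>\<^sub>M N) (\<lambda>(x, u). A x u)" and B: "integrable (lborel \<Otimes>\<^sub>M N) (\<lambda>(x, u). B x u)"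
    and eq: "\<And>u. (LINT x|lborel. A x u) = (LINT x|lborel. B x u)"
  shows "(LINT x|lborel. LINT u|N. A x u) = (LINT x|lborel. LINT u|N. B x u)"
proof -
  interpret N: sigma_finite_measure N by fact
  interpret P: pair_sigma_finite lborel N ..
  show ?thesis
    using P.integral_fst[OF A] P.integral_snd[OF A] P.integral_fst[OF B] P.integral_snd[OF B] eq by simp
qed

lemma integral_lborel_translate:
  fixes f :: "'a::euclidean_space \<Rightarrow> real"
  assumes "f \<in> borel_measurable borel"
  shows "(LINT x|lborel. f (x + t)) = (LINT x|lborel. f x)"
  using integral_lborel_isometry[OF assms, of 1 t] by (simp add: add.commute)

text \<open>A fixed integrable profile bounded by 1. Difference kernels are bounded by its square,
  so that in \<open>shifted_product_integrable\<close> one factor can be the L^p function and the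
  other the integrable one.\<close>

definition decay :: "real ^ 'n::finite \<Rightarrow> real" where
  "decay x = 1 / (1 + norm x) ^ (CARD('n) + 2)"

lemma decay_measurable [measurable]: "decay \<in> borel_measurable borel"
  unfolding decay_def by measurable

lemma decay_bounds: "0 < decay x" "decay x \<le> 1" "\<bar>decay x\<bar> \<le> 1"
proof -
  have "1 \<le> (1 + norm x) ^ (CARD('a) + 2)"
    by (intro one_le_power) simp
  then show "0 < decay x" "decay x \<le> 1" "\<bar>decay x\<bar> \<le> 1"
    by (auto simp: decay_def)
qed

lemma decay_integrable: "integrable lborel decay"
  using integrable_inverse_power_norm by (simp add: decay_def[abs_def])

lemma decay_Lp: "1 \<le> p \<Longrightarrow> decay \<in> Lp_space p"
  by (rule Lp_bounded_integrable[OF decay_integrable decay_bounds(3)])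

lemma schwartz_decay_bound:
  fixes \<phi> :: "real ^ 'n::finite \<Rightarrow> real"
  assumes "\<phi> \<in> schwartz_space"
  obtains C where "0 \<le> C" "\<And>x. \<bar>\<phi> x\<bar> \<le> C * decay x"
  using schwartz_decay[OF assms, of "[]" "CARD('n) + 2"] by (auto simp: decay_def)

lemma schwartz_bounded:
  assumes "\<phi> \<in> schwartz_space"
  obtains C where "\<And>x. \<bar>\<phi> x\<bar> \<le> C"
proof -
  obtain C where C: "0 \<le> C" "\<And>x. \<bar>\<phi> x\<bar> \<le> C * decay x"
    using schwartz_decay_bound[OF assms] by blast
  have "\<bar>\<phi> x\<bar> \<le> C" for x
    using C(2)[of x] mult_left_mono[OF decay_bounds(2)[of x] C(1)] by simp
  then show ?thesis by (rule that)
qed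

lemma schwartz_measurable: "\<phi> \<in> schwartz_space \<Longrightarrow> \<phi> \<in> borel_measurable borel"
  by (intro smooth_borel_measurable schwartz_smooth)

lemma schwartz_integrable:
  fixes \<phi> :: "real ^ 'n::finite \<Rightarrow> real"
  assumes "\<phi> \<in> schwartz_space"
  shows "integrable lborel \<phi>"
proof -
  obtain C where C: "0 \<le> C" "\<And>x. \<bar>\<phi> x\<bar> \<le> C * decay x"
    using schwartz_decay_bound[OF assms] by blast
  have "integrable lborel (\<lambda>x :: real ^ 'n. C * decay x)"
    by (intro integrable_mult_right decay_integrable)
  then show ?thesis
    by (rule Bochner_Integration.integrable_bound)
       (use C schwartz_measurable[OF assms] in \<open>auto intro: order_trans[OF _ abs_ge_self]\<close>)
qed

lemma schwartz_Lp: "\<phi> \<in> schwartz_space \<Longrightarrow> 1 \<le> p \<Longrightarrow> \<phi> \<in> Lp_space p"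
  by (metis Lp_bounded_integrable schwartz_bounded schwartz_integrable)

lemma Lp_schwartz_integrable:
  assumes "f \<in> Lp_space p" "\<phi> \<in> schwartz_space" "1 \<le> p"
  shows "integrable lborel (\<lambda>x. f x * \<phi> x)"
proof -
  obtain C where C: "\<And>x. \<bar>\<phi> x\<bar> \<le> C"
    using schwartz_bounded[OF assms(2)] by blast
  show ?thesis
    by (rule Lp_mult_integrable[OF assms(1) schwartz_integrable[OF assms(2)] C assms(3)])
qed

text \<open>
  The singular measure \<open>\<nu>\<close> is replaced by the finite measure \<open>\<mu> = min(\<bar>u\<bar>, \<bar>u\<bar>\<^sup>2) \<nu>(du)\<close>, and the
  weight \<open>u\<^sub>k\<close> by \<open>\<theta> k u = u\<^sub>k / min(\<bar>u\<bar>, \<bar>u\<bar>\<^sup>2)\<close>. A difference \<open>\<phi> (x + u) - \<phi> x\<close> of a Schwartz function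
  absorbs the singularity of \<open>\<theta>\<close> at 0, so every kernel that occurs is bounded.
\<close>

locale truncated_levy =
  fixes \<nu> \<mu> :: "(real ^ 'n::finite) measure" and \<theta> :: "'n \<Rightarrow> real ^ 'n \<Rightarrow> real" and p :: real
  assumes finite_\<mu>: "finite_measure \<mu>" and sets_\<mu>: "sets \<mu> = sets borel"
    and \<theta>_measurable [measurable]: "\<theta> k \<in> borel_measurable borel"
    and \<theta>_bound: "\<bar>\<theta> k u\<bar> * min 1 (norm u) \<le> 1"
    and adj: "\<phi> \<in> borel_measurable borel \<Longrightarrow>
      frac_deriv_adj \<nu> k \<phi> x = (LINT u|\<mu>. (\<phi> (x - u) - \<phi> x) * \<theta> k u)"
    and p: "1 < p"
begin

sublocale finite_measure \<mu> by (rule finite_\<mu>)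

sublocale P: pair_sigma_finite lborel \<mu> ..

declare sets_\<mu> [measurable_cong]

text \<open>The increment \<open>v\<close> is separate from \<open>u\<close> because both signs
  occur: \<open>v = u\<close> for D and \<open>v = - u\<close> for its adjoint. The bound on
  \<theta> absorbs the factor \<open>min 1 (norm u)\<close> of the difference.\<close>

lemma difference_kernel_bound:
  fixes \<phi> :: "real ^ 'n \<Rightarrow> real"
  assumes "\<phi> \<in> schwartz_space"
  shows "\<exists>C\<ge>0. \<forall>k x u v. norm v = norm u \<longrightarrow>
    \<bar>(\<phi> (x + v) - \<phi> x) * \<theta> k u\<bar> \<le> C * ((decay (x + v))\<^sup>2 + (decay x)\<^sup>2)"
proof -
  \<comment> \<open>Twice the exponent in \<open>decay\<close>, which yields its square.\<close>
  let ?N = "2 * (CARD('n) + 2)"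
  obtain C where C: "0 \<le> C" "\<And>x u. \<bar>\<phi> (x - u) - \<phi> x\<bar> \<le>
      min 1 (norm u) * (C / (1 + norm (x - u)) ^ ?N + C / (1 + norm x) ^ ?N)"
    using schwartz_difference[OF assms, of ?N] by blast
  have decay2: "(decay y)\<^sup>2 = 1 / (1 + norm y) ^ ?N" for y :: "real ^ 'n"
    by (simp only: decay_def power_divide power_one power_mult[symmetric] mult.commute)
  have C_decay: "C / (1 + norm y) ^ ?N = C * (decay y)\<^sup>2" for y :: "real ^ 'n"
    unfolding decay2 by (simp only: times_divide_eq_right mult_1_right)
  have "\<bar>(\<phi> (x + v) - \<phi> x) * \<theta> k u\<bar> \<le> C * ((decay (x + v))\<^sup>2 + (decay x)\<^sup>2)" if "norm v = norm u" for k x u v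
  proof -
    let ?H = "C * ((decay (x + v))\<^sup>2 + (decay x)\<^sup>2)"
    have "0 \<le> ?H"
      using C by simp
    have "\<bar>\<phi> (x + v) - \<phi> x\<bar> \<le> min 1 (norm u) * ?H"
      using C(2)[of x "- v"] that unfolding C_decay by (simp add: distrib_left)
    then have "\<bar>(\<phi> (x + v) - \<phi> x) * \<theta> k u\<bar> \<le> (min 1 (norm u) * ?H) * \<bar>\<theta> k u\<bar>"
      unfolding abs_mult by (intro mult_right_mono) auto
    also have "\<dots> = (\<bar>\<theta> k u\<bar> * min 1 (norm u)) * ?H"
      by (simp add: mult_ac)
    also have "\<dots> \<le> 1 * ?H"
      using \<open>0 \<le> ?H\<close> \<theta>_bound by (intro mult_right_mono) auto
    finally show ?thesis by simp
  qed
  then show ?thesis using C(1) by blast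
qed

lemma difference_kernel_bounded:
  fixes \<phi> :: "real ^ 'n \<Rightarrow> real"
  assumes "\<phi> \<in> schwartz_space"
  shows "\<exists>C\<ge>0. \<forall>k x u v. norm v = norm u \<longrightarrow> \<bar>(\<phi> (x + v) - \<phi> x) * \<theta> k u\<bar> \<le> C"
proof -
  obtain C where C: "0 \<le> C" "\<And>k x u v. norm v = norm u \<Longrightarrow>
      \<bar>(\<phi> (x + v) - \<phi> x) * \<theta> k u\<bar> \<le> C * ((decay (x + v))\<^sup>2 + (decay x)\<^sup>2)"
    using difference_kernel_bound[OF assms] by blast
  have "(decay y)\<^sup>2 \<le> 1" for y :: "real ^ 'n"
    using decay_bounds[of y] by (simp add: power_le_one)
  then have C2: "C * ((decay y)\<^sup>2 + (decay x)\<^sup>2) \<le> C * (1 + 1)" for x y :: "real ^ 'n"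
    using C(1) by (intro mult_left_mono add_mono) auto
  have le: "\<bar>(\<phi> (x + v) - \<phi> x) * \<theta> k u\<bar> \<le> C * (1 + 1)" if "norm v = norm u" for k x u v
    by (rule order_trans[OF C(2)[OF that] C2])
  show ?thesis
    by (rule exI[of _ "C * (1 + 1)"]) (use C(1) le in simp)
qed

lemma difference_kernel_integrable:
  fixes \<phi> :: "real ^ 'n \<Rightarrow> real"
  assumes \<phi>: "\<phi> \<in> schwartz_space" and [measurable]: "s \<in> borel \<rightarrow>\<^sub>M borel" and s: "\<And>u. norm (s u) = norm u"
  shows "integrable \<mu> (\<lambda>u. (\<phi> (x + s u) - \<phi> x) * \<theta> k u)"
proof -
  note [measurable] = schwartz_measurable[OF \<phi>]
  obtain C where C: "\<And>k x u v. norm v = norm u \<Longrightarrow> \<bar>(\<phi> (x + v) - \<phi> x) * \<theta> k u\<bar> \<le> C"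
    using difference_kernel_bounded[OF \<phi>] by blast
  show ?thesis
    by (rule integrable_const_bound[where B = C]) (use C s in auto)
qed

lemma
  fixes \<phi> :: "real ^ 'n \<Rightarrow> real"
  assumes \<phi>: "\<phi> \<in> schwartz_space" and [measurable]: "s \<in> borel \<rightarrow>\<^sub>M borel" and s: "\<And>u. norm (s u) = norm u"
  shows difference_kernel_pair_integrable:
      "integrable (lborel \<Otimes>\<^sub>M \<mu>) (\<lambda>(x, u). (\<phi> (x + s u) - \<phi> x) * \<theta> k u)"
    and Lp_difference_kernel_pair_integrable:
      "f \<in> Lp_space p \<Longrightarrow> integrable (lborel \<Otimes>\<^sub>M \<mu>) (\<lambda>(x, u). f x * ((\<phi> (x + s u) - \<phi> x) * \<theta> k u))"
proof -
  note [measurable] = schwartz_measurable[OF \<phi>]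
  have sf: "sigma_finite_measure \<mu>" ..
  obtain C where C: "0 \<le> C" "\<And>k x u v. norm v = norm u \<Longrightarrow>
      \<bar>(\<phi> (x + v) - \<phi> x) * \<theta> k u\<bar> \<le> C * ((decay (x + v))\<^sup>2 + (decay x)\<^sup>2)"
    using difference_kernel_bound[OF \<phi>] by blast
  have D: "integrable (lborel \<Otimes>\<^sub>M \<mu>) (\<lambda>(x, u). f (x + t u) * decay (x + t' u) * C)"
    if "f \<in> Lp_space p" "t \<in> borel \<rightarrow>\<^sub>M borel" "t' \<in> borel \<rightarrow>\<^sub>M borel" for f t t'
    using shifted_product_integrable[OF sf that(1) decay_integrable decay_bounds(3), of "\<lambda>u. C" t t'] that p
    by simp
  \<comment> \<open>Each square is read as a product of two equally shifted factors
    \<open>decay\<close>.\<close>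
  have "integrable (lborel \<Otimes>\<^sub>M \<mu>) (\<lambda>z. (case z of (x, u) \<Rightarrow> decay (x + s u) * decay (x + s u) * C) +
      (case z of (x, u) \<Rightarrow> decay (x + 0) * decay (x + 0) * C))"
    using p by (intro Bochner_Integration.integrable_add D[of decay s s] D[of decay "\<lambda>u. 0" "\<lambda>u. 0"] decay_Lp) auto
  then show "integrable (lborel \<Otimes>\<^sub>M \<mu>) (\<lambda>(x, u). (\<phi> (x + s u) - \<phi> x) * \<theta> k u)"
  proof (rule Bochner_Integration.integrable_bound)
    show "AE z in lborel \<Otimes>\<^sub>M \<mu>. norm (case z of (x, u) \<Rightarrow> (\<phi> (x + s u) - \<phi> x) * \<theta> k u) \<le>
      norm ((case z of (x, u) \<Rightarrow> decay (x + s u) * decay (x + s u) * C) +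
        (case z of (x, u) \<Rightarrow> decay (x + 0) * decay (x + 0) * C))"
    proof (intro AE_I2)
      fix z :: "(real ^ 'n) \<times> (real ^ 'n)"
      show "norm (case z of (x, u) \<Rightarrow> (\<phi> (x + s u) - \<phi> x) * \<theta> k u) \<le>
        norm ((case z of (x, u) \<Rightarrow> decay (x + s u) * decay (x + s u) * C) +
          (case z of (x, u) \<Rightarrow> decay (x + 0) * decay (x + 0) * C))"
        using C(2)[OF s, of "fst z" "snd z" k]
        by (simp add: split_beta power2_eq_square algebra_simps)
    qed
  qed measurable
  assume f: "f \<in> Lp_space p"
  note [measurable] = Lp_measurable[OF f]
  have "integrable (lborel \<Otimes>\<^sub>M \<mu>) (\<lambda>z. \<bar>case z of (x, u) \<Rightarrow> f (x + 0) * decay (x + s u) * C\<bar> +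
      \<bar>case z of (x, u) \<Rightarrow> f (x + 0) * decay (x + 0) * C\<bar>)"
    using p by (intro Bochner_Integration.integrable_add integrable_abs D[of f "\<lambda>u. 0" s] D[of f "\<lambda>u. 0" "\<lambda>u. 0"] f) auto
  then show "integrable (lborel \<Otimes>\<^sub>M \<mu>) (\<lambda>(x, u). f x * ((\<phi> (x + s u) - \<phi> x) * \<theta> k u))"
  proof (rule Bochner_Integration.integrable_bound)
    show "AE z in lborel \<Otimes>\<^sub>M \<mu>. norm (case z of (x, u) \<Rightarrow> f x * ((\<phi> (x + s u) - \<phi> x) * \<theta> k u)) \<le>
      norm (\<bar>case z of (x, u) \<Rightarrow> f (x + 0) * decay (x + s u) * C\<bar> +
        \<bar>case z of (x, u) \<Rightarrow> f (x + 0) * decay (x + 0) * C\<bar>)"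
    proof (intro AE_I2)
      fix z :: "(real ^ 'n) \<times> (real ^ 'n)"
      obtain x u where z: "z = (x, u)" by (cases z)
      \<comment> \<open>Here \<open>f\<close> is the L^p function, so the square is weakened to a
        single factor \<open>decay\<close>.\<close>
      have "(decay y)\<^sup>2 \<le> decay y" for y :: "real ^ 'n"
        using decay_bounds[of y] by (simp add: power2_eq_square mult_left_le)
      then have "C * ((decay (x + s u))\<^sup>2 + (decay x)\<^sup>2) \<le> C * (decay (x + s u) + decay x)"
        using C(1) by (intro mult_left_mono add_mono) auto
      then have "\<bar>f x\<bar> * \<bar>(\<phi> (x + s u) - \<phi> x) * \<theta> k u\<bar> \<le> \<bar>f x\<bar> * (C * (decay (x + s u) + decay x))"
        using C(2)[OF s, of x u k] by (intro mult_left_mono) auto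
      also have "\<dots> = \<bar>f x * decay (x + s u) * C\<bar> + \<bar>f x * decay x * C\<bar>"
        using C(1) decay_bounds(1)[of x] decay_bounds(1)[of "x + s u"] by (simp add: abs_mult algebra_simps)
      finally show "norm (case z of (x, u) \<Rightarrow> f x * ((\<phi> (x + s u) - \<phi> x) * \<theta> k u)) \<le>
        norm (\<bar>case z of (x, u) \<Rightarrow> f (x + 0) * decay (x + s u) * C\<bar> +
          \<bar>case z of (x, u) \<Rightarrow> f (x + 0) * decay (x + 0) * C\<bar>)"
        by (simp add: z abs_mult)
    qed
  qed measurable
qed

lemma adj_schwartz:
  "\<phi> \<in> schwartz_space \<Longrightarrow> frac_deriv_adj \<nu> k \<phi> x = (LINT u|\<mu>. (\<phi> (x + - u) - \<phi> x) * \<theta> k u)"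
  using adj[OF schwartz_measurable] by simp

lemma adj_integrable:
  assumes "\<phi> \<in> schwartz_space"
  shows "integrable lborel (frac_deriv_adj \<nu> k \<phi>)"
proof -
  have "frac_deriv_adj \<nu> k \<phi> = (\<lambda>x. LINT u|\<mu>. (\<phi> (x + - u) - \<phi> x) * \<theta> k u)"
    using adj_schwartz[OF assms] by (rule ext)
  then show ?thesis
    using P.integrable_fst[OF difference_kernel_pair_integrable[OF assms, of uminus k]] by simp
qed

lemma kernel_integral_bounded:
  fixes \<phi> :: "real ^ 'n \<Rightarrow> real"
  assumes "\<phi> \<in> schwartz_space" "s \<in> borel \<rightarrow>\<^sub>M borel" "\<And>u. norm (s u) = norm u"
  obtains B where "\<And>x. \<bar>LINT u|\<mu>. (\<phi> (x + s u) - \<phi> x) * \<theta> k u\<bar> \<le> B"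
proof -
  obtain C where C: "\<And>k x u v. norm v = norm u \<Longrightarrow> \<bar>(\<phi> (x + v) - \<phi> x) * \<theta> k u\<bar> \<le> C"
    using difference_kernel_bounded[OF assms(1)] by blast
  have "\<bar>LINT u|\<mu>. (\<phi> (x + s u) - \<phi> x) * \<theta> k u\<bar> \<le> (LINT u|\<mu>. C)" for x
  proof -
    have "\<bar>LINT u|\<mu>. (\<phi> (x + s u) - \<phi> x) * \<theta> k u\<bar> \<le> (LINT u|\<mu>. \<bar>(\<phi> (x + s u) - \<phi> x) * \<theta> k u\<bar>)"
      by (rule integral_abs_bound)
    also have "\<dots> \<le> (LINT u|\<mu>. C)"
      using C assms(3) by (intro integral_mono integrable_abs difference_kernel_integrable assms) auto
    finally show ?thesis .
  qed
  then show ?thesis by (rule that)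
qed

lemma Lp_adj_integrable:
  assumes "f \<in> Lp_space p" "\<phi> \<in> schwartz_space"
  shows "integrable lborel (\<lambda>x. f x * frac_deriv_adj \<nu> k \<phi> x)"
proof -
  obtain B where "\<And>x. \<bar>LINT u|\<mu>. (\<phi> (x + - u) - \<phi> x) * \<theta> k u\<bar> \<le> B"
    using kernel_integral_bounded[OF assms(2), of uminus k] by auto
  then have B: "\<bar>frac_deriv_adj \<nu> k \<phi> x\<bar> \<le> B" for x
    using adj_schwartz[OF assms(2)] by simp
  show ?thesis
    using Lp_mult_integrable[OF assms(1) adj_integrable[OF assms(2)] B] p by simp
qed

lemma represents_diff:
  assumes "f \<in> Lp_space p" "h \<in> Lp_space p" "a \<in> Lp_space p" "b \<in> Lp_space p"
    and "represents a (frac_deriv_distr \<nu> k f)" "represents b (frac_deriv_distr \<nu> k h)"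
  shows "represents (\<lambda>x. a x - b x) (frac_deriv_distr \<nu> k (\<lambda>x. f x - h x))"
  unfolding represents_def
proof
  fix \<phi> :: "real ^ 'n \<Rightarrow> real"
  assume \<phi>: "\<phi> \<in> schwartz_space"
  have "frac_deriv_distr \<nu> k (\<lambda>x. f x - h x) \<phi> = frac_deriv_distr \<nu> k f \<phi> - frac_deriv_distr \<nu> k h \<phi>"
    using Lp_adj_integrable[OF assms(1) \<phi>] Lp_adj_integrable[OF assms(2) \<phi>]
    by (simp add: frac_deriv_distr_def left_diff_distrib)
  also have "\<dots> = (LINT x|lborel. a x * \<phi> x) - (LINT x|lborel. b x * \<phi> x)"
    using assms(5,6) \<phi> by (simp add: represents_def)
  also have "\<dots> = (LINT x|lborel. (a x - b x) * \<phi> x)"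
    using Lp_schwartz_integrable[OF assms(3) \<phi>] Lp_schwartz_integrable[OF assms(4) \<phi>] p
    by (simp add: left_diff_distrib)
  finally show "frac_deriv_distr \<nu> k (\<lambda>x. f x - h x) \<phi> = (LINT x|lborel. (a x - b x) * \<phi> x)" .
qed

text \<open>Representatives of the same functional have equal pairings with all test functions, so
  \<open>Lp_mass_eq_zero\<close> applies to their difference.\<close>

lemma represents_unique:
  fixes a b :: "real ^ 'n \<Rightarrow> real"
  assumes a: "a \<in> Lp_space p" and b: "b \<in> Lp_space p" and "represents a T" "represents b T"
  shows "Lp_mass p a = Lp_mass p b"
proof -
  have d: "(\<lambda>x. a x - b x) \<in> Lp_space p"
    using a b p by (intro Lp_diff) auto
  have "Lp_mass p (\<lambda>x. a x - b x) = 0"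
  proof (rule Lp_mass_eq_zero[OF d p])
    fix \<phi> :: "real ^ 'n \<Rightarrow> real"
    assume "\<phi> \<in> test_functions"
    then have \<phi>: "\<phi> \<in> schwartz_space"
      using test_functions_subset_schwartz by blast
    then show "(LINT x|lborel. (a x - b x) * \<phi> x) = 0"
      using Lp_schwartz_integrable[OF a \<phi>] Lp_schwartz_integrable[OF b \<phi>] p assms(3,4)
      by (simp add: left_diff_distrib represents_def)
  qed
  then have "AE x in lborel. \<bar>a x - b x\<bar> powr p = 0"
    using Lp_integrable[OF d] by (subst (asm) Lp_mass_def, subst (asm) integral_nonneg_eq_0_iff_AE) auto
  then have "AE x in lborel. a x = b x"
    by (rule eventually_mono) (use p in auto)
  then show ?thesis
    using a b by (rule Lp_mass_cong_AE)
qed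

text \<open>The norm involves representatives picked by \<open>SOME\<close>; uniqueness almost
  everywhere lets explicit ones take their place.\<close>

lemma frac_sobolev_norm_eq:
  assumes "f \<in> Lp_space p"
    and d: "\<And>k. d k \<in> Lp_space p" "\<And>k. represents (d k) (frac_deriv_distr \<nu> k f)"
  shows "frac_sobolev_norm \<nu> p f = (Lp_mass p f + (\<Sum>k\<in>UNIV. Lp_mass p (d k))) powr (1 / p)"
proof -
  have "Lp_mass p (frac_deriv \<nu> p k f) = Lp_mass p (d k)" for k
  proof -
    have "frac_deriv \<nu> p k f \<in> Lp_space p \<and> represents (frac_deriv \<nu> p k f) (frac_deriv_distr \<nu> k f)"
      unfolding frac_deriv_def using d[of k] by (rule_tac someI[where x = "d k"]) simp
    then show ?thesis
      using represents_unique[OF _ d(1) _ d(2)] by simp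
  qed
  then show ?thesis
    by (simp add: frac_sobolev_norm_def Lp_mass_def)
qed

text \<open>The representative is the pointwise fractional gradient. For fixed u the weight
  \<open>\<theta> k u\<close> is a number, the two terms of the difference are integrable
  separately, and translation by u moves the shift from \<phi> to f.\<close>

lemma schwartz_frac_sobolev:
  assumes f: "f \<in> schwartz_space"
  shows "f \<in> frac_sobolev \<nu> p"
proof -
  have fp: "f \<in> Lp_space p"
    using f p by (intro schwartz_Lp) auto
  note [measurable] = schwartz_measurable[OF f]
  have sf: "sigma_finite_measure \<mu>" ..
  have "\<exists>g\<in>Lp_space p. represents g (frac_deriv_distr \<nu> k f)" for k
  proof (intro bexI[of _ "\<lambda>x. LINT u|\<mu>. (f (x + u) - f x) * \<theta> k u"])
    have I: "integrable (lborel \<Otimes>\<^sub>M \<mu>) (\<lambda>(x, u). (f (x + u) - f x) * \<theta> k u)"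
      by (rule difference_kernel_pair_integrable[OF f]) auto
    obtain B where B: "\<And>x. \<bar>LINT u|\<mu>. (f (x + u) - f x) * \<theta> k u\<bar> \<le> B"
      using kernel_integral_bounded[OF f, of "\<lambda>u. u" k] by auto
    show "(\<lambda>x. LINT u|\<mu>. (f (x + u) - f x) * \<theta> k u) \<in> Lp_space p"
      using p by (intro Lp_bounded_integrable[OF P.integrable_fst[OF I] B]) auto
    show "represents (\<lambda>x. LINT u|\<mu>. (f (x + u) - f x) * \<theta> k u) (frac_deriv_distr \<nu> k f)"
      unfolding represents_def
    proof
      fix \<phi> :: "real ^ 'n \<Rightarrow> real"
      assume \<phi>: "\<phi> \<in> schwartz_space"
      note [measurable] = schwartz_measurable[OF \<phi>]
      have \<phi>p: "\<phi> \<in> Lp_space p"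
        using \<phi> p by (intro schwartz_Lp) auto
      have "frac_deriv_distr \<nu> k f \<phi> = (LINT x|lborel. LINT u|\<mu>. f x * ((\<phi> (x + - u) - \<phi> x) * \<theta> k u))"
        by (simp add: frac_deriv_distr_def adj_schwartz[OF \<phi>])
      also have "\<dots> = (LINT x|lborel. LINT u|\<mu>. \<phi> x * ((f (x + u) - f x) * \<theta> k u))"
      proof (rule iterated_integral_cong[OF sf])
        show "integrable (lborel \<Otimes>\<^sub>M \<mu>) (\<lambda>(x, u). f x * ((\<phi> (x + - u) - \<phi> x) * \<theta> k u))"
          by (rule Lp_difference_kernel_pair_integrable[OF \<phi> _ _ fp]) auto
        show "integrable (lborel \<Otimes>\<^sub>M \<mu>) (\<lambda>(x, u). \<phi> x * ((f (x + u) - f x) * \<theta> k u))"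
          by (rule Lp_difference_kernel_pair_integrable[OF f _ _ \<phi>p]) auto
        show "(LINT x|lborel. f x * ((\<phi> (x + - u) - \<phi> x) * \<theta> k u)) =
            (LINT x|lborel. \<phi> x * ((f (x + u) - f x) * \<theta> k u))" for u
        proof -
          have I1: "integrable lborel (\<lambda>x. f x * \<phi> (x + - u))" for u
            using Lp_schwartz_integrable[OF fp schwartz_translate[OF \<phi>, of "- u"]] p
            by (simp add: add.commute)
          have I2: "integrable lborel (\<lambda>x. \<phi> x * f (x + u))"
            using Lp_schwartz_integrable[OF \<phi>p schwartz_translate[OF f, of u]] p
            by (simp add: add.commute)
          have I0: "integrable lborel (\<lambda>x. f x * \<phi> x)"
            using Lp_schwartz_integrable[OF fp \<phi>] p by simp
          have "(LINT x|lborel. f x * ((\<phi> (x + - u) - \<phi> x) * \<theta> k u)) =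
              (LINT x|lborel. (f x * \<phi> (x + - u) - f x * \<phi> x) * \<theta> k u)"
            by (simp add: algebra_simps)
          also have "\<dots> = ((LINT x|lborel. f x * \<phi> (x + - u)) - (LINT x|lborel. f x * \<phi> x)) * \<theta> k u"
            using I1[of u] I0 by simp
          also have "(LINT x|lborel. f x * \<phi> (x + - u)) = (LINT x|lborel. \<phi> x * f (x + u))"
            using integral_lborel_translate[of "\<lambda>x. f x * \<phi> (x + - u)" u] by (simp add: mult.commute)
          also have "((LINT x|lborel. \<phi> x * f (x + u)) - (LINT x|lborel. f x * \<phi> x)) * \<theta> k u =
              (LINT x|lborel. (\<phi> x * f (x + u) - f x * \<phi> x) * \<theta> k u)"
            using I2 I0 by simp
          also have "\<dots> = (LINT x|lborel. \<phi> x * ((f (x + u) - f x) * \<theta> k u))"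
            by (simp add: algebra_simps)
          finally show ?thesis .
        qed
      qed
      also have "\<dots> = (LINT x|lborel. (LINT u|\<mu>. (f (x + u) - f x) * \<theta> k u) * \<phi> x)"
        by (simp add: mult.commute)
      finally show "frac_deriv_distr \<nu> k f \<phi> = (LINT x|lborel. (LINT u|\<mu>. (f (x + u) - f x) * \<theta> k u) * \<phi> x)" .
    qed
  qed
  then show ?thesis
    using fp by (simp add: frac_sobolev_def)
qed

text \<open>Leibniz rule by duality: on the test side \<eta> D^*\<phi> equals D^* of \<eta> \<phi>
  plus a remainder S. Since \<eta> \<phi> is again Schwartz, the first term is governed by the
  hypothesis on g. Fubini and a translation of x by u turn the pairing of f with S into the pairing
  of T with \<phi>.\<close>

lemma represents_cutoff:
  assumes f: "f \<in> Lp_space p" and g: "g \<in> Lp_space p" "represents g (frac_deriv_distr \<nu> k f)"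
    and \<eta>: "\<eta> \<in> test_functions"
  defines "T \<equiv> \<lambda>x. LINT u|\<mu>. f (x + u) * ((\<eta> (x + u) - \<eta> x) * \<theta> k u)"
  assumes T: "T \<in> Lp_space p"
  shows "represents (\<lambda>x. \<eta> x * g x + T x) (frac_deriv_distr \<nu> k (\<lambda>x. \<eta> x * f x))"
  unfolding represents_def
proof
  fix \<phi> :: "real ^ 'n \<Rightarrow> real"
  assume \<phi>: "\<phi> \<in> schwartz_space"
  have \<eta>S: "\<eta> \<in> schwartz_space"
    using \<eta> test_functions_subset_schwartz by blast
  note [measurable] = schwartz_measurable[OF \<phi>] schwartz_measurable[OF \<eta>S] Lp_measurable[OF f] Lp_measurable[OF g(1)]
  have sf: "sigma_finite_measure \<mu>" ..
  have "(\<lambda>x. \<eta> x * \<phi> x) \<in> test_functions"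
    using \<eta> \<phi> by (intro test_function_mult schwartz_smooth)
  then have \<eta>\<phi>: "(\<lambda>x. \<eta> x * \<phi> x) \<in> schwartz_space"
    using test_functions_subset_schwartz by blast
  define S where "S x = (LINT u|\<mu>. - (\<phi> (x + - u) * ((\<eta> (x + - u) - \<eta> x) * \<theta> k u)))" for x
  obtain C where C: "0 \<le> C" "\<And>k x u v. norm v = norm u \<Longrightarrow> \<bar>(\<eta> (x + v) - \<eta> x) * \<theta> k u\<bar> \<le> C"
    using difference_kernel_bounded[OF \<eta>S] by blast
  obtain B where B: "\<And>x. \<bar>\<phi> x\<bar> \<le> B"
    using schwartz_bounded[OF \<phi>] by blast
  have leibniz: "\<eta> x * frac_deriv_adj \<nu> k \<phi> x = frac_deriv_adj \<nu> k (\<lambda>x. \<eta> x * \<phi> x) x + S x" for x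
  proof -
    have I1: "integrable \<mu> (\<lambda>u. (\<eta> (x + - u) * \<phi> (x + - u) - \<eta> x * \<phi> x) * \<theta> k u)"
      using difference_kernel_integrable[OF \<eta>\<phi>, of uminus x k] by simp
    have I2: "integrable \<mu> (\<lambda>u. - (\<phi> (x + - u) * ((\<eta> (x + - u) - \<eta> x) * \<theta> k u)))"
    proof (rule integrable_const_bound[where B = "B * C"])
      show "AE u in \<mu>. norm (- (\<phi> (x + - u) * ((\<eta> (x + - u) - \<eta> x) * \<theta> k u))) \<le> B * C"
      proof (intro AE_I2)
        fix u
        have "\<bar>\<phi> (x + - u)\<bar> * \<bar>(\<eta> (x + - u) - \<eta> x) * \<theta> k u\<bar> \<le> B * C"
          using B[of "x + - u"] C(2)[of "- u" u x k] abs_ge_zero[of "\<phi> (x + - u)"]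
          by (intro mult_mono) (auto simp del: abs_ge_zero)
        then show "norm (- (\<phi> (x + - u) * ((\<eta> (x + - u) - \<eta> x) * \<theta> k u))) \<le> B * C"
          by (simp add: abs_mult)
      qed
    qed measurable
    have "\<eta> x * frac_deriv_adj \<nu> k \<phi> x = (LINT u|\<mu>. \<eta> x * ((\<phi> (x + - u) - \<phi> x) * \<theta> k u))"
      by (simp add: adj_schwartz[OF \<phi>])
    also have "\<dots> = (LINT u|\<mu>. (\<eta> (x + - u) * \<phi> (x + - u) - \<eta> x * \<phi> x) * \<theta> k u +
        - (\<phi> (x + - u) * ((\<eta> (x + - u) - \<eta> x) * \<theta> k u)))"
      by (intro Bochner_Integration.integral_cong) (auto simp: algebra_simps)
    also have "\<dots> = frac_deriv_adj \<nu> k (\<lambda>x. \<eta> x * \<phi> x) x + S x"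
      unfolding S_def adj_schwartz[OF \<eta>\<phi>] using I1 I2 by (rule Bochner_Integration.integral_add)
    finally show ?thesis .
  qed
  have k_int: "integrable \<mu> (\<lambda>u. C)" by simp
  have A: "integrable (lborel \<Otimes>\<^sub>M \<mu>) (\<lambda>(x, u). f x * - (\<phi> (x + - u) * ((\<eta> (x + - u) - \<eta> x) * \<theta> k u)))"
  proof (rule Bochner_Integration.integrable_bound)
    show "integrable (lborel \<Otimes>\<^sub>M \<mu>) (\<lambda>(x, u). f (x + 0) * \<phi> (x + - u) * C)"
      using shifted_product_integrable[OF sf f schwartz_integrable[OF \<phi>] B _ k_int, of "\<lambda>u. 0" uminus] p by simp
    show "AE z in lborel \<Otimes>\<^sub>M \<mu>. norm (case z of (x, u) \<Rightarrow> f x * - (\<phi> (x + - u) * ((\<eta> (x + - u) - \<eta> x) * \<theta> k u)))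
        \<le> norm (case z of (x, u) \<Rightarrow> f (x + 0) * \<phi> (x + - u) * C)"
    proof (intro AE_I2)
      fix z :: "(real ^ 'n) \<times> (real ^ 'n)"
      obtain x u where z: "z = (x, u)" by (cases z)
      have "\<bar>f x * \<phi> (x + - u)\<bar> * \<bar>(\<eta> (x + - u) - \<eta> x) * \<theta> k u\<bar> \<le> \<bar>f x * \<phi> (x + - u)\<bar> * C"
        using C(2)[of "- u" u x k] by (intro mult_left_mono) auto
      then show "norm (case z of (x, u) \<Rightarrow> f x * - (\<phi> (x + - u) * ((\<eta> (x + - u) - \<eta> x) * \<theta> k u)))
        \<le> norm (case z of (x, u) \<Rightarrow> f (x + 0) * \<phi> (x + - u) * C)"
        using C(1) by (simp add: z abs_mult mult.assoc)
    qed
  qed measurable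
  have B': "integrable (lborel \<Otimes>\<^sub>M \<mu>) (\<lambda>(x, u). f (x + u) * ((\<eta> (x + u) - \<eta> x) * \<theta> k u) * \<phi> x)"
  proof (rule Bochner_Integration.integrable_bound)
    show "integrable (lborel \<Otimes>\<^sub>M \<mu>) (\<lambda>(x, u). f (x + u) * \<phi> (x + 0) * C)"
      using shifted_product_integrable[OF sf f schwartz_integrable[OF \<phi>] B _ k_int, of "\<lambda>u. u" "\<lambda>u. 0"] p by simp
    show "AE z in lborel \<Otimes>\<^sub>M \<mu>. norm (case z of (x, u) \<Rightarrow> f (x + u) * ((\<eta> (x + u) - \<eta> x) * \<theta> k u) * \<phi> x)
        \<le> norm (case z of (x, u) \<Rightarrow> f (x + u) * \<phi> (x + 0) * C)"
    proof (intro AE_I2)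
      fix z :: "(real ^ 'n) \<times> (real ^ 'n)"
      obtain x u where z: "z = (x, u)" by (cases z)
      have "\<bar>f (x + u) * \<phi> x\<bar> * \<bar>(\<eta> (x + u) - \<eta> x) * \<theta> k u\<bar> \<le> \<bar>f (x + u) * \<phi> x\<bar> * C"
        using C(2)[of u u x k] by (intro mult_left_mono) auto
      then show "norm (case z of (x, u) \<Rightarrow> f (x + u) * ((\<eta> (x + u) - \<eta> x) * \<theta> k u) * \<phi> x)
        \<le> norm (case z of (x, u) \<Rightarrow> f (x + u) * \<phi> (x + 0) * C)"
        using C(1) by (simp add: z abs_mult mult_ac)
    qed
  qed measurable
  have S_int: "integrable lborel (\<lambda>x. f x * S x)"
    using P.integrable_fst[OF A] by (simp add: S_def)
  have "frac_deriv_distr \<nu> k (\<lambda>x. \<eta> x * f x) \<phi> =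
      (LINT x|lborel. f x * frac_deriv_adj \<nu> k (\<lambda>x. \<eta> x * \<phi> x) x + f x * S x)"
    unfolding frac_deriv_distr_def
    by (intro Bochner_Integration.integral_cong refl) (simp add: leibniz[symmetric] flip: distrib_left)
  also have "\<dots> = (LINT x|lborel. f x * frac_deriv_adj \<nu> k (\<lambda>x. \<eta> x * \<phi> x) x) + (LINT x|lborel. f x * S x)"
    by (intro Bochner_Integration.integral_add Lp_adj_integrable f \<eta>\<phi> S_int)
  also have "(LINT x|lborel. f x * frac_deriv_adj \<nu> k (\<lambda>x. \<eta> x * \<phi> x) x) = (LINT x|lborel. g x * (\<eta> x * \<phi> x))"
    using g(2) \<eta>\<phi> by (simp add: represents_def frac_deriv_distr_def)
  also have "(LINT x|lborel. f x * S x) =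
      (LINT x|lborel. LINT u|\<mu>. f x * - (\<phi> (x + - u) * ((\<eta> (x + - u) - \<eta> x) * \<theta> k u)))"
    by (simp add: S_def)
  also have "\<dots> = (LINT x|lborel. LINT u|\<mu>. f (x + u) * ((\<eta> (x + u) - \<eta> x) * \<theta> k u) * \<phi> x)"
  proof (rule iterated_integral_cong[OF sf A B'])
    fix u
    show "(LINT x|lborel. f x * - (\<phi> (x + - u) * ((\<eta> (x + - u) - \<eta> x) * \<theta> k u))) =
        (LINT x|lborel. f (x + u) * ((\<eta> (x + u) - \<eta> x) * \<theta> k u) * \<phi> x)"
      by (subst integral_lborel_translate[of _ u, symmetric]) (simp_all add: algebra_simps)
  qed
  also have "\<dots> = (LINT x|lborel. T x * \<phi> x)"
    by (simp add: T_def)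
  also have "(LINT x|lborel. g x * (\<eta> x * \<phi> x)) + (LINT x|lborel. T x * \<phi> x) =
      (LINT x|lborel. g x * (\<eta> x * \<phi> x) + T x * \<phi> x)"
    using p by (intro Bochner_Integration.integral_add[symmetric] Lp_schwartz_integrable[OF g(1) \<eta>\<phi>]
        Lp_schwartz_integrable[OF T \<phi>]) auto
  also have "\<dots> = (LINT x|lborel. (\<eta> x * g x + T x) * \<phi> x)"
    by (simp add: algebra_simps)
  finally show "frac_deriv_distr \<nu> k (\<lambda>x. \<eta> x * f x) \<phi> = (LINT x|lborel. (\<eta> x * g x + T x) * \<phi> x)" .
qed

end

section \<open>Approximation of Sobolev functions by test functions\<close>

lemma test_function_Lipschitz:
  fixes f :: "real ^ 'n::finite \<Rightarrow> real"
  assumes "f \<in> test_functions"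
  shows "\<exists>L\<ge>0. \<forall>x y. \<bar>f x - f y\<bar> \<le> L * norm (x - y)"
proof -
  have "\<exists>B. \<forall>x. \<bar>partial_deriv k f x\<bar> \<le> B" for k
    using test_function_bounded[OF test_function_partial_deriv[OF assms]] by metis
  then obtain B where B: "\<And>k x. \<bar>partial_deriv k f x\<bar> \<le> B k" by metis
  have B_nonneg: "0 \<le> B k" for k
    using B[of k 0] abs_ge_zero order_trans by blast
  have "\<bar>partial_deriv k f x\<bar> \<le> (\<Sum>k\<in>UNIV. B k)" for k x
  proof -
    have "B k \<le> (\<Sum>k\<in>UNIV. B k)"
      using B_nonneg by (intro member_le_sum) auto
    then show ?thesis
      using B order_trans by blast
  qed
  then have "\<bar>f x - f y\<bar> \<le> real CARD('n) * (\<Sum>k\<in>UNIV. B k) * norm (x - y)" for x y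
    by (intro partial_deriv_Lipschitz[where S = UNIV] smooth_differentiable_on test_function_smooth assms) auto
  moreover have "0 \<le> real CARD('n) * (\<Sum>k\<in>UNIV. B k)"
    using B_nonneg by (intro mult_nonneg_nonneg sum_nonneg) auto
  ultimately show ?thesis by blast
qed

context truncated_levy
begin

lemma cutoff_approx:
  assumes f: "f \<in> Lp_space p"
    and g: "\<And>k. g k \<in> Lp_space p" "\<And>k. represents (g k) (frac_deriv_distr \<nu> k f)" and "0 < \<epsilon>"
  shows "\<exists>\<eta>\<in>test_functions. Lp_mass p (\<lambda>x. f x - \<eta> x * f x) < \<epsilon> \<and>
    (\<forall>k. \<exists>e\<in>Lp_space p. represents e (frac_deriv_distr \<nu> k (\<lambda>x. \<eta> x * f x)) \<and>
      Lp_mass p (\<lambda>x. g k x - e x) < \<epsilon>)"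
proof -
  have sf: "sigma_finite_measure \<mu>" ..
  obtain \<omega> :: "real ^ 'n \<Rightarrow> real" where \<omega>: "\<omega> \<in> test_functions" "\<omega> 0 = 1" "\<And>x. \<bar>\<omega> x\<bar> \<le> 1"
    using cutoff_exists by blast
  obtain L where L: "0 \<le> L" "\<And>x y. \<bar>\<omega> x - \<omega> y\<bar> \<le> L * norm (x - y)"
    using test_function_Lipschitz[OF \<omega>(1)] by blast
  define \<eta> where "\<eta> n x = \<omega> (0 + (1 / real (Suc n)) *\<^sub>R x)" for n x
  have \<eta>: "\<eta> n \<in> test_functions" for n
    unfolding \<eta>_def by (intro test_function_affine \<omega>) simp
  note \<eta>_measurable [measurable] = smooth_borel_measurable[OF test_function_smooth[OF \<eta>]]
  have \<eta>_bound: "\<bar>\<eta> n x\<bar> \<le> 1" for n x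
    using \<omega>(3) by (simp add: \<eta>_def)
  have \<eta>_lim: "(\<lambda>n. \<eta> n x) \<longlonglongrightarrow> 1" for x
  proof -
    have "(\<lambda>n. (1 / real (Suc n)) *\<^sub>R x) \<longlonglongrightarrow> 0 *\<^sub>R x"
      by (intro tendsto_scaleR tendsto_const) (use LIMSEQ_inverse_real_of_nat in \<open>simp add: inverse_eq_divide\<close>)
    moreover have "isCont \<omega> 0"
      using smooth_continuous_on[OF test_function_smooth[OF \<omega>(1)]] by (simp add: continuous_on_eq_continuous_at)
    ultimately show ?thesis
      using \<omega>(2) isCont_tendsto_compose[of 0 \<omega>] by (simp add: \<eta>_def)
  qed
  have cut_lim: "(\<lambda>n. Lp_mass p (\<lambda>x. h x - \<eta> n x * h x)) \<longlonglongrightarrow> 0" if h: "h \<in> Lp_space p" for h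
  proof -
    note [measurable] = Lp_measurable[OF h]
    \<comment> \<open>Twice h, written as a sum, dominates the difference because |\<eta>| \<le>
      1.\<close>
    have 2: "(\<lambda>x. h x + h x) \<in> Lp_space p"
      using h p by (intro Lp_add) auto
    show ?thesis
    proof (rule Lp_tendsto[OF _ _ _ _ 2])
      have "(\<lambda>n. \<eta> n x * h x) \<longlonglongrightarrow> 1 * h x" for x
        by (intro tendsto_intros \<eta>_lim)
      then show "AE x in lborel. (\<lambda>n. \<eta> n x * h x) \<longlonglongrightarrow> h x" by simp
      show "\<bar>h x - \<eta> n x * h x\<bar> \<le> \<bar>h x + h x\<bar>" for n x
      proof -
        have "\<bar>\<eta> n x * h x\<bar> \<le> 1 * \<bar>h x\<bar>"
          unfolding abs_mult using \<eta>_bound by (intro mult_right_mono) auto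
        then show ?thesis by linarith
      qed
    qed (use p in auto)
  qed
  have cut_Lp: "(\<lambda>x. \<eta> n x * h x) \<in> Lp_space p" if h: "h \<in> Lp_space p" for n h
  proof -
    note [measurable] = Lp_measurable[OF h]
    show ?thesis
      using p \<eta>_bound by (intro Lp_dominated[OF h]) (auto simp: abs_mult mult_left_le_one_le)
  qed
  \<comment> \<open>Majorant of the commutator kernel: the 2 comes from |\<eta>| \<le> 1, the other
    bound from the Lipschitz constant of \<omega> and the dilation.\<close>
  define \<kappa> where "\<kappa> k n u = min 2 (L * norm u / real (Suc n)) * \<bar>\<theta> k u\<bar>" for k n u
  have \<kappa>_measurable [measurable]: "\<kappa> k n \<in> borel_measurable borel" for k n
    unfolding \<kappa>_def by measurable
  have \<kappa>_nonneg: "0 \<le> \<kappa> k n u" for k n u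
    using L(1) by (simp add: \<kappa>_def)
  \<comment> \<open>A dominating constant, integrable because \<mu> is finite. Near 0 the factor L
    |u| cancels \<theta>, which is at most 1/|u| there; for |u| \<ge> 1 the first factor is at most
    2 and |\<theta>| at most 1.\<close>
  have \<kappa>_bound: "\<kappa> k n u \<le> 2 + L" for k n u
  proof -
    have "L * norm u / real (Suc n) \<le> L * norm u / 1"
      using L(1) by (intro divide_left_mono) auto
    then have "L * norm u / real (Suc n) \<le> (2 + L) * norm u"
      by (rule order_trans) (simp add: distrib_right)
    then have "min 2 (L * norm u / real (Suc n)) \<le> (2 + L) * min 1 (norm u)"
      using L(1) by (cases "norm u \<le> 1") (auto simp: min_def)
    then have "\<kappa> k n u \<le> ((2 + L) * min 1 (norm u)) * \<bar>\<theta> k u\<bar>"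
      unfolding \<kappa>_def by (intro mult_right_mono) auto
    also have "\<dots> = (2 + L) * (\<bar>\<theta> k u\<bar> * min 1 (norm u))"
      by (simp add: mult_ac)
    also have "\<dots> \<le> (2 + L) * 1"
      using L(1) \<theta>_bound by (intro mult_left_mono) auto
    finally show ?thesis by simp
  qed
  have \<kappa>_int: "integrable \<mu> (\<kappa> k n)" for k n
    by (rule integrable_const_bound[where B = "2 + L"]) (use \<kappa>_bound \<kappa>_nonneg in auto)
  have \<kappa>_lim: "(\<lambda>n. LINT u|\<mu>. \<kappa> k n u) \<longlonglongrightarrow> 0" for k
  proof -
    have "(\<lambda>n. LINT u|\<mu>. \<kappa> k n u) \<longlonglongrightarrow> (LINT u|\<mu>. 0)"
    proof (rule integral_dominated_convergence)
      have "(\<lambda>n. \<kappa> k n u) \<longlonglongrightarrow> min 2 (L * norm u * 0) * \<bar>\<theta> k u\<bar>" for u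
        unfolding \<kappa>_def divide_inverse
        by (intro tendsto_intros LIMSEQ_inverse_real_of_nat)
      then show "AE u in \<mu>. (\<lambda>n. \<kappa> k n u) \<longlonglongrightarrow> 0" by simp
      show "AE u in \<mu>. norm (\<kappa> k n u) \<le> 2 + L" for n
        using \<kappa>_bound \<kappa>_nonneg by simp
    qed auto
    then show ?thesis by simp
  qed
  define T where "T k n x = (LINT u|\<mu>. f (x + u) * ((\<eta> n (x + u) - \<eta> n x) * \<theta> k u))" for k n x
  have K: "\<bar>(\<eta> n (x + u) - \<eta> n x) * \<theta> k u\<bar> \<le> \<kappa> k n u" for k n x u
  proof -
    have "\<bar>\<eta> n (x + u) - \<eta> n x\<bar> \<le> L * norm u / real (Suc n)"
      using L(2)[of "(1 / real (Suc n)) *\<^sub>R (x + u)" "(1 / real (Suc n)) *\<^sub>R x"]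
      by (simp add: \<eta>_def flip: scaleR_diff_right)
    moreover have "\<bar>\<eta> n (x + u) - \<eta> n x\<bar> \<le> 2"
      using \<eta>_bound[of n "x + u"] \<eta>_bound[of n x] by linarith
    ultimately show ?thesis
      unfolding \<kappa>_def abs_mult by (intro mult_right_mono) auto
  qed
  have T_meas: "(\<lambda>(x, u). (\<eta> n (x + u) - \<eta> n x) * \<theta> k u) \<in> borel_measurable (borel \<Otimes>\<^sub>M \<mu>)" for k n
    by measurable
  have id_meas: "(\<lambda>u. u) \<in> \<mu> \<rightarrow>\<^sub>M borel"
    by measurable
  have T_Lp: "T k n \<in> Lp_space p" for k n
    unfolding T_def by (rule Lp_kernel[OF sf f p \<kappa>_int \<kappa>_nonneg id_meas T_meas K])
  have T_mass: "Lp_mass p (T k n) \<le> (LINT u|\<mu>. \<kappa> k n u) powr p * Lp_mass p f" for k n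
    unfolding T_def by (rule Lp_mass_kernel[OF sf f p \<kappa>_int \<kappa>_nonneg id_meas T_meas K])
  have T_lim: "(\<lambda>n. Lp_mass p (T k n)) \<longlonglongrightarrow> 0" for k
  proof (rule tendsto_sandwich[OF _ _ tendsto_const])
    have "(\<lambda>n. (LINT u|\<mu>. \<kappa> k n u) powr p * Lp_mass p f) \<longlonglongrightarrow> 0 powr p * Lp_mass p f"
      using p \<kappa>_nonneg by (intro tendsto_mult tendsto_powr' tendsto_const \<kappa>_lim) (auto intro!: always_eventually integral_nonneg_AE)
    then show "(\<lambda>n. (LINT u|\<mu>. \<kappa> k n u) powr p * Lp_mass p f) \<longlonglongrightarrow> 0" by simp
  qed (use T_mass in \<open>auto simp: Lp_mass_nonneg\<close>)
  define e where "e k n x = \<eta> n x * g k x + T k n x" for k n x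
  have e_Lp: "e k n \<in> Lp_space p" for k n
    unfolding e_def using p by (intro Lp_add cut_Lp g T_Lp) auto
  have e_rep: "represents (e k n) (frac_deriv_distr \<nu> k (\<lambda>x. \<eta> n x * f x))" for k n
    using represents_cutoff[OF f g(1)[of k] g(2)[of k] \<eta>[of n]] T_Lp[of k n] by (simp add: e_def[abs_def] T_def[abs_def])
  have e_mass: "Lp_mass p (\<lambda>x. g k x - e k n x) \<le>
      2 powr p * (Lp_mass p (\<lambda>x. g k x - \<eta> n x * g k x) + Lp_mass p (T k n))" for k n
    using Lp_mass_diff[OF Lp_diff[OF g(1)[of k] cut_Lp[OF g(1)[of k]]] T_Lp[of k n]] p
    by (simp add: e_def algebra_simps)
  have e_lim: "(\<lambda>n. Lp_mass p (\<lambda>x. g k x - e k n x)) \<longlonglongrightarrow> 0" for k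
  proof (rule tendsto_sandwich[OF _ _ tendsto_const])
    have "(\<lambda>n. 2 powr p * (Lp_mass p (\<lambda>x. g k x - \<eta> n x * g k x) + Lp_mass p (T k n))) \<longlonglongrightarrow> 2 powr p * (0 + 0)"
      by (intro tendsto_intros cut_lim g T_lim)
    then show "(\<lambda>n. 2 powr p * (Lp_mass p (\<lambda>x. g k x - \<eta> n x * g k x) + Lp_mass p (T k n))) \<longlonglongrightarrow> 0" by simp
  qed (use e_mass in \<open>auto simp: Lp_mass_nonneg\<close>)
  have "\<forall>\<^sub>F n in sequentially. \<forall>k. Lp_mass p (\<lambda>x. g k x - e k n x) < \<epsilon>"
    using order_tendstoD(2)[OF e_lim \<open>0 < \<epsilon>\<close>] by (rule eventually_all_finite)
  then have "\<forall>\<^sub>F n in sequentially. Lp_mass p (\<lambda>x. f x - \<eta> n x * f x) < \<epsilon> \<and>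
      (\<forall>k. Lp_mass p (\<lambda>x. g k x - e k n x) < \<epsilon>)"
    using order_tendstoD(2)[OF cut_lim[OF f] \<open>0 < \<epsilon>\<close>] by (rule eventually_conj[rotated])
  \<comment> \<open>One n serves f and all components of the gradient, as there are finitely
    many.\<close>
  then obtain n where "Lp_mass p (\<lambda>x. f x - \<eta> n x * f x) < \<epsilon>" "\<And>k. Lp_mass p (\<lambda>x. g k x - e k n x) < \<epsilon>"
    by (auto dest!: eventually_happens)
  then show ?thesis
    using \<eta>[of n] e_Lp[of _ n] e_rep[of _ n] by (intro bexI[of _ "\<eta> n"]) auto
qed

text \<open>For fixed y the shift by y is moved from f to D^*\<phi>, which becomes D^* of a
  translate of \<phi>. The translate is again Schwartz, so g may replace f; integrating over y with
  weight \<rho> gives the claim.\<close>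

lemma represents_convol:
  assumes f: "f \<in> Lp_space p" and g: "g \<in> Lp_space p" "represents g (frac_deriv_distr \<nu> k f)"
    and \<rho>: "\<rho> \<in> test_functions"
  shows "represents (convol g \<rho>) (frac_deriv_distr \<nu> k (convol f \<rho>))"
  unfolding represents_def
proof
  fix \<phi> :: "real ^ 'n \<Rightarrow> real"
  assume \<phi>: "\<phi> \<in> schwartz_space"
  note \<phi>_meas [measurable] = schwartz_measurable[OF \<phi>]
  note [measurable] = smooth_borel_measurable[OF test_function_smooth[OF \<rho>]]
    Lp_measurable[OF f] Lp_measurable[OF g(1)]
  have adj_meas [measurable]: "frac_deriv_adj \<nu> k \<phi> \<in> borel_measurable borel"
    using borel_measurable_integrable[OF adj_integrable[OF \<phi>]] by simp
  have sf: "sigma_finite_measure (lborel :: (real ^ 'n) measure)"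
    by (rule sigma_finite_lborel)
  obtain B where "\<And>x. \<bar>LINT u|\<mu>. (\<phi> (x + - u) - \<phi> x) * \<theta> k u\<bar> \<le> B"
    using kernel_integral_bounded[OF \<phi>, of uminus k] by auto
  then have B: "\<bar>frac_deriv_adj \<nu> k \<phi> x\<bar> \<le> B" for x
    using adj_schwartz[OF \<phi>] by simp
  obtain B' where B': "\<And>x. \<bar>\<phi> x\<bar> \<le> B'"
    using schwartz_bounded[OF \<phi>] by blast
  \<comment> \<open>The shifts \<open>- y\<close> and \<open>0\<close> are written out to match
    \<open>shifted_product_integrable\<close>.\<close>
  have g_eq: "(LINT y|lborel. g (x + - y) * \<phi> (x + 0) * \<rho> y) = convol g \<rho> x * \<phi> x" for x
    unfolding convol_def by (subst integral_mult_left_zero[symmetric]) (simp add: mult_ac)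
  have "frac_deriv_distr \<nu> k (convol f \<rho>) \<phi> =
      (LINT x|lborel. LINT y|lborel. f (x + - y) * frac_deriv_adj \<nu> k \<phi> (x + 0) * \<rho> y)"
    unfolding frac_deriv_distr_def convol_def
    by (intro Bochner_Integration.integral_cong refl, subst integral_mult_left_zero[symmetric]) (simp add: mult_ac)
  also have "\<dots> = (LINT x|lborel. LINT y|lborel. g (x + - y) * \<phi> (x + 0) * \<rho> y)"
  proof (rule iterated_integral_cong[OF sf])
    show "integrable (lborel \<Otimes>\<^sub>M lborel) (\<lambda>(x, y). f (x + - y) * frac_deriv_adj \<nu> k \<phi> (x + 0) * \<rho> y)"
      using p by (intro shifted_product_integrable[OF sf f adj_integrable[OF \<phi>] B _ test_function_integrable[OF \<rho>]]) auto
    show "integrable (lborel \<Otimes>\<^sub>M lborel) (\<lambda>(x, y). g (x + - y) * \<phi> (x + 0) * \<rho> y)"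
      using p by (intro shifted_product_integrable[OF sf g(1) schwartz_integrable[OF \<phi>] B' _ test_function_integrable[OF \<rho>]]) auto
    fix y
    have \<phi>y: "(\<lambda>x. \<phi> (y + x)) \<in> schwartz_space"
      by (rule schwartz_translate[OF \<phi>])
    have "frac_deriv_adj \<nu> k (\<lambda>x. \<phi> (y + x)) x = frac_deriv_adj \<nu> k \<phi> (x + y)" for x
      by (simp add: frac_deriv_adj_def algebra_simps)
    then have "(LINT x|lborel. f (x + - y) * frac_deriv_adj \<nu> k \<phi> x) = frac_deriv_distr \<nu> k f (\<lambda>x. \<phi> (y + x))"
      unfolding frac_deriv_distr_def
      by (subst integral_lborel_translate[of _ y, symmetric]) simp_all
    also have "\<dots> = (LINT x|lborel. g x * \<phi> (y + x))"
      using g(2) \<phi>y by (simp add: represents_def)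
    also have "\<dots> = (LINT x|lborel. g (x + - y) * \<phi> x)"
      by (subst integral_lborel_translate[of _ "- y", symmetric]) simp_all
    finally show "(LINT x|lborel. f (x + - y) * frac_deriv_adj \<nu> k \<phi> (x + 0) * \<rho> y) =
        (LINT x|lborel. g (x + - y) * \<phi> (x + 0) * \<rho> y)"
      by simp
  qed
  also have "\<dots> = (LINT x|lborel. convol g \<rho> x * \<phi> x)"
    by (simp only: g_eq)
  finally show "frac_deriv_distr \<nu> k (convol f \<rho>) \<phi> = (LINT x|lborel. convol g \<rho> x * \<phi> x)" .
qed

lemma mollifier_approx:
  assumes f: "f \<in> Lp_space p" "integrable lborel f" "\<And>x. R < norm x \<Longrightarrow> f x = 0"
    and g: "\<And>k. g k \<in> Lp_space p" "\<And>k. represents (g k) (frac_deriv_distr \<nu> k f)" and "0 < \<epsilon>"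
  shows "\<exists>\<phi>\<in>test_functions. Lp_mass p (\<lambda>x. f x - \<phi> x) < \<epsilon> \<and>
    (\<forall>k. \<exists>e\<in>Lp_space p. represents e (frac_deriv_distr \<nu> k \<phi>) \<and> Lp_mass p (\<lambda>x. g k x - e x) < \<epsilon>)"
proof -
  obtain \<delta>0 where \<delta>0: "0 < \<delta>0" "\<And>\<rho>. mollifier \<delta>0 \<rho> \<Longrightarrow> Lp_mass p (\<lambda>x. f x - convol f \<rho> x) < \<epsilon>"
    using convol_approx[OF f(1) \<open>0 < \<epsilon>\<close> p] by blast
  have "\<exists>\<delta>>0. \<forall>\<rho>. mollifier \<delta> \<rho> \<longrightarrow> Lp_mass p (\<lambda>x. g k x - convol (g k) \<rho> x) < \<epsilon>" for k
    by (rule convol_approx[OF g(1) \<open>0 < \<epsilon>\<close> p])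
  then obtain \<delta> where \<delta>: "\<And>k. 0 < \<delta> k"
    "\<And>k \<rho>. mollifier (\<delta> k) \<rho> \<Longrightarrow> Lp_mass p (\<lambda>x. g k x - convol (g k) \<rho> x) < \<epsilon>"
    by metis
  \<comment> \<open>The smallest of finitely many radii: one mollifier then works for f and for
    every component of the gradient.\<close>
  define d where "d = Min (insert \<delta>0 (range \<delta>))"
  have d: "0 < d" "d \<le> \<delta>0" "d \<le> \<delta> k" for k
    unfolding d_def using \<delta>0(1) \<delta>(1) by (subst Min_gr_iff; auto)+ (intro Min_le; auto)+
  obtain \<rho> :: "real ^ 'n \<Rightarrow> real" where \<rho>: "mollifier d \<rho>"
    using mollifier_exists[OF d(1)] by blast
  note \<rho>_test = mollifierD(1)[OF \<rho>]
  show ?thesis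
  proof (rule bexI[of _ "convol f \<rho>"], intro conjI allI)
    show "convol f \<rho> \<in> test_functions"
      using f(2,3) \<rho>_test by (rule convol_test_function)
    show "Lp_mass p (\<lambda>x. f x - convol f \<rho> x) < \<epsilon>"
      using \<delta>0(2) mollifier_mono[OF \<rho> d(2)] by blast
    fix k
    show "\<exists>e\<in>Lp_space p. represents e (frac_deriv_distr \<nu> k (convol f \<rho>)) \<and> Lp_mass p (\<lambda>x. g k x - e x) < \<epsilon>"
      using \<delta>(2)[OF mollifier_mono[OF \<rho> d(3)[of k]]] represents_convol[OF f(1) g \<rho>_test]
        convol_Lp[OF g(1) \<rho> p] by blast
  qed
qed

lemma test_function_approx:
  assumes f: "f \<in> Lp_space p"
    and g: "\<And>k. g k \<in> Lp_space p" "\<And>k. represents (g k) (frac_deriv_distr \<nu> k f)" and "0 < \<epsilon>"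
  shows "\<exists>\<phi>\<in>test_functions. Lp_mass p (\<lambda>x. f x - \<phi> x) < \<epsilon> \<and>
    (\<forall>k. \<exists>e\<in>Lp_space p. represents e (frac_deriv_distr \<nu> k \<phi>) \<and> Lp_mass p (\<lambda>x. g k x - e x) < \<epsilon>)"
proof -
  \<comment> \<open>Half of \<epsilon>, after division by the factor 2^p of the quasi-triangle
    inequality: one error from the cutoff, one from the mollification.\<close>
  define \<epsilon>' where "\<epsilon>' = \<epsilon> / (2 * 2 powr p)"
  have \<epsilon>': "0 < \<epsilon>'" "2 powr p * (\<epsilon>' + \<epsilon>') = \<epsilon>"
    using \<open>0 < \<epsilon>\<close> by (auto simp: \<epsilon>'_def)
  have tri: "Lp_mass p (\<lambda>x. a x - c x) < \<epsilon>"
    if "a \<in> Lp_space p" "b \<in> Lp_space p" "c \<in> Lp_space p"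
      "Lp_mass p (\<lambda>x. a x - b x) < \<epsilon>'" "Lp_mass p (\<lambda>x. b x - c x) < \<epsilon>'" for a b c
  proof -
    have "Lp_mass p (\<lambda>x. (a x - b x) + (b x - c x)) \<le>
        2 powr p * (Lp_mass p (\<lambda>x. a x - b x) + Lp_mass p (\<lambda>x. b x - c x))"
      using that p by (intro Lp_mass_add Lp_diff) auto
    also have "\<dots> < 2 powr p * (\<epsilon>' + \<epsilon>')"
      using that by (intro mult_strict_left_mono add_strict_mono) auto
    also note \<epsilon>'(2)
    finally show ?thesis by simp
  qed
  obtain \<eta> where \<eta>: "\<eta> \<in> test_functions" "Lp_mass p (\<lambda>x. f x - \<eta> x * f x) < \<epsilon>'"
    and "\<forall>k. \<exists>e\<in>Lp_space p. represents e (frac_deriv_distr \<nu> k (\<lambda>x. \<eta> x * f x)) \<and>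
      Lp_mass p (\<lambda>x. g k x - e x) < \<epsilon>'"
    using cutoff_approx[OF f g \<epsilon>'(1)] by blast
  then obtain e where e: "\<And>k. e k \<in> Lp_space p"
    "\<And>k. represents (e k) (frac_deriv_distr \<nu> k (\<lambda>x. \<eta> x * f x))"
    "\<And>k. Lp_mass p (\<lambda>x. g k x - e k x) < \<epsilon>'"
    by metis
  obtain R where R: "\<And>x. R < norm x \<Longrightarrow> \<eta> x = 0"
    using test_function_support[OF \<eta>(1)] by blast
  obtain B where B: "0 < B" "\<And>x. \<bar>\<eta> x\<bar> \<le> B"
    using test_function_bounded[OF \<eta>(1)] by blast
  \<comment> \<open>The factor \<eta>, bounded and integrable, turns membership in L^p into
    integrability.\<close>
  have \<eta>f_int: "integrable lborel (\<lambda>x. \<eta> x * f x)"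
    using Lp_mult_integrable[OF f test_function_integrable[OF \<eta>(1)] B(2)] p by (simp add: mult.commute)
  note [measurable] = Lp_measurable[OF f]
  have "(\<lambda>x. B * f x) \<in> Lp_space p"
    using f by (simp add: Lp_space_def abs_mult powr_mult)
  then have \<eta>f: "(\<lambda>x. \<eta> x * f x) \<in> Lp_space p"
    using \<eta>f_int B p by (elim Lp_dominated(1)) (auto simp: abs_mult intro!: mult_right_mono)
  obtain \<phi> where \<phi>: "\<phi> \<in> test_functions" "Lp_mass p (\<lambda>x. \<eta> x * f x - \<phi> x) < \<epsilon>'"
    and d: "\<forall>k. \<exists>d\<in>Lp_space p. represents d (frac_deriv_distr \<nu> k \<phi>) \<and> Lp_mass p (\<lambda>x. e k x - d x) < \<epsilon>'"
    using mollifier_approx[OF \<eta>f \<eta>f_int _ e(1,2) \<epsilon>'(1), of R] R by auto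
  have "\<exists>d\<in>Lp_space p. represents d (frac_deriv_distr \<nu> k \<phi>) \<and> Lp_mass p (\<lambda>x. g k x - d x) < \<epsilon>" for k
  proof -
    obtain d where "d \<in> Lp_space p" "represents d (frac_deriv_distr \<nu> k \<phi>)" "Lp_mass p (\<lambda>x. e k x - d x) < \<epsilon>'"
      using d by blast
    then show ?thesis
      using tri[OF g(1)[of k] e(1)[of k] _ e(3)] by blast
  qed
  moreover have "Lp_mass p (\<lambda>x. f x - \<phi> x) < \<epsilon>"
    using tri[OF f \<eta>f _ \<eta>(2) \<phi>(2)] test_function_Lp[OF \<phi>(1)] p by simp
  ultimately show ?thesis
    using \<phi>(1) by blast
qed

text \<open>For the inclusion of the closure a single approximant is enough, say for accuracy 1: f
  is the sum of f - \<phi> and the test function \<phi>, and both lie in the space.\<close>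

lemma frac_sobolev_eq_closure: "frac_sobolev \<nu> p = frac_sobolev_closure \<nu> p test_functions"
proof (intro equalityI subsetI)
  fix f
  assume "f \<in> frac_sobolev \<nu> p"
  then have f: "f \<in> Lp_space p" and "\<forall>k. \<exists>g\<in>Lp_space p. represents g (frac_deriv_distr \<nu> k f)"
    by (auto simp: frac_sobolev_def)
  then obtain g where g: "\<And>k. g k \<in> Lp_space p" "\<And>k. represents (g k) (frac_deriv_distr \<nu> k f)"
    by metis
  have "\<exists>\<phi>\<in>test_functions. (\<lambda>x. f x - \<phi> x) \<in> frac_sobolev \<nu> p \<and> frac_sobolev_norm \<nu> p (\<lambda>x. f x - \<phi> x) < \<epsilon>"
    if "0 < \<epsilon>" for \<epsilon>
  proof -
    \<comment> \<open>The p-th power of the norm has 1 + \<open>CARD('n)\<close> contributions: the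
      function and each component of its gradient.\<close>
    define \<epsilon>' where "\<epsilon>' = \<epsilon> powr p / (1 + real CARD('n))"
    have "0 < \<epsilon>'" "(1 + real CARD('n)) * \<epsilon>' = \<epsilon> powr p"
      using that by (auto simp: \<epsilon>'_def add_pos_nonneg)
    obtain \<phi> where \<phi>: "\<phi> \<in> test_functions" "Lp_mass p (\<lambda>x. f x - \<phi> x) < \<epsilon>'"
      and "\<forall>k. \<exists>e\<in>Lp_space p. represents e (frac_deriv_distr \<nu> k \<phi>) \<and> Lp_mass p (\<lambda>x. g k x - e x) < \<epsilon>'"
      using test_function_approx[OF f g \<open>0 < \<epsilon>'\<close>] by blast
    then obtain e where e: "\<And>k. e k \<in> Lp_space p" "\<And>k. represents (e k) (frac_deriv_distr \<nu> k \<phi>)"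
      "\<And>k. Lp_mass p (\<lambda>x. g k x - e k x) < \<epsilon>'"
      by metis
    have \<phi>p: "\<phi> \<in> Lp_space p"
      using \<phi> p by (intro test_function_Lp) auto
    have f\<phi>: "(\<lambda>x. f x - \<phi> x) \<in> Lp_space p"
      using f \<phi>p p by (intro Lp_diff) auto
    have d: "(\<lambda>x. g k x - e k x) \<in> Lp_space p"
      "represents (\<lambda>x. g k x - e k x) (frac_deriv_distr \<nu> k (\<lambda>x. f x - \<phi> x))" for k
      using g e p by (auto intro!: Lp_diff represents_diff f \<phi>p)
    have "frac_sobolev_norm \<nu> p (\<lambda>x. f x - \<phi> x) =
        (Lp_mass p (\<lambda>x. f x - \<phi> x) + (\<Sum>k\<in>UNIV. Lp_mass p (\<lambda>x. g k x - e k x))) powr (1 / p)"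
      by (rule frac_sobolev_norm_eq[OF f\<phi> d])
    also have "\<dots> < ((1 + real CARD('n)) * \<epsilon>') powr (1 / p)"
    proof (rule powr_less_mono2)
      have "(\<Sum>k\<in>UNIV. Lp_mass p (\<lambda>x. g k x - e k x)) \<le> (\<Sum>k\<in>(UNIV :: 'n set). \<epsilon>')"
        using e(3) by (intro sum_mono less_imp_le)
      then show "Lp_mass p (\<lambda>x. f x - \<phi> x) + (\<Sum>k\<in>UNIV. Lp_mass p (\<lambda>x. g k x - e k x)) <
          (1 + real CARD('n)) * \<epsilon>'"
        using \<phi>(2) by (simp add: distrib_right)
      show "0 \<le> Lp_mass p (\<lambda>x. f x - \<phi> x) + (\<Sum>k\<in>UNIV. Lp_mass p (\<lambda>x. g k x - e k x))"
        by (intro add_nonneg_nonneg sum_nonneg Lp_mass_nonneg)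
    qed (use p in simp)
    also have "\<dots> = \<epsilon>"
      using \<open>(1 + real CARD('n)) * \<epsilon>' = \<epsilon> powr p\<close> that p by (simp add: powr_powr)
    finally have "frac_sobolev_norm \<nu> p (\<lambda>x. f x - \<phi> x) < \<epsilon>" .
    moreover have "(\<lambda>x. f x - \<phi> x) \<in> frac_sobolev \<nu> p"
      using f\<phi> d by (auto simp: frac_sobolev_def)
    ultimately show ?thesis
      using \<phi>(1) by blast
  qed
  then show "f \<in> frac_sobolev_closure \<nu> p test_functions"
    using f by (simp add: frac_sobolev_closure_def)
next
  fix f
  assume "f \<in> frac_sobolev_closure \<nu> p test_functions"
  then obtain \<phi> where f: "f \<in> Lp_space p" and \<phi>: "\<phi> \<in> test_functions"
    and f\<phi>: "(\<lambda>x. f x - \<phi> x) \<in> frac_sobolev \<nu> p"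
    unfolding frac_sobolev_closure_def using zero_less_one by blast
  \<comment> \<open>\<phi> is added back by subtracting -\<phi>, in order to use
    \<open>represents_diff\<close>; as a product with a constant, -\<phi> is a test function by
    \<open>test_function_mult\<close>.\<close>
  have "(\<lambda>x. \<phi> x * - 1) \<in> test_functions"
    by (intro test_function_mult \<phi> smooth_const)
  then have "(\<lambda>x. \<phi> x * - 1) \<in> frac_sobolev \<nu> p"
    using schwartz_frac_sobolev test_functions_subset_schwartz by blast
  then have "\<exists>g\<in>Lp_space p. represents g (frac_deriv_distr \<nu> k f)" for k
  proof -
    obtain a where a: "a \<in> Lp_space p" "represents a (frac_deriv_distr \<nu> k (\<lambda>x. f x - \<phi> x))"
      using f\<phi> by (auto simp: frac_sobolev_def)
    obtain b where b: "b \<in> Lp_space p" "represents b (frac_deriv_distr \<nu> k (\<lambda>x. \<phi> x * - 1))"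
      using \<open>(\<lambda>x. \<phi> x * - 1) \<in> frac_sobolev \<nu> p\<close> by (auto simp: frac_sobolev_def)
    have "represents (\<lambda>x. a x - b x) (frac_deriv_distr \<nu> k (\<lambda>x. (f x - \<phi> x) - \<phi> x * - 1))"
      using f\<phi> \<open>(\<lambda>x. \<phi> x * - 1) \<in> frac_sobolev \<nu> p\<close>
      by (intro represents_diff a b) (auto simp: frac_sobolev_def)
    then show ?thesis
      using Lp_diff[OF a(1) b(1)] p by auto
  qed
  then show "f \<in> frac_sobolev \<nu> p"
    using f by (simp add: frac_sobolev_def)
qed

end

section \<open>Polar coordinates and moments of the stable Levy measure\<close>

text \<open>The Levy measure is specified on sets only. It is identified with the image, under (y,
  r) -> r y, of a density on the product of \<sigma> and Lebesgue measure; change of variables then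
  extends the polar formula to functions.\<close>

lemma nn_integral_stable_levy:
  fixes \<sigma> \<nu> :: "(real ^ 'n::finite) measure" and h :: "real ^ 'n \<Rightarrow> ennreal"
  assumes \<nu>: "symmetric_stable_levy_measure \<alpha> \<sigma> \<nu>" and [measurable]: "h \<in> borel_measurable borel"
  shows "(\<integral>\<^sup>+u. h u \<partial>\<nu>) =
    (\<integral>\<^sup>+y. (\<integral>\<^sup>+r. ennreal (indicator {0<..} r / r powr (\<alpha> + 1)) * h (r *\<^sub>R y) \<partial>lborel) \<partial>\<sigma>)"
proof -
  have \<sigma>: "finite_measure \<sigma>" "sets \<sigma> = sets (restrict_space borel (sphere 0 1))"
    using \<nu> by (auto simp: symmetric_stable_levy_measure_def symmetric_spherical_measure_def)
  interpret \<sigma>: finite_measure \<sigma> by fact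
  interpret P: pair_sigma_finite \<sigma> "lborel :: real measure" ..
  \<comment> \<open>\<sigma> lives on the Borel sets of the sphere; the inclusion map makes its
    points vectors of the whole space.\<close>
  have [measurable]: "(\<lambda>y. y) \<in> \<sigma> \<rightarrow>\<^sub>M borel"
    by (subst measurable_cong_sets[OF \<sigma>(2) refl]) (simp add: measurable_restrict_space1)
  define D where "D = density (\<sigma> \<Otimes>\<^sub>M lborel) (\<lambda>(y, r). ennreal (indicator {0<..} r / r powr (\<alpha> + 1)))"
  have polar: "(\<integral>\<^sup>+u. f u \<partial>distr D borel (\<lambda>(y, r). r *\<^sub>R y)) =
      (\<integral>\<^sup>+y. (\<integral>\<^sup>+r. ennreal (indicator {0<..} r / r powr (\<alpha> + 1)) * f (r *\<^sub>R y) \<partial>lborel) \<partial>\<sigma>)"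
    if [measurable]: "f \<in> borel_measurable borel" for f :: "real ^ 'n \<Rightarrow> ennreal"
    unfolding D_def
    by (simp add: nn_integral_distr nn_integral_density split_beta lborel.nn_integral_fst[symmetric])
  have "\<nu> = distr D borel (\<lambda>(y, r). r *\<^sub>R y)"
  proof (rule measure_eqI)
    show "sets \<nu> = sets (distr D borel (\<lambda>(y, r). r *\<^sub>R y))"
      using \<nu> by (simp add: symmetric_stable_levy_measure_def)
    fix B
    assume "B \<in> sets \<nu>"
    then have B [measurable]: "B \<in> sets borel"
      using \<nu> by (simp add: symmetric_stable_levy_measure_def)
    have "emeasure (distr D borel (\<lambda>(y, r). r *\<^sub>R y)) B = (\<integral>\<^sup>+u. indicator B u \<partial>distr D borel (\<lambda>(y, r). r *\<^sub>R y))"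
      using B by simp
    also have "\<dots> = (\<integral>\<^sup>+y. (\<integral>\<^sup>+r. ennreal (indicator {0<..} r / r powr (\<alpha> + 1)) * indicator B (r *\<^sub>R y) \<partial>lborel) \<partial>\<sigma>)"
      by (rule polar) measurable
    also have "\<dots> = emeasure \<nu> B"
      using \<nu> B unfolding symmetric_stable_levy_measure_def
      by (auto intro!: nn_integral_cong simp: indicator_def)
    finally show "emeasure \<nu> B = emeasure (distr D borel (\<lambda>(y, r). r *\<^sub>R y)) B" by simp
  qed
  then show ?thesis
    using polar[of h] by simp
qed

text \<open>On a ray in a unit direction the two ends separate: r^2 / r^(\<alpha>+1) is integrable
  near 0 because \<alpha> < 2, and r / r^(\<alpha>+1) near infinity because \<alpha> > 1. The bound
  is the same for all directions, and \<sigma> is finite.\<close>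

lemma stable_levy_truncated_moment:
  fixes \<sigma> \<nu> :: "(real ^ 'n::finite) measure"
  assumes \<alpha>: "1 < \<alpha>" "\<alpha> < 2" and \<nu>: "symmetric_stable_levy_measure \<alpha> \<sigma> \<nu>"
  shows "(\<integral>\<^sup>+u. ennreal (min (norm u) ((norm u)\<^sup>2)) \<partial>\<nu>) < \<infinity>"
proof -
  have \<sigma>: "finite_measure \<sigma>" "sets \<sigma> = sets (restrict_space borel (sphere 0 1))"
    using \<nu> by (auto simp: symmetric_stable_levy_measure_def symmetric_spherical_measure_def)
  interpret \<sigma>: finite_measure \<sigma> by fact
  have space_\<sigma>: "space \<sigma> = sphere 0 1"
    using sets_eq_imp_space_eq[OF \<sigma>(2)] by (simp add: space_restrict_space)
  \<comment> \<open>Equal to 1/(2 - \<alpha>) + 1/(\<alpha> - 1), in the shape in which the two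
    power integrals arise.\<close>
  define K where "K = 1 powr (1 - \<alpha> + 1) / (1 - \<alpha> + 1) + - (1 powr (- \<alpha> + 1)) / (- \<alpha> + 1)"
  have le: "(\<integral>\<^sup>+r. ennreal (indicator {0<..} r / r powr (\<alpha> + 1)) *
      ennreal (min (norm (r *\<^sub>R y)) ((norm (r *\<^sub>R y))\<^sup>2)) \<partial>lborel) \<le> ennreal K"
    if "y \<in> space \<sigma>" for y
  proof -
    have y: "norm y = 1"
      using that by (simp add: space_\<sigma>)
    have "(\<integral>\<^sup>+r. ennreal (indicator {0<..} r / r powr (\<alpha> + 1)) *
        ennreal (min (norm (r *\<^sub>R y)) ((norm (r *\<^sub>R y))\<^sup>2)) \<partial>lborel) \<le>
      (\<integral>\<^sup>+r. ennreal (r powr (1 - \<alpha>)) * indicator {0..1} r + ennreal (r powr (- \<alpha>)) * indicator {1..} r \<partial>lborel)"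
    proof (intro nn_integral_mono)
      fix r :: real
      show "ennreal (indicator {0<..} r / r powr (\<alpha> + 1)) * ennreal (min (norm (r *\<^sub>R y)) ((norm (r *\<^sub>R y))\<^sup>2)) \<le>
          ennreal (r powr (1 - \<alpha>)) * indicator {0..1} r + ennreal (r powr (- \<alpha>)) * indicator {1..} r"
      proof (cases "0 < r")
        case True
        have r2: "r\<^sup>2 / r powr (\<alpha> + 1) = r powr (1 - \<alpha>)" and r1: "r / r powr (\<alpha> + 1) = r powr (- \<alpha>)"
          using True powr_diff[of r 2 "\<alpha> + 1"] powr_diff[of r 1 "\<alpha> + 1"] by simp_all
        have "ennreal (indicator {0<..} r / r powr (\<alpha> + 1)) * ennreal (min (norm (r *\<^sub>R y)) ((norm (r *\<^sub>R y))\<^sup>2)) =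
            ennreal (min r (r\<^sup>2) / r powr (\<alpha> + 1))"
          using True by (simp add: y flip: ennreal_mult)
        also have "\<dots> \<le> ennreal (r powr (1 - \<alpha>)) * indicator {0..1} r + ennreal (r powr (- \<alpha>)) * indicator {1..} r"
        proof (cases "r \<le> 1")
          case True
          have "min r (r\<^sup>2) / r powr (\<alpha> + 1) \<le> r powr (1 - \<alpha>)"
            unfolding r2[symmetric] by (intro divide_right_mono) auto
          then show ?thesis
            using True \<open>0 < r\<close> by (simp add: ennreal_leI add_increasing2)
        next
          case False
          have "min r (r\<^sup>2) / r powr (\<alpha> + 1) \<le> r powr (- \<alpha>)"
            unfolding r1[symmetric] by (intro divide_right_mono) auto
          then show ?thesis
            using False by (simp add: ennreal_leI)
        qed
        finally show ?thesis .
      qed simp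
    qed
    also have "\<dots> = (\<integral>\<^sup>+r. ennreal (r powr (1 - \<alpha>)) * indicator {0..1} r \<partial>lborel) +
        (\<integral>\<^sup>+r. ennreal (r powr (- \<alpha>)) * indicator {1..} r \<partial>lborel)"
      by (rule nn_integral_add) measurable
    also have "\<dots> = ennreal (1 powr (1 - \<alpha> + 1) / (1 - \<alpha> + 1)) + ennreal (- (1 powr (- \<alpha> + 1)) / (- \<alpha> + 1))"
      using \<alpha> by (intro arg_cong2[where f = "(+)"] nn_integral_has_integral_lebesgue'
          has_integral_powr_from_0 has_integral_powr_to_inf) auto
    also have "\<dots> = ennreal K"
      unfolding K_def using \<alpha> by (intro ennreal_plus[symmetric]) (auto simp: field_simps)
    finally show ?thesis .
  qed
  have "(\<integral>\<^sup>+u. ennreal (min (norm u) ((norm u)\<^sup>2)) \<partial>\<nu>) =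
      (\<integral>\<^sup>+y. (\<integral>\<^sup>+r. ennreal (indicator {0<..} r / r powr (\<alpha> + 1)) *
        ennreal (min (norm (r *\<^sub>R y)) ((norm (r *\<^sub>R y))\<^sup>2)) \<partial>lborel) \<partial>\<sigma>)"
    by (rule nn_integral_stable_levy[OF \<nu>]) measurable
  also have "\<dots> \<le> (\<integral>\<^sup>+y. ennreal K \<partial>\<sigma>)"
    by (intro nn_integral_mono le)
  also have "\<dots> < \<infinity>"
    by (simp add: ennreal_mult_less_top \<sigma>.emeasure_eq_measure)
  finally show ?thesis .
qed

theorem proposition3p2:
  fixes \<alpha> p :: real
    and \<sigma> \<nu> :: "(real ^ 'n::finite) measure"
  assumes "1 < \<alpha>" and "\<alpha> < 2"
    and "symmetric_stable_levy_measure \<alpha> \<sigma> \<nu>"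
    and "nondegenerate \<alpha> \<sigma>"
    and "1 < p"
  shows "frac_sobolev \<nu> p = frac_sobolev_closure \<nu> p test_functions"
proof -
  define w :: "real ^ 'n \<Rightarrow> real" where "w u = min (norm u) ((norm u)\<^sup>2)" for u
  define \<theta> where "\<theta> k u = u $ k / w u" for k and u :: "real ^ 'n"
  have sets_\<nu> [measurable_cong]: "sets \<nu> = sets borel"
    using assms(3) by (simp add: symmetric_stable_levy_measure_def)
  have w_meas [measurable]: "w \<in> borel_measurable borel"
    unfolding w_def by measurable
  have w_pos: "0 < w u" if "u \<noteq> 0" for u
    using that by (simp add: w_def)
  have w_eq: "w u = norm u * min 1 (norm u)" for u
    by (simp add: w_def min_mult_distrib_left power2_eq_square)
  interpret truncated_levy \<nu> "density \<nu> (\<lambda>u. ennreal (w u))" \<theta> p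
  proof (rule truncated_levy.intro)
    show "finite_measure (density \<nu> (\<lambda>u. ennreal (w u)))"
      using stable_levy_truncated_moment[OF assms(1-3)]
      by (intro finite_measureI) (simp add: emeasure_density w_def)
    show "\<theta> k \<in> borel_measurable borel" for k
      unfolding \<theta>_def by measurable
    show "\<bar>\<theta> k u\<bar> * min 1 (norm u) \<le> 1" for k u
    proof (cases "u = 0")
      case False
      have "\<bar>u $ k\<bar> * min 1 (norm u) \<le> w u"
        unfolding w_eq by (intro mult_right_mono component_le_norm_cart) auto
      then show ?thesis
        using w_pos[OF False] by (simp add: \<theta>_def divide_le_eq)
    qed simp
    fix \<phi> :: "real ^ 'n \<Rightarrow> real" and k x
    assume [measurable]: "\<phi> \<in> borel_measurable borel"
    have [measurable]: "(\<lambda>u. u $ k) \<in> borel_measurable (borel :: (real ^ 'n) measure)" "\<theta> k \<in> borel_measurable borel"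
      unfolding \<theta>_def by measurable
    \<comment> \<open>At u = 0 division by zero gives \<theta> the value 0, and both sides vanish;
      so the identity is pointwise and asks nothing about the mass of \<nu> at the origin.\<close>
    have w\<theta>: "w u *\<^sub>R ((\<phi> (x - u) - \<phi> x) * \<theta> k u) = (\<phi> (x - u) - \<phi> x) * u $ k" for u
      using w_pos[of u] by (cases "u = 0") (auto simp: \<theta>_def)
    have "0 \<le> w u" for u by (simp add: w_def)
    then show "frac_deriv_adj \<nu> k \<phi> x = (LINT u|density \<nu> (\<lambda>u. ennreal (w u)). (\<phi> (x - u) - \<phi> x) * \<theta> k u)"
      unfolding frac_deriv_adj_def by (subst integral_density) (auto simp only: w\<theta> AE_I2, measurable)
  qed (use assms sets_\<nu> in auto)
  show ?thesis
    by (rule frac_sobolev_eq_closure)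
qed

end
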